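(* Let $\mathbf{\Gamma}_1,\mathbf{\Gamma}_2$ be torsion-free discrete quantum groups. Then the Cartesian product $\mathbf{\Gamma}_1\times\mathbf{\Gamma}_2$ is torsion-free.
   Context: A discrete quantum group $\mathbf{\Gamma}$ means a Hopf $^*$-algebra $(\mathbb{C}[\mathbf{\Gamma}],\Delta)$ (over $\mathbb{C}$, counit $\varepsilon$) with an invariant positive state $\varphi:\mathbb{C}[\mathbf{\Gamma}]\to\mathbb{C}$, i.e. $(\mathrm{id}\otimes\varphi)\Delta(x)=\varphi(x)1=(\varphi\otimes\mathrm{id})\Delta(x)$. A corepresentation is a finite-dimensional vector space $V$ with a linear map $\delta:V\to V\otimes\mathbb{C}[\mathbf{\Gamma}]$ with $(\mathrm{id}\otimes\Delta)\delta=(\delta\otimes\mathrm{id})\delta$ and $(\mathrm{id}\otimes\varepsilon)\delta=\mathrm{id}$. It is unitary if $V$ is a Hilbert space and $\delta(\xi)^*\delta(\eta)=\langle\xi,\eta\rangle1$ for all $\xi,\eta\in V$ (where $\xi^*\eta=\langle\xi,\eta\rangle$). A coaction is a corepresentation $(A,\alpha)$ where $A$ is a (finite-dimensional) C$^*$-algebra and $\alpha:A\to A\otimes\mathbb{C}[\mathbf{\Gamma}]$ is a unital $^*$-homomorphism. For a unitary corepresentation $(V,\delta)$ the adjoint coaction on $B(V)$ is $\xi\eta^*\mapsto\delta(\xi)\delta(\eta)^*$. $\mathbf{\Gamma}$ is torsion-free if every coaction on a finite-dimensional C$^*$-algebra is equivariantly Morita equivalent to a direct sum of trivial coactions (of $\mathbb{C}$);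 equivalently, every coaction on a finite-dimensional C$^*$-algebra is isomorphic to a direct sum of adjoint coactions. The Cartesian product $\mathbf{\Gamma}_1\times\mathbf{\Gamma}_2$ is the discrete quantum group given by the tensor product Hopf $^*$-algebra $\mathbb{C}[\mathbf{\Gamma}_1]\otimes\mathbb{C}[\mathbf{\Gamma}_2]$. *)

theory Defs
  imports Complex_Main "HOL-Library.Poly_Mapping" "Jordan_Normal_Form.VS_Connect"
begin

section \<open>Complex vector spaces and complex \<open>*\<close>-algebras\<close>

class complex_vector = ab_group_add +
  fixes scaleC :: "complex \<Rightarrow> 'a \<Rightarrow> 'a"  (infixr "*\<^sub>C" 75)
  assumes scaleC_add_right: "c *\<^sub>C (x + y) = c *\<^sub>C x + c *\<^sub>C y"
    and scaleC_add_left: "(c + d) *\<^sub>C x = c *\<^sub>C x + d *\<^sub>C x"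
    and scaleC_scaleC: "c *\<^sub>C d *\<^sub>C x = (c * d) *\<^sub>C x"
    and scaleC_one: "1 *\<^sub>C x = x"

interpretation cvector: vector_space "scaleC :: complex \<Rightarrow> 'a \<Rightarrow> 'a::complex_vector"
  by unfold_locales (simp_all add: scaleC_add_right scaleC_add_left scaleC_scaleC scaleC_one)

class complex_star_algebra = complex_vector + ring_1 +
  fixes star :: "'a \<Rightarrow> 'a"
  assumes scaleC_mult_left: "(c *\<^sub>C x) * y = c *\<^sub>C (x * y)"
    and scaleC_mult_right: "x * (c *\<^sub>C y) = c *\<^sub>C (x * y)"
    and star_add: "star (x + y) = star x + star y"
    and star_scaleC: "star (c *\<^sub>C x) = cnj c *\<^sub>C star x"
    and star_mult: "star (x * y) = star y * star x"
    and star_star: "star (star x) = x"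

instantiation complex :: complex_star_algebra
begin

definition scaleC_complex :: "complex \<Rightarrow> complex \<Rightarrow> complex" where "scaleC_complex c x = c * x"

definition star_complex :: "complex \<Rightarrow> complex" where "star_complex x = cnj x"

instance
  by standard (simp_all add: scaleC_complex_def star_complex_def algebra_simps)

end

definition semilinear ::
  "(complex \<Rightarrow> complex) \<Rightarrow> ('a::complex_vector \<Rightarrow> 'b::complex_vector) \<Rightarrow> bool" where
  "semilinear \<sigma> f \<longleftrightarrow>
     (\<forall>x y. f (x + y) = f x + f y) \<and> (\<forall>c x. f (c *\<^sub>C x) = \<sigma> c *\<^sub>C f x)"

definition semibilinear ::
  "(complex \<Rightarrow> complex) \<Rightarrow>
   ('a::complex_vector \<Rightarrow> 'b::complex_vector \<Rightarrow> 'c::complex_vector) \<Rightarrow> bool" where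
  "semibilinear \<sigma> f \<longleftrightarrow> (\<forall>x. semilinear \<sigma> (f x)) \<and> (\<forall>y. semilinear \<sigma> (\<lambda>x. f x y))"

abbreviation clinear :: "('a::complex_vector \<Rightarrow> 'b::complex_vector) \<Rightarrow> bool" where
  "clinear \<equiv> semilinear (\<lambda>c. c)"

abbreviation cbilinear ::
  "('a::complex_vector \<Rightarrow> 'b::complex_vector \<Rightarrow> 'c::complex_vector) \<Rightarrow> bool" where
  "cbilinear \<equiv> semibilinear (\<lambda>c. c)"


section \<open>Algebraic tensor products\<close>

instantiation poly_mapping :: (type, complex_vector) complex_vector
begin

lift_definition scaleC_poly_mapping :: "complex \<Rightarrow> ('a \<Rightarrow>\<^sub>0 'b) \<Rightarrow> ('a \<Rightarrow>\<^sub>0 'b)"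
  is "\<lambda>c p k. c *\<^sub>C p k"
  by (erule finite_subset[rotated]) auto

instance
  by standard
    (transfer, simp add: fun_eq_iff scaleC_add_right scaleC_add_left scaleC_scaleC scaleC_one)+

end

abbreviation free_pair :: "'a \<Rightarrow> 'b \<Rightarrow> ('a \<times> 'b) \<Rightarrow>\<^sub>0 complex" where
  "free_pair a b \<equiv> Poly_Mapping.single (a, b) 1"

inductive_set bilinear_relators :: "(('a::complex_vector \<times> 'b::complex_vector) \<Rightarrow>\<^sub>0 complex) set"
  where
    "free_pair (a + a') b - free_pair a b - free_pair a' b \<in> bilinear_relators"
  | "free_pair a (b + b') - free_pair a b - free_pair a b' \<in> bilinear_relators"
  | "free_pair (c *\<^sub>C a) b - c *\<^sub>C free_pair a b \<in> bilinear_relators"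
  | "free_pair a (c *\<^sub>C b) - c *\<^sub>C free_pair a b \<in> bilinear_relators"

definition tensor_rel ::
  "(('a::complex_vector \<times> 'b::complex_vector) \<Rightarrow>\<^sub>0 complex) \<Rightarrow> (('a \<times> 'b) \<Rightarrow>\<^sub>0 complex) \<Rightarrow> bool" where
  "tensor_rel p q \<longleftrightarrow> p - q \<in> cvector.span bilinear_relators"

lemma equivp_tensor_rel:
  "equivp (tensor_rel :: (('a::complex_vector \<times> 'b::complex_vector) \<Rightarrow>\<^sub>0 complex) \<Rightarrow> _)"
proof (rule equivpI)
  show "reflp (tensor_rel :: (('a \<times> 'b) \<Rightarrow>\<^sub>0 complex) \<Rightarrow> _)"
    by (rule reflpI) (simp add: tensor_rel_def cvector.span_zero)
  show "symp (tensor_rel :: (('a \<times> 'b) \<Rightarrow>\<^sub>0 complex) \<Rightarrow> _)"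
    by (rule sympI) (metis tensor_rel_def cvector.span_neg minus_diff_eq)
  show "transp (tensor_rel :: (('a \<times> 'b) \<Rightarrow>\<^sub>0 complex) \<Rightarrow> _)"
  proof (rule transpI)
    fix p q r :: "('a \<times> 'b) \<Rightarrow>\<^sub>0 complex"
    assume "tensor_rel p q" and "tensor_rel q r"
    then have "(p - q) + (q - r) \<in> cvector.span bilinear_relators"
      unfolding tensor_rel_def by (rule cvector.span_add)
    then show "tensor_rel p r"
      unfolding tensor_rel_def by simp
  qed
qed

quotient_type (overloaded) ('a, 'b) tensor =
  "('a::complex_vector \<times> 'b::complex_vector) \<Rightarrow>\<^sub>0 complex" / tensor_rel
  by (rule equivp_tensor_rel)

instantiation tensor :: (complex_vector, complex_vector) complex_vector
begin

lift_definition zero_tensor :: "('a, 'b) tensor" is 0 .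

lift_definition plus_tensor :: "('a, 'b) tensor \<Rightarrow> ('a, 'b) tensor \<Rightarrow> ('a, 'b) tensor" is "(+)"
  unfolding tensor_rel_def add_diff_add by (rule cvector.span_add)

lift_definition uminus_tensor :: "('a, 'b) tensor \<Rightarrow> ('a, 'b) tensor" is uminus
  unfolding tensor_rel_def minus_diff_minus by (rule cvector.span_neg)

lift_definition minus_tensor :: "('a, 'b) tensor \<Rightarrow> ('a, 'b) tensor \<Rightarrow> ('a, 'b) tensor" is "(-)"
proof -
  fix p p' q q' :: "('a \<times> 'b) \<Rightarrow>\<^sub>0 complex"
  assume "tensor_rel p p'" and "tensor_rel q q'"
  then have "(p - p') - (q - q') \<in> cvector.span bilinear_relators"
    unfolding tensor_rel_def by (rule cvector.span_diff)
  moreover have "(p - p') - (q - q') = (p - q) - (p' - q')" by simp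
  ultimately show "tensor_rel (p - q) (p' - q')"
    unfolding tensor_rel_def by metis
qed

lift_definition scaleC_tensor :: "complex \<Rightarrow> ('a, 'b) tensor \<Rightarrow> ('a, 'b) tensor" is scaleC
  unfolding tensor_rel_def cvector.scale_right_diff_distrib[symmetric] by (rule cvector.span_scale)

instance
  by standard
    (transfer, simp add: tensor_rel_def cvector.span_zero algebra_simps
        scaleC_add_right scaleC_add_left scaleC_scaleC scaleC_one)+

end

lift_definition tprod :: "'a::complex_vector \<Rightarrow> 'b::complex_vector \<Rightarrow> ('a, 'b) tensor"
  (infixr "\<otimes>\<^sub>C" 72) is free_pair .

text \<open>
  The value on a tensor is computed from an arbitrary representative.  For \<open>\<sigma>\<close> the identity or
  complex conjugation and \<open>f\<close> (semi)bilinear, this is the (semi)linear map sending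
  \<open>a \<otimes>\<^sub>C b\<close> to \<open>f a b\<close>.
\<close>

definition free_eval ::
  "(complex \<Rightarrow> complex) \<Rightarrow> ('a \<Rightarrow> 'b \<Rightarrow> 'c) \<Rightarrow> (('a \<times> 'b) \<Rightarrow>\<^sub>0 complex) \<Rightarrow> 'c::complex_vector" where
  "free_eval \<sigma> f p =
     (\<Sum>k\<in>Poly_Mapping.keys p. \<sigma> (Poly_Mapping.lookup p k) *\<^sub>C f (fst k) (snd k))"

definition tensor_semilift ::
  "(complex \<Rightarrow> complex) \<Rightarrow> ('a::complex_vector \<Rightarrow> 'b::complex_vector \<Rightarrow> 'c) \<Rightarrow>
   ('a, 'b) tensor \<Rightarrow> 'c::complex_vector" where
  "tensor_semilift \<sigma> f t = free_eval \<sigma> f (rep_tensor t)"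

abbreviation tensor_lift ::
  "('a::complex_vector \<Rightarrow> 'b::complex_vector \<Rightarrow> 'c) \<Rightarrow> ('a, 'b) tensor \<Rightarrow> 'c::complex_vector" where
  "tensor_lift \<equiv> tensor_semilift (\<lambda>c. c)"


lemma ex_abs_tensor: "\<exists>p. t = abs_tensor p"
proof
  show "t = abs_tensor (rep_tensor t)" by (rule sym) (rule Quotient_abs_rep[OF Quotient_tensor])
qed

lemma clinear_iff: "clinear f \<longleftrightarrow> Vector_Spaces.linear scaleC scaleC f"
  unfolding semilinear_def Vector_Spaces.linear_iff by (simp add: cvector.vector_space_axioms)

context
  fixes \<sigma> :: "complex \<Rightarrow> complex"
  assumes \<sigma>: "\<sigma> = (\<lambda>c. c) \<or> \<sigma> = cnj"
begin

lemma semilift_scalar: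
  "\<sigma> 0 = 0" "\<sigma> 1 = 1" "\<sigma> (c + d) = \<sigma> c + \<sigma> d" "\<sigma> (c * d) = \<sigma> c * \<sigma> d"
  "\<sigma> (- c) = - \<sigma> c"
  using \<sigma> by auto

lemma free_eval_superset:
  assumes "finite S" "Poly_Mapping.keys p \<subseteq> S"
  shows "free_eval \<sigma> f p = (\<Sum>k\<in>S. \<sigma> (Poly_Mapping.lookup p k) *\<^sub>C f (fst k) (snd k))"
  unfolding free_eval_def
  by (rule sum.mono_neutral_left) (use assms in \<open>auto simp: in_keys_iff semilift_scalar\<close>)

lemma free_eval_add: "free_eval \<sigma> f (p + q) = free_eval \<sigma> f p + free_eval \<sigma> f q"
proof -
  let ?S = "Poly_Mapping.keys p \<union> Poly_Mapping.keys q"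
  have "Poly_Mapping.keys (p + q) \<subseteq> ?S" by (rule Poly_Mapping.keys_add)
  then show ?thesis
    by (simp add: free_eval_superset[of ?S] lookup_add semilift_scalar scaleC_add_left sum.distrib)
qed

lemma free_eval_scaleC: "free_eval \<sigma> f (c *\<^sub>C p) = \<sigma> c *\<^sub>C free_eval \<sigma> f p"
proof -
  have "Poly_Mapping.keys (c *\<^sub>C p) \<subseteq> Poly_Mapping.keys p"
    by (auto simp: in_keys_iff scaleC_poly_mapping.rep_eq scaleC_complex_def)
  then show ?thesis
    by (simp add: free_eval_superset[of "Poly_Mapping.keys p"] scaleC_poly_mapping.rep_eq
        scaleC_complex_def semilift_scalar cvector.scale_sum_right)
qed

lemma free_eval_uminus: "free_eval \<sigma> f (- p) = - free_eval \<sigma> f p"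
  using free_eval_add[of f p "- p"] by (simp add: free_eval_def eq_neg_iff_add_eq_0 add.commute)

lemma free_eval_diff: "free_eval \<sigma> f (p - q) = free_eval \<sigma> f p - free_eval \<sigma> f q"
  using free_eval_add[of f p "- q"] by (simp add: free_eval_uminus)

lemma free_eval_free_pair: "free_eval \<sigma> f (free_pair a b) = f a b"
  by (simp add: free_eval_def semilift_scalar scaleC_one)

lemma free_eval_tensor_rel:
  assumes f: "semibilinear \<sigma> f" and "tensor_rel p q"
  shows "free_eval \<sigma> f p = free_eval \<sigma> f q"
proof -
  have relator: "free_eval \<sigma> f r = 0" if "r \<in> bilinear_relators" for r
    using that f
    by cases (simp_all add: free_eval_diff free_eval_scaleC free_eval_free_pair
        semibilinear_def semilinear_def)
  have "free_eval \<sigma> f r = 0" if "r \<in> cvector.span bilinear_relators" for r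
    using that
  proof (induction rule: cvector.span_induct_alt)
    case base
    then show ?case by (simp add: free_eval_def)
  next
    case (step c x y)
    then show ?case by (simp add: free_eval_add free_eval_scaleC relator)
  qed
  from this[of "p - q"] show ?thesis
    using \<open>tensor_rel p q\<close> by (simp add: tensor_rel_def free_eval_diff)
qed

lemma tensor_semilift_abs:
  assumes "semibilinear \<sigma> f"
  shows "tensor_semilift \<sigma> f (abs_tensor p) = free_eval \<sigma> f p"
proof -
  have "tensor_rel (rep_tensor (abs_tensor p)) p"
    by (simp add: tensor.abs_eq_iff[symmetric] Quotient_abs_rep[OF Quotient_tensor])
  then show ?thesis
    unfolding tensor_semilift_def by (rule free_eval_tensor_rel[OF assms])
qed

lemma tensor_semilift_tprod [simp]:
  assumes "semibilinear \<sigma> f"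
  shows "tensor_semilift \<sigma> f (a \<otimes>\<^sub>C b) = f a b"
  using assms by (simp add: tprod.abs_eq tensor_semilift_abs free_eval_free_pair)

lemma semilinear_tensor_semilift:
  fixes f :: "'a::complex_vector \<Rightarrow> 'b::complex_vector \<Rightarrow> 'c::complex_vector"
  assumes "semibilinear \<sigma> f"
  shows "semilinear \<sigma> (tensor_semilift \<sigma> f)"
  unfolding semilinear_def
proof (intro conjI allI)
  fix s t :: "('a, 'b) tensor" and c
  obtain p q where "s = abs_tensor p" "t = abs_tensor q"
    using ex_abs_tensor by blast
  then show "tensor_semilift \<sigma> f (s + t) = tensor_semilift \<sigma> f s + tensor_semilift \<sigma> f t"
    and "tensor_semilift \<sigma> f (c *\<^sub>C s) = \<sigma> c *\<^sub>C tensor_semilift \<sigma> f s"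
    using assms
    by (simp_all add: plus_tensor.abs_eq scaleC_tensor.abs_eq tensor_semilift_abs
        free_eval_add free_eval_scaleC)
qed

end

context
  fixes a a' :: "'a::complex_vector" and b b' :: "'b::complex_vector" and c :: complex
begin

lemma tprod_add_left: "(a + a') \<otimes>\<^sub>C b = a \<otimes>\<^sub>C b + a' \<otimes>\<^sub>C b"
  by transfer
    (use cvector.span_base[OF bilinear_relators.intros(1)] in \<open>simp add: tensor_rel_def diff_diff_eq\<close>)

lemma tprod_add_right: "a \<otimes>\<^sub>C (b + b') = a \<otimes>\<^sub>C b + a \<otimes>\<^sub>C b'"
  by transfer
    (use cvector.span_base[OF bilinear_relators.intros(2)] in \<open>simp add: tensor_rel_def diff_diff_eq\<close>)

lemma tprod_scaleC_left: "(c *\<^sub>C a) \<otimes>\<^sub>C b = c *\<^sub>C (a \<otimes>\<^sub>C b)"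
  by transfer
    (use cvector.span_base[OF bilinear_relators.intros(3)] in \<open>simp add: tensor_rel_def\<close>)

lemma tprod_scaleC_right: "a \<otimes>\<^sub>C (c *\<^sub>C b) = c *\<^sub>C (a \<otimes>\<^sub>C b)"
  by transfer
    (use cvector.span_base[OF bilinear_relators.intros(4)] in \<open>simp add: tensor_rel_def\<close>)

end

lemma tensor_induct [case_names add tprod]:
  assumes add: "\<And>s t. P s \<Longrightarrow> P t \<Longrightarrow> P (s + t)" and tprod: "\<And>a b. P (a \<otimes>\<^sub>C b)"
  shows "P t"
proof -
  obtain p where t: "t = abs_tensor p"
    using ex_abs_tensor by blast
  have single: "abs_tensor (Poly_Mapping.single k c) = (c *\<^sub>C fst k) \<otimes>\<^sub>C snd k" for k c
  proof -
    have "Poly_Mapping.single k c = c *\<^sub>C free_pair (fst k) (snd k)"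
      by (rule poly_mapping_eqI)
        (simp add: lookup_single scaleC_poly_mapping.rep_eq scaleC_complex_def when_def)
    then have "abs_tensor (Poly_Mapping.single k c) = c *\<^sub>C (fst k \<otimes>\<^sub>C snd k)"
      by (simp add: scaleC_tensor.abs_eq tprod.abs_eq)
    then show ?thesis
      by (simp only: tprod_scaleC_left)
  qed
  have "P (abs_tensor p)"
  proof (induction p rule: update_induct)
    case const
    have "P (abs_tensor (Poly_Mapping.single (0, 0) 0))" by (simp only: single tprod)
    then show ?case by simp
  next
    case (update p k c)
    have "Poly_Mapping.update k c p = p + Poly_Mapping.single k c"
      by (rule poly_mapping_eqI)
        (use update in \<open>auto simp: lookup_update lookup_add lookup_single in_keys_iff when_def\<close>)
    then show ?case
      by (simp add: plus_tensor.abs_eq[symmetric] add single tprod update)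
  qed
  then show ?thesis by (simp add: t)
qed

interpretation cvector_pair:
  vector_space_pair "scaleC :: complex \<Rightarrow> 'a \<Rightarrow> 'a::complex_vector"
    "scaleC :: complex \<Rightarrow> 'b \<Rightarrow> 'b::complex_vector"
  by unfold_locales

lemma ex_functional:
  fixes x :: "'a::complex_vector"
  assumes "x \<noteq> 0"
  obtains f :: "'a \<Rightarrow> complex" where "clinear f" "f x = 1"
proof -
  have "cvector.independent {x}" using assms by (simp add: cvector.dependent_single)
  then obtain f :: "'a \<Rightarrow> complex" where "Vector_Spaces.linear scaleC scaleC f" "f x = 1"
    using cvector_pair.linear_independent_extend[of "{x}" "\<lambda>_. 1"] by auto
  then show thesis using that clinear_iff by blast
qed

lemma tprod_eq_0_iff: "a \<otimes>\<^sub>C b = 0 \<longleftrightarrow> a = 0 \<or> b = 0"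
proof
  assume zero: "a \<otimes>\<^sub>C b = 0"
  show "a = 0 \<or> b = 0"
  proof (rule ccontr)
    assume "\<not> (a = 0 \<or> b = 0)"
    then obtain f g where f: "clinear f" "f a = (1::complex)" and g: "clinear g" "g b = (1::complex)"
      by (metis ex_functional)
    define h where "h x y = f x * g y" for x y
    have h: "cbilinear h"
      using f g by (simp add: h_def semibilinear_def semilinear_def scaleC_complex_def algebra_simps)
    have "tensor_lift h 0 = 0"
      using semilinear_tensor_semilift[OF _ h] by (metis cvector.scale_zero_left semilinear_def)
    moreover have "tensor_lift h (a \<otimes>\<^sub>C b) = 1"
      using h f g by (simp add: h_def)
    ultimately show False using zero by simp
  qed
next
  assume "a = 0 \<or> b = 0"
  then show "a \<otimes>\<^sub>C b = 0"
    using tprod_scaleC_left[of 0 0 b] tprod_scaleC_right[of a 0 0] by auto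
qed

instantiation tensor :: (complex_star_algebra, complex_star_algebra) complex_star_algebra
begin

definition one_tensor :: "('a, 'b) tensor" where "1 = 1 \<otimes>\<^sub>C 1"

definition times_tensor :: "('a, 'b) tensor \<Rightarrow> ('a, 'b) tensor \<Rightarrow> ('a, 'b) tensor" where
  "s * t = tensor_lift (\<lambda>a b. tensor_lift (\<lambda>c d. (a * c) \<otimes>\<^sub>C (b * d)) t) s"

definition star_tensor :: "('a, 'b) tensor \<Rightarrow> ('a, 'b) tensor" where
  "star = tensor_semilift cnj (\<lambda>a b. star a \<otimes>\<^sub>C star b)"

lemma cbilinear_times_tensor: "cbilinear ((*) :: ('a, 'b) tensor \<Rightarrow> _)"
  and tprod_mult: "(a \<otimes>\<^sub>C b) * (c \<otimes>\<^sub>C d) = (a * c) \<otimes>\<^sub>C (b * d)"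
  for a c :: 'a and b d :: 'b
proof -
  have inner: "cbilinear (\<lambda>c d. (a * c) \<otimes>\<^sub>C (b * d))" for a :: 'a and b :: 'b
    by (simp add: semibilinear_def semilinear_def distrib_left tprod_add_left tprod_add_right
        tprod_scaleC_left tprod_scaleC_right scaleC_mult_right)
  note lin = semilinear_tensor_semilift[OF _ inner, simplified, unfolded semilinear_def]
  have outer: "cbilinear (\<lambda>a b. tensor_lift (\<lambda>c d. (a * c) \<otimes>\<^sub>C (b * d)) t)" for t :: "('a, 'b) tensor"
  proof (induction t rule: tensor_induct)
    case (add s t)
    then show ?case
      by (simp add: lin semibilinear_def semilinear_def scaleC_add_right algebra_simps)
  next
    case (tprod c d)
    show ?case
      by (simp add: inner) (simp add: semibilinear_def semilinear_def distrib_right tprod_add_left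
          tprod_add_right tprod_scaleC_left tprod_scaleC_right scaleC_mult_left)
  qed
  note lin' = semilinear_tensor_semilift[OF _ outer, simplified, unfolded semilinear_def]
  have tprod_times: "(a \<otimes>\<^sub>C b) * t = tensor_lift (\<lambda>c d. (a * c) \<otimes>\<^sub>C (b * d)) t"
    for a :: 'a and b :: 'b and t
    unfolding times_tensor_def by (rule tensor_semilift_tprod[OF _ outer]) simp
  show "(a \<otimes>\<^sub>C b) * (c \<otimes>\<^sub>C d) = (a * c) \<otimes>\<^sub>C (b * d)" for a c :: 'a and b d :: 'b
    by (simp add: tprod_times inner)
  have left: "(s + s') * t = s * t + s' * t" "(c *\<^sub>C s) * t = c *\<^sub>C (s * t)"
    for s s' t :: "('a, 'b) tensor" and c
    by (simp_all add: times_tensor_def lin')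
  have right: "s * (t + t') = s * t + s * t' \<and> s * (c *\<^sub>C t) = c *\<^sub>C (s * t)"
    for s t t' :: "('a, 'b) tensor" and c
  proof (induction s rule: tensor_induct)
    case (add s s')
    then show ?case by (simp add: left scaleC_add_right)
  next
    case (tprod a b)
    show ?case by (simp add: tprod_times lin)
  qed
  show "cbilinear ((*) :: ('a, 'b) tensor \<Rightarrow> _)"
    using left right by (simp add: semibilinear_def semilinear_def)
qed

lemma semilinear_star_tensor: "semilinear cnj (star :: ('a, 'b) tensor \<Rightarrow> _)"
  and star_tprod: "star (a \<otimes>\<^sub>C b) = star a \<otimes>\<^sub>C star b"
  for a :: 'a and b :: 'b
proof -
  have star: "semibilinear cnj (\<lambda>a b. star a \<otimes>\<^sub>C star b)"
    by (simp add: semibilinear_def semilinear_def star_add star_scaleC tprod_add_left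
        tprod_add_right tprod_scaleC_left tprod_scaleC_right)
  show "semilinear cnj (star :: ('a, 'b) tensor \<Rightarrow> _)"
    unfolding star_tensor_def by (rule semilinear_tensor_semilift[OF _ star]) simp
  show "star (a \<otimes>\<^sub>C b) = star a \<otimes>\<^sub>C star b" for a :: 'a and b :: 'b
    by (simp add: star_tensor_def star)
qed

instance
proof
  note lin = cbilinear_times_tensor[unfolded semibilinear_def semilinear_def]
    semilinear_star_tensor[unfolded semilinear_def]
  fix x y z :: "('a, 'b) tensor" and c :: complex
  show left: "(x + y) * z = x * z + y * z" for x y z :: "('a, 'b) tensor" by (simp add: lin)
  show right: "x * (y + z) = x * y + x * z" for x y z :: "('a, 'b) tensor" by (simp add: lin)
  show "(c *\<^sub>C x) * y = c *\<^sub>C (x * y)" and "x * (c *\<^sub>C y) = c *\<^sub>C (x * y)"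
    by (simp_all add: lin)
  show "star (x + y) = star x + star y" and "star (c *\<^sub>C x) = cnj c *\<^sub>C star x"
    by (simp_all add: lin)
  show "1 * x = x" and "x * 1 = x"
    by (induction x rule: tensor_induct) (simp_all add: left right one_tensor_def tprod_mult)
  show "(0 :: ('a, 'b) tensor) \<noteq> 1"
    by (metis one_tensor_def tprod_eq_0_iff zero_neq_one)
  show "star (star x) = x"
    by (induction x rule: tensor_induct) (simp_all add: lin star_tprod star_star)
  show "x * y * z = x * (y * z)"
  proof (induction x rule: tensor_induct)
    case (tprod a b)
    show ?case
    proof (induction y rule: tensor_induct)
      case (tprod c d)
      show ?case
        by (induction z rule: tensor_induct) (simp_all add: left right tprod_mult mult.assoc)
    qed (simp add: left right)
  qed (simp add: left right)
  show "star (x * y) = star y * star x"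
  proof (induction x rule: tensor_induct)
    case (tprod a b)
    show ?case
      by (induction y rule: tensor_induct) (simp_all add: lin tprod_mult star_tprod star_mult)
  qed (simp add: lin)
qed

end


definition tensor_map ::
  "('a::complex_vector \<Rightarrow> 'c::complex_vector) \<Rightarrow> ('b::complex_vector \<Rightarrow> 'd::complex_vector) \<Rightarrow>
   ('a, 'b) tensor \<Rightarrow> ('c, 'd) tensor" where
  "tensor_map f g = tensor_lift (\<lambda>a b. f a \<otimes>\<^sub>C g b)"

definition tensor_assoc ::
  "(('a::complex_vector, 'b::complex_vector) tensor, 'c::complex_vector) tensor \<Rightarrow>
   ('a, ('b, 'c) tensor) tensor" where
  "tensor_assoc = tensor_lift (\<lambda>s c. tensor_lift (\<lambda>a b. a \<otimes>\<^sub>C (b \<otimes>\<^sub>C c)) s)"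

definition tensor_interchange ::
  "(('a::complex_vector, 'b::complex_vector) tensor, ('c::complex_vector, 'd::complex_vector) tensor) tensor \<Rightarrow>
   (('a, 'c) tensor, ('b, 'd) tensor) tensor" where
  "tensor_interchange = tensor_lift (\<lambda>s t.
     tensor_lift (\<lambda>a b. tensor_lift (\<lambda>c d. (a \<otimes>\<^sub>C c) \<otimes>\<^sub>C (b \<otimes>\<^sub>C d)) t) s)"


section \<open>Discrete quantum groups\<close>

text \<open>The underlying \<open>*\<close>-algebra of \<open>\<complex>[\<Gamma>]\<close> is the type \<open>'a\<close>.\<close>

record (overloaded) ('a::complex_star_algebra) quantum_group =
  comult :: "'a \<Rightarrow> ('a, 'a) tensor"
  counit :: "'a \<Rightarrow> complex"
  antipode :: "'a \<Rightarrow> 'a"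
  haar :: "'a \<Rightarrow> complex"

definition hopf_star_algebra :: "'a::complex_star_algebra quantum_group \<Rightarrow> bool" where
  "hopf_star_algebra \<Gamma> \<longleftrightarrow>
     clinear (comult \<Gamma>) \<and>
     comult \<Gamma> 1 = 1 \<and>
     (\<forall>x y. comult \<Gamma> (x * y) = comult \<Gamma> x * comult \<Gamma> y) \<and>
     (\<forall>x. comult \<Gamma> (star x) = star (comult \<Gamma> x)) \<and>
     (\<forall>x. tensor_assoc (tensor_map (comult \<Gamma>) id (comult \<Gamma> x)) =
           tensor_map id (comult \<Gamma>) (comult \<Gamma> x)) \<and>
     clinear (counit \<Gamma>) \<and>
     counit \<Gamma> 1 = 1 \<and>
     (\<forall>x y. counit \<Gamma> (x * y) = counit \<Gamma> x * counit \<Gamma> y) \<and>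
     (\<forall>x. tensor_lift (\<lambda>a b. counit \<Gamma> a *\<^sub>C b) (comult \<Gamma> x) = x) \<and>
     (\<forall>x. tensor_lift (\<lambda>a b. counit \<Gamma> b *\<^sub>C a) (comult \<Gamma> x) = x) \<and>
     clinear (antipode \<Gamma>) \<and>
     (\<forall>x. tensor_lift (\<lambda>a b. antipode \<Gamma> a * b) (comult \<Gamma> x) = counit \<Gamma> x *\<^sub>C 1) \<and>
     (\<forall>x. tensor_lift (\<lambda>a b. a * antipode \<Gamma> b) (comult \<Gamma> x) = counit \<Gamma> x *\<^sub>C 1)"

definition invariant_state :: "'a::complex_star_algebra quantum_group \<Rightarrow> bool" where
  "invariant_state \<Gamma> \<longleftrightarrow>
     clinear (haar \<Gamma>) \<and>
     haar \<Gamma> 1 = 1 \<and>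
     (\<forall>x. haar \<Gamma> (star x * x) \<in> \<real> \<and> Re (haar \<Gamma> (star x * x)) \<ge> 0) \<and>
     (\<forall>x. tensor_lift (\<lambda>a b. haar \<Gamma> b *\<^sub>C a) (comult \<Gamma> x) = haar \<Gamma> x *\<^sub>C 1) \<and>
     (\<forall>x. tensor_lift (\<lambda>a b. haar \<Gamma> a *\<^sub>C b) (comult \<Gamma> x) = haar \<Gamma> x *\<^sub>C 1)"

definition discrete_quantum_group :: "'a::complex_star_algebra quantum_group \<Rightarrow> bool" where
  "discrete_quantum_group \<Gamma> \<longleftrightarrow> hopf_star_algebra \<Gamma> \<and> invariant_state \<Gamma>"

definition cartesian_product ::
  "'a::complex_star_algebra quantum_group \<Rightarrow> 'b::complex_star_algebra quantum_group \<Rightarrow>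
   ('a, 'b) tensor quantum_group" where
  "cartesian_product \<Gamma>\<^sub>1 \<Gamma>\<^sub>2 =
     \<lparr> comult = (\<lambda>x. tensor_interchange (tensor_map (comult \<Gamma>\<^sub>1) (comult \<Gamma>\<^sub>2) x)),
       counit = tensor_lift (\<lambda>a b. counit \<Gamma>\<^sub>1 a * counit \<Gamma>\<^sub>2 b),
       antipode = tensor_map (antipode \<Gamma>\<^sub>1) (antipode \<Gamma>\<^sub>2),
       haar = tensor_lift (\<lambda>a b. haar \<Gamma>\<^sub>1 a * haar \<Gamma>\<^sub>2 b) \<rparr>"



section \<open>Coactions on finite-dimensional C*-algebras\<close>

text \<open>
  Every finite-dimensional space is identified with \<open>\<complex>\<^sup>n\<close>, that is \<open>carrier_vec n\<close>, by a choice of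
  basis, and \<open>\<complex>\<^sup>n \<otimes> H\<close> with \<open>H\<^sup>n\<close>: a vector \<open>x\<close> over \<open>H\<close> stands for the sum of
  \<open>e\<^sub>i \<otimes> x $ i\<close>, where \<open>e\<^sub>i = unit_vec n i\<close>.  The behaviour of functions outside the carriers is
  irrelevant.
\<close>

definition vec_semilinear ::
  "(complex \<Rightarrow> complex) \<Rightarrow> nat \<Rightarrow> nat \<Rightarrow> (complex vec \<Rightarrow> 'h::complex_vector vec) \<Rightarrow> bool" where
  "vec_semilinear \<sigma> n m f \<longleftrightarrow>
     (\<forall>x\<in>carrier_vec n. f x \<in> carrier_vec m) \<and>
     (\<forall>x\<in>carrier_vec n. \<forall>y\<in>carrier_vec n. f (x + y) = f x + f y) \<and>
     (\<forall>c. \<forall>x\<in>carrier_vec n. f (c \<cdot>\<^sub>v x) = map_vec (scaleC (\<sigma> c)) (f x))"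

definition vec_sesquilinear ::
  "(complex \<Rightarrow> complex) \<Rightarrow> (complex \<Rightarrow> complex) \<Rightarrow> nat \<Rightarrow> nat \<Rightarrow> nat \<Rightarrow>
   (complex vec \<Rightarrow> complex vec \<Rightarrow> complex vec) \<Rightarrow> bool" where
  "vec_sesquilinear \<sigma> \<tau> n m k f \<longleftrightarrow>
     (\<forall>x\<in>carrier_vec n. vec_semilinear \<tau> m k (f x)) \<and>
     (\<forall>y\<in>carrier_vec m. vec_semilinear \<sigma> n k (\<lambda>x. f x y))"

abbreviation vec_linear ::
  "nat \<Rightarrow> nat \<Rightarrow> (complex vec \<Rightarrow> 'h::complex_vector vec) \<Rightarrow> bool" where
  "vec_linear \<equiv> vec_semilinear (\<lambda>c. c)"

abbreviation vec_bilinear ::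
  "nat \<Rightarrow> nat \<Rightarrow> nat \<Rightarrow> (complex vec \<Rightarrow> complex vec \<Rightarrow> complex vec) \<Rightarrow> bool" where
  "vec_bilinear \<equiv> vec_sesquilinear (\<lambda>c. c) (\<lambda>c. c)"

definition vec_tprod :: "complex vec \<Rightarrow> 'h \<Rightarrow> 'h::complex_vector vec" where
  "vec_tprod v h = map_vec (\<lambda>c. c *\<^sub>C h) v"

text \<open>
  The maps \<open>\<Sum> e\<^sub>i \<otimes> x\<^sub>i \<mapsto> \<Sum> f(e\<^sub>i) \<otimes> x\<^sub>i\<close> and
  \<open>(\<Sum> e\<^sub>i \<otimes> x\<^sub>i, \<Sum> e\<^sub>j \<otimes> y\<^sub>j) \<mapsto> \<Sum> f(e\<^sub>i, e\<^sub>j) \<otimes> x\<^sub>i y\<^sub>j\<close>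
  into \<open>\<complex>\<^sup>k \<otimes> H\<close>.  The extension of an \<open>f\<close> that is conjugate-linear in an argument by the involution
  of \<open>H\<close> in that argument is obtained by first applying \<open>star\<close> to the coordinates of the argument.
\<close>

definition amplify :: "nat \<Rightarrow> (complex vec \<Rightarrow> complex vec) \<Rightarrow> 'h vec \<Rightarrow> 'h::complex_vector vec" where
  "amplify k f x =
     vec k (\<lambda>l. \<Sum>i<dim_vec x. (f (unit_vec (dim_vec x) i) $ l) *\<^sub>C (x $ i))"

definition amplify2 ::
  "nat \<Rightarrow> (complex vec \<Rightarrow> complex vec \<Rightarrow> complex vec) \<Rightarrow>
   'h vec \<Rightarrow> 'h vec \<Rightarrow> 'h::complex_star_algebra vec" where
  "amplify2 k f x y =
     vec k (\<lambda>l. \<Sum>i<dim_vec x. \<Sum>j<dim_vec y.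
       (f (unit_vec (dim_vec x) i) (unit_vec (dim_vec y) j) $ l) *\<^sub>C (x $ i * y $ j))"

text \<open>\<open>\<delta> \<otimes> id\<close> for \<open>\<delta> : \<complex>\<^sup>n \<rightarrow> \<complex>\<^sup>k \<otimes> H\<close>, with values in \<open>\<complex>\<^sup>k \<otimes> H \<otimes> H\<close>.\<close>

definition amplify_corep ::
  "nat \<Rightarrow> (complex vec \<Rightarrow> 'h vec) \<Rightarrow> 'h vec \<Rightarrow> ('h::complex_vector, 'h) tensor vec" where
  "amplify_corep k \<delta> x =
     vec k (\<lambda>l. \<Sum>i<dim_vec x. (\<delta> (unit_vec (dim_vec x) i) $ l) \<otimes>\<^sub>C (x $ i))"

definition corepresentation ::
  "'h::complex_star_algebra quantum_group \<Rightarrow> nat \<Rightarrow> (complex vec \<Rightarrow> 'h vec) \<Rightarrow> bool" where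
  "corepresentation \<Gamma> n \<delta> \<longleftrightarrow>
     vec_linear n n \<delta> \<and>
     (\<forall>x\<in>carrier_vec n. map_vec (comult \<Gamma>) (\<delta> x) = amplify_corep n \<delta> (\<delta> x)) \<and>
     (\<forall>x\<in>carrier_vec n. map_vec (counit \<Gamma>) (\<delta> x) = x)"

record fd_algebra =
  adim :: nat
  amult :: "complex vec \<Rightarrow> complex vec \<Rightarrow> complex vec"
  aone :: "complex vec"
  astar :: "complex vec \<Rightarrow> complex vec"

abbreviation acarrier :: "fd_algebra \<Rightarrow> complex vec set" where
  "acarrier A \<equiv> carrier_vec (adim A)"

definition fd_star_algebra :: "fd_algebra \<Rightarrow> bool" where
  "fd_star_algebra A \<longleftrightarrow>
     vec_bilinear (adim A) (adim A) (adim A) (amult A) \<and>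
     (\<forall>x\<in>acarrier A. \<forall>y\<in>acarrier A. \<forall>z\<in>acarrier A.
        amult A (amult A x y) z = amult A x (amult A y z)) \<and>
     aone A \<in> acarrier A \<and>
     (\<forall>x\<in>acarrier A. amult A (aone A) x = x \<and> amult A x (aone A) = x) \<and>
     vec_semilinear cnj (adim A) (adim A) (astar A) \<and>
     (\<forall>x\<in>acarrier A. astar A (astar A x) = x) \<and>
     (\<forall>x\<in>acarrier A. \<forall>y\<in>acarrier A. astar A (amult A x y) = amult A (astar A y) (astar A x))"

text \<open>Completeness of the norm is automatic in finite dimensions.\<close>

definition cstar_norm :: "fd_algebra \<Rightarrow> (complex vec \<Rightarrow> real) \<Rightarrow> bool" where
  "cstar_norm A N \<longleftrightarrow>
     (\<forall>x\<in>acarrier A. N x \<ge> 0 \<and> (N x = 0 \<longleftrightarrow> x = 0\<^sub>v (adim A))) \<and>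
     (\<forall>x\<in>acarrier A. \<forall>y\<in>acarrier A. N (x + y) \<le> N x + N y) \<and>
     (\<forall>c. \<forall>x\<in>acarrier A. N (c \<cdot>\<^sub>v x) = cmod c * N x) \<and>
     (\<forall>x\<in>acarrier A. \<forall>y\<in>acarrier A. N (amult A x y) \<le> N x * N y) \<and>
     (\<forall>x\<in>acarrier A. N (amult A (astar A x) x) = (N x)\<^sup>2)"

definition fd_cstar_algebra :: "fd_algebra \<Rightarrow> bool" where
  "fd_cstar_algebra A \<longleftrightarrow> fd_star_algebra A \<and> (\<exists>N. cstar_norm A N)"

definition positive_element :: "fd_algebra \<Rightarrow> complex vec \<Rightarrow> bool" where
  "positive_element A a \<longleftrightarrow> (\<exists>b\<in>acarrier A. a = amult A (astar A b) b)"

definition coaction ::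
  "'h::complex_star_algebra quantum_group \<Rightarrow> fd_algebra \<Rightarrow> (complex vec \<Rightarrow> 'h vec) \<Rightarrow> bool" where
  "coaction \<Gamma> A \<alpha> \<longleftrightarrow>
     fd_cstar_algebra A \<and>
     corepresentation \<Gamma> (adim A) \<alpha> \<and>
     \<alpha> (aone A) = vec_tprod (aone A) 1 \<and>
     (\<forall>x\<in>acarrier A. \<forall>y\<in>acarrier A.
        \<alpha> (amult A x y) = amplify2 (adim A) (amult A) (\<alpha> x) (\<alpha> y)) \<and>
     (\<forall>x\<in>acarrier A. \<alpha> (astar A x) = amplify (adim A) (astar A) (map_vec star (\<alpha> x)))"


section \<open>Equivariant Morita equivalence and torsion-freeness\<close>

text \<open>
  \<open>\<complex>\<^sup>m\<close> as an equivariant imprimitivity bimodule between \<open>(A, \<alpha>)\<close> and \<open>(B, \<beta>)\<close>: a left Hilbert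
  \<open>A\<close>-module (action \<open>l\<close>, inner product \<open>lip\<close>) and a right Hilbert \<open>B\<close>-module (action \<open>r\<close>, inner
  product \<open>rip\<close>), both full, with a compatible corepresentation \<open>\<delta>\<close>.  The \<open>A\<close>-valued inner product
  is linear in the first argument, the \<open>B\<close>-valued one in the second.
\<close>

definition left_hilbert_module ::
  "fd_algebra \<Rightarrow> nat \<Rightarrow> (complex vec \<Rightarrow> complex vec \<Rightarrow> complex vec) \<Rightarrow>
   (complex vec \<Rightarrow> complex vec \<Rightarrow> complex vec) \<Rightarrow> bool" where
  "left_hilbert_module A m l lip \<longleftrightarrow>
     vec_bilinear (adim A) m m l \<and>
     (\<forall>x\<in>carrier_vec m. l (aone A) x = x) \<and>
     (\<forall>a\<in>acarrier A. \<forall>b\<in>acarrier A. \<forall>x\<in>carrier_vec m. l (amult A a b) x = l a (l b x)) \<and>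
     vec_sesquilinear (\<lambda>c. c) cnj m m (adim A) lip \<and>
     (\<forall>a\<in>acarrier A. \<forall>x\<in>carrier_vec m. \<forall>y\<in>carrier_vec m. lip (l a x) y = amult A a (lip x y)) \<and>
     (\<forall>x\<in>carrier_vec m. \<forall>y\<in>carrier_vec m. astar A (lip x y) = lip y x) \<and>
     (\<forall>x\<in>carrier_vec m. positive_element A (lip x x)) \<and>
     (\<forall>x\<in>carrier_vec m. lip x x = 0\<^sub>v (adim A) \<longrightarrow> x = 0\<^sub>v m)"

definition right_hilbert_module ::
  "fd_algebra \<Rightarrow> nat \<Rightarrow> (complex vec \<Rightarrow> complex vec \<Rightarrow> complex vec) \<Rightarrow>
   (complex vec \<Rightarrow> complex vec \<Rightarrow> complex vec) \<Rightarrow> bool" where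
  "right_hilbert_module B m r rip \<longleftrightarrow>
     vec_bilinear m (adim B) m r \<and>
     (\<forall>x\<in>carrier_vec m. r x (aone B) = x) \<and>
     (\<forall>b\<in>acarrier B. \<forall>c\<in>acarrier B. \<forall>x\<in>carrier_vec m. r x (amult B b c) = r (r x b) c) \<and>
     vec_sesquilinear cnj (\<lambda>c. c) m m (adim B) rip \<and>
     (\<forall>b\<in>acarrier B. \<forall>x\<in>carrier_vec m. \<forall>y\<in>carrier_vec m. rip x (r y b) = amult B (rip x y) b) \<and>
     (\<forall>x\<in>carrier_vec m. \<forall>y\<in>carrier_vec m. astar B (rip x y) = rip y x) \<and>
     (\<forall>x\<in>carrier_vec m. positive_element B (rip x x)) \<and>
     (\<forall>x\<in>carrier_vec m. rip x x = 0\<^sub>v (adim B) \<longrightarrow> x = 0\<^sub>v m)"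

definition full_inner_product ::
  "fd_algebra \<Rightarrow> nat \<Rightarrow> (complex vec \<Rightarrow> complex vec \<Rightarrow> complex vec) \<Rightarrow> bool" where
  "full_inner_product A m ip \<longleftrightarrow>
     LinearCombinations.module.span class_ring (module_vec TYPE(complex) (adim A))
       {ip x y | x y. x \<in> carrier_vec m \<and> y \<in> carrier_vec m} = acarrier A"

definition imprimitivity_bimodule ::
  "fd_algebra \<Rightarrow> fd_algebra \<Rightarrow> nat \<Rightarrow>
   (complex vec \<Rightarrow> complex vec \<Rightarrow> complex vec) \<Rightarrow> (complex vec \<Rightarrow> complex vec \<Rightarrow> complex vec) \<Rightarrow>
   (complex vec \<Rightarrow> complex vec \<Rightarrow> complex vec) \<Rightarrow> (complex vec \<Rightarrow> complex vec \<Rightarrow> complex vec) \<Rightarrow>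
   bool" where
  "imprimitivity_bimodule A B m l r lip rip \<longleftrightarrow>
     left_hilbert_module A m l lip \<and> full_inner_product A m lip \<and>
     right_hilbert_module B m r rip \<and> full_inner_product B m rip \<and>
     (\<forall>a\<in>acarrier A. \<forall>x\<in>carrier_vec m. \<forall>b\<in>acarrier B. l a (r x b) = r (l a x) b) \<and>
     (\<forall>a\<in>acarrier A. \<forall>x\<in>carrier_vec m. \<forall>y\<in>carrier_vec m.
        rip (l a x) y = rip x (l (astar A a) y)) \<and>
     (\<forall>b\<in>acarrier B. \<forall>x\<in>carrier_vec m. \<forall>y\<in>carrier_vec m.
        lip (r x b) y = lip x (r y (astar B b))) \<and>
     (\<forall>x\<in>carrier_vec m. \<forall>y\<in>carrier_vec m. \<forall>z\<in>carrier_vec m. l (lip x y) z = r x (rip y z))"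

definition equivariantly_morita_equivalent ::
  "'h::complex_star_algebra quantum_group \<Rightarrow> fd_algebra \<Rightarrow> (complex vec \<Rightarrow> 'h vec) \<Rightarrow>
   fd_algebra \<Rightarrow> (complex vec \<Rightarrow> 'h vec) \<Rightarrow> bool" where
  "equivariantly_morita_equivalent \<Gamma> A \<alpha> B \<beta> \<longleftrightarrow>
     (\<exists>m l r lip rip \<delta>.
        imprimitivity_bimodule A B m l r lip rip \<and>
        corepresentation \<Gamma> m \<delta> \<and>
        (\<forall>a\<in>acarrier A. \<forall>x\<in>carrier_vec m. \<delta> (l a x) = amplify2 m l (\<alpha> a) (\<delta> x)) \<and>
        (\<forall>x\<in>carrier_vec m. \<forall>b\<in>acarrier B. \<delta> (r x b) = amplify2 m r (\<delta> x) (\<beta> b)) \<and>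
        (\<forall>x\<in>carrier_vec m. \<forall>y\<in>carrier_vec m.
           \<alpha> (lip x y) = amplify2 (adim A) lip (\<delta> x) (map_vec star (\<delta> y))) \<and>
        (\<forall>x\<in>carrier_vec m. \<forall>y\<in>carrier_vec m.
           \<beta> (rip x y) = amplify2 (adim B) rip (map_vec star (\<delta> x)) (\<delta> y)))"

text \<open>The direct sum of \<open>k\<close> copies of \<open>\<complex>\<close>, with the coaction \<open>x \<mapsto> x \<otimes> 1\<close>.\<close>

definition trivial_algebra :: "nat \<Rightarrow> fd_algebra" where
  "trivial_algebra k =
     \<lparr> adim = k,
       amult = (\<lambda>x y. vec k (\<lambda>i. x $ i * y $ i)),
       aone = vec k (\<lambda>_. 1),
       astar = map_vec cnj \<rparr>"

definition trivial_coaction :: "complex vec \<Rightarrow> 'h::complex_star_algebra vec" where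
  "trivial_coaction x = vec_tprod x 1"

definition torsion_free :: "'h::complex_star_algebra quantum_group \<Rightarrow> bool" where
  "torsion_free \<Gamma> \<longleftrightarrow>
     (\<forall>A \<alpha>. coaction \<Gamma> A \<alpha> \<longrightarrow>
        (\<exists>k. equivariantly_morita_equivalent \<Gamma> A \<alpha> (trivial_algebra k) trivial_coaction))"

end

theory Submission
  imports Defs
begin

text \<open>
  For torsion-free \<open>\<Gamma>\<close> the imprimitivity bimodule of a coaction \<open>(A, \<alpha>)\<close> produces a unitary
  \<open>U \<in> A \<otimes> \<complex>[\<Gamma>]\<close> with \<open>(id \<otimes> \<Delta>)(U) = U\<^sub>1\<^sub>2 U\<^sub>1\<^sub>3\<close> and \<open>\<alpha>(a) = U (a \<otimes> 1) U\<^sup>*\<close>; conversely such a \<open>U\<close>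
  turns any Hilbert bimodule between \<open>A\<close> and a sum of copies of \<open>\<complex>\<close> into an equivariant one.  In
  particular coactions of \<open>\<Gamma>\<close> fix central elements.

  A coaction \<open>\<alpha>\<close> of \<open>\<Gamma>\<^sub>1 \<times> \<Gamma>\<^sub>2\<close> restricts to commuting coactions of \<open>\<Gamma>\<^sub>1\<close> and \<open>\<Gamma>\<^sub>2\<close>, implemented by
  unitaries \<open>V\<close> and \<open>W\<close>, and \<open>\<alpha>\<close> is implemented by \<open>V W\<close> as soon as \<open>V\<close> and \<open>W\<close> commute.  Their
  commutator lies in \<open>Z(A) \<otimes> \<complex>[\<Gamma>\<^sub>1] \<otimes> \<complex>[\<Gamma>\<^sub>2]\<close> and each of its components \<open>\<zeta>\<close> is a unitary
  bicharacter.  The right leg of \<open>\<zeta>\<close> spans a finite-dimensional Hopf \<open>*\<close>-subalgebra \<open>H\<close> of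
  \<open>\<complex>[\<Gamma>\<^sub>2]\<close>, which is a C*-algebra since the Haar state is faithful, with the coaction \<open>\<Delta>\<close>.  The
  integral \<open>p = (\<phi>\<^sub>1 \<otimes> id)(\<zeta>)\<close> of \<open>H\<close> is central, so \<open>\<Delta> p = p \<otimes> 1\<close> and \<open>p\<close> is a scalar; hence \<open>H\<close>
  is one-dimensional and \<open>\<zeta> = 1\<close>.
\<close>

subsection \<open>Linear maps and homomorphisms on tensor products\<close>

text \<open>The obstacle is that \<open>V\<close> and \<open>W\<close> are fixed only up to
  unitaries with central left leg, so nothing in their construction makes them commute. What is
  automatic is that \<open>V W\<close> and \<open>W V\<close> both conjugate
  \<open>a \<otimes> 1\<close> to \<open>\<alpha> a\<close>: projecting the two legs of the
  coproduct to the two factors, in either order, and multiplying recovers the element. This alone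
  puts the commutator in the center. A unitary \<open>U\<close> exists because the right-hand
  algebra carries the trivial coaction: the corepresentation on the bimodule is then linear for the
  right action, and such a map is given by an element of
  \<open>A \<otimes> \<complex>[\<Gamma>]\<close>. A component of the commutator is its scalar
  action on one summand of the bimodule; evaluation at a nonzero vector there transfers every
  identity of the commutator to \<open>\<zeta>\<close>. Only positivity of the Haar state is an
  axiom. Its faithfulness makes left multiplication on the Hilbert space of \<open>H\<close> a
  faithful representation, which supplies the C*-norm. Invariance gives p x = \<omega>(1) p for the
  slice x at \<omega>, and the counit takes p to 1. So a scalar p equals 1, and every slice is the
  scalar \<omega>(1).\<close>

lemmas [simp] = scaleC_scaleC scaleC_one scaleC_mult_left scaleC_mult_right star_star star_scaleC star_add
  tprod_mult tprod_scaleC_left tprod_scaleC_right star_tprod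

lemma clinearI:
  assumes "\<And>x y. f (x + y) = f x + f y" and "\<And>c x. f (c *\<^sub>C x) = c *\<^sub>C f x"
  shows "clinear f"
  using assms by (simp add: semilinear_def)

lemma clinear_add: "clinear f \<Longrightarrow> f (x + y) = f x + f y"
  by (simp add: semilinear_def)

lemma clinear_scaleC: "clinear f \<Longrightarrow> f (c *\<^sub>C x) = c *\<^sub>C f x"
  by (simp add: semilinear_def)

lemma clinear_0: "clinear f \<Longrightarrow> f 0 = 0"
  using clinear_add[of f 0 0] by simp

lemma clinear_sum: "clinear f \<Longrightarrow> f (sum g S) = (\<Sum>i\<in>S. f (g i))"
  by (induction S rule: infinite_finite_induct) (simp_all add: clinear_0 clinear_add)

lemma clinear_diff: "clinear f \<Longrightarrow> f (x - y) = f x - f y"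
  using clinear_add[of f "x - y" y] by simp

lemma clinear_id [simp]: "clinear (\<lambda>x. x)"
  by (rule clinearI) simp_all

lemma clinear_comp: "clinear f \<Longrightarrow> clinear g \<Longrightarrow> clinear (\<lambda>x. f (g x))"
  by (simp add: semilinear_def)

lemma cbilinearI:
  assumes "\<And>x. clinear (f x)" and "\<And>y. clinear (\<lambda>x. f x y)"
  shows "cbilinear f"
  using assms by (simp add: semibilinear_def)

lemma star_0 [simp]: "star 0 = (0 :: 'a::complex_star_algebra)"
  using star_add[of 0 "0::'a"] by simp

lemma star_one [simp]: "star 1 = (1 :: 'a::complex_star_algebra)"
proof -
  have "star 1 = star 1 * star (star (1::'a))" by simp
  also have "\<dots> = star (star 1 * 1)" by (simp only: star_mult)
  finally show ?thesis by simp
qed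

lemma star_sum: "star (sum g S) = (\<Sum>i\<in>S. star (g i :: 'a::complex_star_algebra))"
  by (induction S rule: infinite_finite_induct) simp_all

lemma clinear_tensor_lift [simp]: "cbilinear f \<Longrightarrow> clinear (tensor_lift f)"
  by (rule semilinear_tensor_semilift) simp_all

lemma tensor_lift_tprod: "cbilinear f \<Longrightarrow> tensor_lift f (a \<otimes>\<^sub>C b) = f a b"
  by simp

lemma cbilinear_tprod:
  assumes "clinear f" "clinear g"
  shows "cbilinear (\<lambda>a b. f a \<otimes>\<^sub>C g b)"
  using assms by (simp add: semibilinear_def semilinear_def tprod_add_left tprod_add_right)

lemma clinear_tprod_left [simp]: "clinear (\<lambda>a. a \<otimes>\<^sub>C b)"
  and clinear_tprod_right [simp]: "clinear (\<lambda>b. a \<otimes>\<^sub>C b)"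
  by (simp_all add: semilinear_def tprod_add_left tprod_add_right)

lemma cbilinear_mult:
  assumes "clinear f" "clinear g"
  shows "cbilinear (\<lambda>a b. f a * (g b :: 'a::complex_star_algebra))"
  using assms by (simp add: semibilinear_def semilinear_def algebra_simps)

lemma cbilinear_scaleC:
  assumes "clinear f" "clinear g"
  shows "cbilinear (\<lambda>a b. (f a :: complex) *\<^sub>C g b)"
  using assms by (simp add: semibilinear_def semilinear_def scaleC_add_left scaleC_add_right scaleC_complex_def
      mult.commute)

lemma cbilinear_scaleC':
  assumes "clinear f" "clinear g"
  shows "cbilinear (\<lambda>a b. (g b :: complex) *\<^sub>C f a)"
  using assms by (simp add: semibilinear_def semilinear_def scaleC_add_left scaleC_add_right scaleC_complex_def
      mult.commute)

lemma clinear_mult_left: "clinear (\<lambda>x. a * (x :: 'a::complex_star_algebra))"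
  and clinear_mult_right: "clinear (\<lambda>x. (x :: 'a::complex_star_algebra) * a)"
  by (simp_all add: semilinear_def algebra_simps)

lemma tensor_ext:
  assumes "clinear f" "clinear g" "\<And>a b. f (a \<otimes>\<^sub>C b) = g (a \<otimes>\<^sub>C b)"
  shows "f t = g t"
  by (induction t rule: tensor_induct) (use assms in \<open>simp_all add: semilinear_def\<close>)

lemma cbilinear_tensor: "cbilinear (\<otimes>\<^sub>C)"
  by (rule cbilinear_tprod[OF clinear_id clinear_id])

lemma tensor_lift_tensor: "tensor_lift (\<otimes>\<^sub>C) s = s"
  by (rule tensor_ext[where t = s]) (simp_all add: cbilinear_tensor)

lemma clinear_tensor_map [simp]:
  assumes "clinear f" "clinear g"
  shows "clinear (tensor_map f g)"
  unfolding tensor_map_def by (intro clinear_tensor_lift cbilinear_tprod assms)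

lemma tensor_map_tprod [simp]:
  assumes "clinear f" "clinear g"
  shows "tensor_map f g (a \<otimes>\<^sub>C b) = f a \<otimes>\<^sub>C g b"
  unfolding tensor_map_def by (simp add: cbilinear_tprod assms)

definition star_hom :: "('a::complex_star_algebra \<Rightarrow> 'b::complex_star_algebra) \<Rightarrow> bool" where
  "star_hom f \<longleftrightarrow> clinear f \<and> f 1 = 1 \<and> (\<forall>x y. f (x * y) = f x * f y) \<and> (\<forall>x. f (star x) = star (f x))"

lemma star_homD:
  assumes "star_hom f"
  shows "clinear f" "f 1 = 1" "f (x * y) = f x * f y" "f (star x) = star (f x)"
  using assms by (simp_all add: star_hom_def)

lemma star_hom_comp: "star_hom f \<Longrightarrow> star_hom g \<Longrightarrow> star_hom (\<lambda>x. f (g x))"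
  by (simp add: star_hom_def clinear_comp)

lemma star_hom_id: "star_hom (\<lambda>x. x)"
  by (simp add: star_hom_def)

lemma star_hom_scalar: "star_hom (\<lambda>c::complex. c *\<^sub>C (1 :: 'a::complex_star_algebra))"
  by (simp add: star_hom_def semilinear_def scaleC_add_left scaleC_complex_def star_complex_def)

lemma star_hom_tprod_left: "star_hom (\<lambda>a. a \<otimes>\<^sub>C (1 :: 'b::complex_star_algebra))"
  and star_hom_tprod_right: "star_hom (\<lambda>b. (1 :: 'a::complex_star_algebra) \<otimes>\<^sub>C b)"
  by (simp_all add: star_hom_def one_tensor_def)

text \<open>Commuting ranges let the right factor of one elementary tensor slide past the left
  factor of the next. Homomorphisms out of tensor products, such as \<open>tensor_map\<close>,
  \<open>tensor_interchange\<close> and the projections to the factors, are cast into this form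
  below.\<close>

lemma star_hom_tensor_lift:
  assumes f: "star_hom f" and g: "star_hom g" and comm: "\<And>a b. f a * g b = g b * f a"
  shows "star_hom (tensor_lift (\<lambda>a b. f a * g b))"
proof -
  let ?h = "tensor_lift (\<lambda>a b. f a * g b)"
  note F = star_homD[OF f] and G = star_homD[OF g]
  have bil: "cbilinear (\<lambda>a b. f a * g b)" by (rule cbilinear_mult[OF F(1) G(1)])
  have lin: "clinear ?h" by (rule clinear_tensor_lift[OF bil])
  note L = clinear_add[OF lin] clinear_scaleC[OF lin]
  have comm': "g b * (f a * z) = f a * (g b * z)" for a b z
    by (metis comm mult.assoc)
  show ?thesis
    unfolding star_hom_def
  proof (intro conjI allI lin)
    show "?h 1 = 1" by (simp add: one_tensor_def bil F G)
    show "?h (x * y) = ?h x * ?h y" for x y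
    proof (induction x rule: tensor_induct)
      case (tprod a b)
      show ?case
        by (induction y rule: tensor_induct)
          (simp_all add: distrib_left L bil F G mult.assoc comm')
    qed (simp add: distrib_right L)
    show "?h (star x) = star (?h x)" for x
    proof (induction x rule: tensor_induct)
      case (tprod a b)
      have "star (f a) * star (g b) = star (g b) * star (f a)" by (metis star_mult comm)
      then show ?case by (simp add: bil F G star_mult)
    qed (simp add: L)
  qed
qed

lemma tensor_map_eq_lift:
  "tensor_map f g = tensor_lift (\<lambda>a b. (f a \<otimes>\<^sub>C 1) * (1 \<otimes>\<^sub>C g b))"
  for f :: "'a::complex_vector \<Rightarrow> 'c::complex_star_algebra"
    and g :: "'b::complex_vector \<Rightarrow> 'd::complex_star_algebra"
  by (simp add: tensor_map_def)

lemma star_hom_tensor_map: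
  assumes "star_hom f" "star_hom g"
  shows "star_hom (tensor_map f g)"
  unfolding tensor_map_eq_lift
  by (rule star_hom_tensor_lift)
    (use assms in \<open>simp_all add: star_hom_comp[OF star_hom_tprod_left] star_hom_comp[OF star_hom_tprod_right]\<close>)

lemmas star_hom_intros = star_hom_id star_hom_tprod_left star_hom_tprod_right star_hom_tensor_map

text \<open>Exchanging the middle legs is a product of two commuting embeddings, one placing
  \<open>s\<close> in the first and third legs, the other placing \<open>t\<close> in the second and
  fourth. In this form \<open>star_hom_tensor_lift\<close> applies.\<close>

lemma tensor_interchange_tprod_eq:
  "tensor_interchange (s \<otimes>\<^sub>C t) =
     tensor_map (\<lambda>a. a \<otimes>\<^sub>C 1) (\<lambda>b. b \<otimes>\<^sub>C 1) s * tensor_map (\<lambda>c. 1 \<otimes>\<^sub>C c) (\<lambda>d. 1 \<otimes>\<^sub>C d) t"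
  and tensor_interchange_eq_lift:
  "(tensor_interchange ::
      (('a::complex_star_algebra, 'b::complex_star_algebra) tensor,
       ('c::complex_star_algebra, 'd::complex_star_algebra) tensor) tensor \<Rightarrow> _) =
     tensor_lift (\<lambda>s t. tensor_map (\<lambda>a. a \<otimes>\<^sub>C 1) (\<lambda>b. b \<otimes>\<^sub>C 1) s * tensor_map (\<lambda>c. 1 \<otimes>\<^sub>C c) (\<lambda>d. 1 \<otimes>\<^sub>C d) t)"
  for s :: "('a::complex_star_algebra, 'b::complex_star_algebra) tensor"
    and t :: "('c::complex_star_algebra, 'd::complex_star_algebra) tensor"
proof -
  let ?m1 = "tensor_map (\<lambda>a::'a. a \<otimes>\<^sub>C (1::'c)) (\<lambda>b::'b. b \<otimes>\<^sub>C (1::'d))"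
  let ?m2 = "tensor_map (\<lambda>c. (1::'a) \<otimes>\<^sub>C c) (\<lambda>d. (1::'b) \<otimes>\<^sub>C d)"
  have inner: "cbilinear (\<lambda>(c::'c) (d::'d). (a \<otimes>\<^sub>C c) \<otimes>\<^sub>C (b \<otimes>\<^sub>C d))" for a :: 'a and b :: 'b
    by (rule cbilinear_tprod) simp_all
  have outer: "cbilinear (\<lambda>(a::'a) (b::'b). tensor_lift (\<lambda>c d. (a \<otimes>\<^sub>C c) \<otimes>\<^sub>C (b \<otimes>\<^sub>C d)) t)"
    for t :: "('c, 'd) tensor"
  proof (induction t rule: tensor_induct)
    case (add s t)
    then show ?case
      by (simp add: semibilinear_def semilinear_def clinear_add[OF clinear_tensor_lift[OF inner]]
          scaleC_add_right algebra_simps)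
  next
    case (tprod c d)
    then show ?case
      by (simp add: inner cbilinear_tprod)
  qed
  have m1: "clinear ?m1" and m2: "clinear ?m2"
    by (intro clinear_tensor_map clinear_tprod_left clinear_tprod_right)+
  have eq: "tensor_lift (\<lambda>a b. tensor_lift (\<lambda>c d. (a \<otimes>\<^sub>C c) \<otimes>\<^sub>C (b \<otimes>\<^sub>C d)) t) s = ?m1 s * ?m2 t" for s t
  proof (induction s rule: tensor_induct)
    case (add s s')
    then show ?case
      by (simp add: clinear_add[OF clinear_tensor_lift[OF outer]] clinear_add[OF m1] distrib_right)
  next
    case (tprod a b)
    have "tensor_lift (\<lambda>c d. (a \<otimes>\<^sub>C c) \<otimes>\<^sub>C (b \<otimes>\<^sub>C d)) t = ?m1 (a \<otimes>\<^sub>C b) * ?m2 t"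
      by (rule tensor_ext[where t = t])
        (simp_all add: inner clinear_comp[OF clinear_mult_left m2])
    then show ?case by (simp add: outer)
  qed
  show lift: "(tensor_interchange :: (('a, 'b) tensor, ('c, 'd) tensor) tensor \<Rightarrow> _) =
     tensor_lift (\<lambda>s t. ?m1 s * ?m2 t)"
    unfolding tensor_interchange_def eq ..
  show "tensor_interchange (s \<otimes>\<^sub>C t) = ?m1 s * ?m2 t"
    unfolding lift by (simp add: cbilinear_mult m1 m2)
qed

lemma tensor_interchange_tprod:
  "tensor_interchange ((a \<otimes>\<^sub>C b) \<otimes>\<^sub>C (c \<otimes>\<^sub>C d)) = (a \<otimes>\<^sub>C c) \<otimes>\<^sub>C (b \<otimes>\<^sub>C d)"
  for a :: "'a::complex_star_algebra" and b :: "'b::complex_star_algebra"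
    and c :: "'c::complex_star_algebra" and d :: "'d::complex_star_algebra"
  by (simp add: tensor_interchange_tprod_eq)

lemma star_hom_tensor_interchange:
  "star_hom (tensor_interchange ::
      (('a::complex_star_algebra, 'b::complex_star_algebra) tensor,
       ('c::complex_star_algebra, 'd::complex_star_algebra) tensor) tensor \<Rightarrow> _)"
proof -
  have comm: "tensor_map (\<lambda>a::'a. a \<otimes>\<^sub>C (1::'c)) (\<lambda>b::'b. b \<otimes>\<^sub>C (1::'d)) s *
      tensor_map (\<lambda>c. (1::'a) \<otimes>\<^sub>C c) (\<lambda>d. (1::'b) \<otimes>\<^sub>C d) t =
      tensor_map (\<lambda>c. (1::'a) \<otimes>\<^sub>C c) (\<lambda>d. (1::'b) \<otimes>\<^sub>C d) t *
      tensor_map (\<lambda>a::'a. a \<otimes>\<^sub>C (1::'c)) (\<lambda>b::'b. b \<otimes>\<^sub>C (1::'d)) s" for s t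
  proof (induction s rule: tensor_induct)
    case (tprod a b)
    show ?case
      by (induction t rule: tensor_induct)
        (simp_all add: clinear_add[OF clinear_tensor_map] distrib_left distrib_right)
  qed (simp add: clinear_add[OF clinear_tensor_map] distrib_left distrib_right)
  show ?thesis
    unfolding tensor_interchange_eq_lift
    by (intro star_hom_tensor_lift star_hom_tensor_map star_hom_tprod_left star_hom_tprod_right comm)
qed

lemma cbilinear_tensor_assoc: "cbilinear (\<lambda>a b. a \<otimes>\<^sub>C (b \<otimes>\<^sub>C c))"
  by (rule cbilinear_tprod[OF clinear_id clinear_tprod_left])

lemma cbilinear_tensor_assoc_outer:
  "cbilinear (\<lambda>s c. tensor_lift (\<lambda>a b. a \<otimes>\<^sub>C (b \<otimes>\<^sub>C c)) s)"
proof (rule cbilinearI)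
  show "clinear (\<lambda>c. tensor_lift (\<lambda>a b. a \<otimes>\<^sub>C (b \<otimes>\<^sub>C c)) s)" for s
  proof (induction s rule: tensor_induct)
    case (add s t)
    then show ?case
      by (simp add: semilinear_def clinear_add[OF clinear_tensor_lift[OF cbilinear_tensor_assoc]]
          scaleC_add_right algebra_simps)
  next
    case (tprod a b)
    then show ?case
      by (simp add: cbilinear_tensor_assoc clinear_comp[OF clinear_tprod_right clinear_tprod_right])
  qed
qed (simp add: cbilinear_tensor_assoc)

lemma clinear_tensor_assoc: "clinear tensor_assoc"
  unfolding tensor_assoc_def by (rule clinear_tensor_lift[OF cbilinear_tensor_assoc_outer])

lemma tensor_assoc_tprod: "tensor_assoc ((a \<otimes>\<^sub>C b) \<otimes>\<^sub>C c) = a \<otimes>\<^sub>C (b \<otimes>\<^sub>C c)"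
  unfolding tensor_assoc_def by (simp add: cbilinear_tensor_assoc_outer cbilinear_tensor_assoc)

lemma clinear_zero [simp]: "clinear (\<lambda>_. 0)"
  by (simp add: semilinear_def)

text \<open>Expand the left legs in a Hamel basis. Independence of the left legs is the point:
  functionals or coefficient comparison then recover each right leg \<open>d b\<close> from slices
  of \<open>t\<close>.\<close>

lemma tensor_eq_sum_basis:
  "\<exists>F d. finite F \<and> cvector.independent F \<and> t = (\<Sum>b\<in>F. b \<otimes>\<^sub>C d b)"
  for t :: "('a::complex_vector, 'b::complex_vector) tensor"
proof -
  define B :: "'a set" where "B = cvector.extend_basis {}"
  have indep: "cvector.independent B" and span: "cvector.span B = UNIV"
    by (simp_all add: B_def cvector.independent_extend_basis cvector.independent_empty)
  have "\<exists>F d. finite F \<and> F \<subseteq> B \<and> t = (\<Sum>b\<in>F. b \<otimes>\<^sub>C d b)"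
  proof (induction t rule: tensor_induct)
    case (add s t)
    then obtain F d F' d' where F: "finite F" "F \<subseteq> B" "s = (\<Sum>b\<in>F. b \<otimes>\<^sub>C d b)"
      and F': "finite F'" "F' \<subseteq> B" "t = (\<Sum>b\<in>F'. b \<otimes>\<^sub>C d' b)" by blast
    define e where "e b = (if b \<in> F then d b else 0) + (if b \<in> F' then d' b else 0)" for b
    have "(\<Sum>b\<in>F \<union> F'. b \<otimes>\<^sub>C e b) =
        (\<Sum>b\<in>F \<union> F'. if b \<in> F then b \<otimes>\<^sub>C d b else 0) + (\<Sum>b\<in>F \<union> F'. if b \<in> F' then b \<otimes>\<^sub>C d' b else 0)"
      unfolding sum.distrib[symmetric] by (rule sum.cong) (auto simp: e_def tprod_add_right tprod_eq_0_iff)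
    also have "(\<Sum>b\<in>F \<union> F'. if b \<in> F then b \<otimes>\<^sub>C d b else 0) = s"
      unfolding F(3) by (rule sum.mono_neutral_cong_right) (use F F' in auto)
    also have "(\<Sum>b\<in>F \<union> F'. if b \<in> F' then b \<otimes>\<^sub>C d' b else 0) = t"
      unfolding F'(3) by (rule sum.mono_neutral_cong_right) (use F F' in auto)
    finally have "s + t = (\<Sum>b\<in>F \<union> F'. b \<otimes>\<^sub>C e b)" ..
    moreover have "finite (F \<union> F')" "F \<union> F' \<subseteq> B" using F F' by auto
    ultimately show ?case by blast
  next
    case (tprod a b)
    let ?r = "cvector.representation B a"
    let ?F = "{x. ?r x \<noteq> 0}"
    have fin: "finite ?F" by (rule cvector.finite_representation)
    have sub: "?F \<subseteq> B" using cvector.representation_ne_zero by blast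
    have a: "a = (\<Sum>x\<in>?F. ?r x *\<^sub>C x)"
      using cvector.sum_nonzero_representation_eq[OF indep, of a] span by simp
    have "(\<Sum>x\<in>?F. x \<otimes>\<^sub>C (?r x *\<^sub>C b)) = (\<Sum>x\<in>?F. ?r x *\<^sub>C x) \<otimes>\<^sub>C b"
      by (simp only: clinear_sum[OF clinear_tprod_left] tprod_scaleC_left tprod_scaleC_right)
    then have "a \<otimes>\<^sub>C b = (\<Sum>x\<in>?F. x \<otimes>\<^sub>C (?r x *\<^sub>C b))" by (simp only: a[symmetric])
    then show ?case
      by (intro exI[of _ ?F] exI[of _ "\<lambda>x. ?r x *\<^sub>C b"] conjI fin sub)
  qed
  then obtain F d where "finite F" "F \<subseteq> B" "t = (\<Sum>b\<in>F. b \<otimes>\<^sub>C d b)" by blast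
  then show ?thesis
    using cvector.independent_mono[OF indep] by blast
qed

lemma star_diff: "star (x - y) = star x - star (y :: 'a::complex_star_algebra)"
  using star_add[of "x - y" y] by (simp add: algebra_simps)

lemma clinear_id' [simp]: "clinear id"
  by (simp add: semilinear_def)

lemma clinear_cbilinear: "clinear h \<Longrightarrow> cbilinear f \<Longrightarrow> cbilinear (\<lambda>s t. h (f s t))"
  by (simp add: semibilinear_def semilinear_def)

lemma cbilinear_comp: "cbilinear f \<Longrightarrow> clinear p \<Longrightarrow> clinear q \<Longrightarrow> cbilinear (\<lambda>s t. f (p s) (q t))"
  by (simp add: semibilinear_def semilinear_def)

lemma cbilinearD:
  assumes "cbilinear f"
  shows "clinear (f x)" "clinear (\<lambda>x. f x y)"
  using assms by (simp_all add: semibilinear_def)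

lemma tensor_ext_bilinear:
  assumes f: "cbilinear f" and g: "cbilinear g"
    and eq: "\<And>a b c d. f (a \<otimes>\<^sub>C b) (c \<otimes>\<^sub>C d) = g (a \<otimes>\<^sub>C b) (c \<otimes>\<^sub>C d)"
  shows "f s t = g s t"
proof (rule tensor_ext[OF cbilinearD(1)[OF f] cbilinearD(1)[OF g]])
  show "f s (c \<otimes>\<^sub>C d) = g s (c \<otimes>\<^sub>C d)" for c d
    by (rule tensor_ext[OF cbilinearD(2)[OF f] cbilinearD(2)[OF g]]) (rule eq)
qed

text \<open>With \<open>s\<close> and \<open>t\<close> the coproducts of elements of the two
  factors, an operation on the coproduct of the product splits into one operation per factor,
  recombined by \<open>h\<close>. For the Hopf axioms \<open>h\<close> is a tensor product, for the
  projections to the factors it is scalar multiplication.\<close>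

lemma tensor_lift_interchange:
  fixes B :: "('a::complex_star_algebra, 'b::complex_star_algebra) tensor \<Rightarrow>
      ('c::complex_star_algebra, 'd::complex_star_algebra) tensor \<Rightarrow> 'e::complex_vector"
  assumes B: "cbilinear B" and h: "cbilinear h" and B1: "cbilinear B1" and B2: "cbilinear B2"
    and eq: "\<And>a b c d. B (a \<otimes>\<^sub>C b) (c \<otimes>\<^sub>C d) = h (B1 a c) (B2 b d)"
  shows "tensor_lift B (tensor_interchange (s \<otimes>\<^sub>C t)) = h (tensor_lift B1 s) (tensor_lift B2 t)"
proof (rule tensor_ext_bilinear[where s = s and t = t])
  have "clinear (\<lambda>x. tensor_lift B (tensor_interchange x))"
    by (rule clinear_comp[OF clinear_tensor_lift[OF B] star_homD(1)[OF star_hom_tensor_interchange]])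
  from clinear_cbilinear[OF this cbilinear_tprod[OF clinear_id clinear_id]]
  show "cbilinear (\<lambda>s t. tensor_lift B (tensor_interchange (s \<otimes>\<^sub>C t)))" .
  show "cbilinear (\<lambda>s t. h (tensor_lift B1 s) (tensor_lift B2 t))"
    by (intro cbilinear_comp[OF h] clinear_tensor_lift B1 B2)
qed (simp add: tensor_interchange_tprod B B1 B2 eq)

subsection \<open>Discrete quantum groups\<close>

locale dqg =
  fixes \<Gamma> :: "'a::complex_star_algebra quantum_group"
  assumes dqg: "discrete_quantum_group \<Gamma>"
begin

abbreviation "\<Delta> \<equiv> comult \<Gamma>"
abbreviation "\<epsilon> \<equiv> counit \<Gamma>"
abbreviation "\<S> \<equiv> antipode \<Gamma>"
abbreviation "\<phi> \<equiv> haar \<Gamma>"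

lemma hopf: "hopf_star_algebra \<Gamma>" and invariant: "invariant_state \<Gamma>"
  using dqg by (simp_all add: discrete_quantum_group_def)

lemma star_hom_comult: "star_hom \<Delta>"
  using hopf by (simp add: hopf_star_algebra_def star_hom_def)

lemma coassoc: "tensor_assoc (tensor_map \<Delta> id (\<Delta> x)) = tensor_map id \<Delta> (\<Delta> x)"
  using hopf by (simp add: hopf_star_algebra_def)

lemma clinear_counit [simp]: "clinear \<epsilon>" and counit_one: "\<epsilon> 1 = 1"
  and counit_mult: "\<epsilon> (x * y) = \<epsilon> x * \<epsilon> y"
  using hopf by (simp_all add: hopf_star_algebra_def)

lemma counit_left: "tensor_lift (\<lambda>a b. \<epsilon> a *\<^sub>C b) (\<Delta> x) = x"
  and counit_right: "tensor_lift (\<lambda>a b. \<epsilon> b *\<^sub>C a) (\<Delta> x) = x"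
  using hopf by (simp_all add: hopf_star_algebra_def)

lemma clinear_antipode [simp]: "clinear \<S>"
  and antipode_left: "tensor_lift (\<lambda>a b. \<S> a * b) (\<Delta> x) = \<epsilon> x *\<^sub>C 1"
  and antipode_right: "tensor_lift (\<lambda>a b. a * \<S> b) (\<Delta> x) = \<epsilon> x *\<^sub>C 1"
  using hopf by (simp_all add: hopf_star_algebra_def)

lemma clinear_haar [simp]: "clinear \<phi>" and haar_one: "\<phi> 1 = 1"
  and haar_pos: "\<phi> (star x * x) \<in> \<real>" "Re (\<phi> (star x * x)) \<ge> 0"
  and haar_right: "tensor_lift (\<lambda>a b. \<phi> b *\<^sub>C a) (\<Delta> x) = \<phi> x *\<^sub>C 1"
  and haar_left: "tensor_lift (\<lambda>a b. \<phi> a *\<^sub>C b) (\<Delta> x) = \<phi> x *\<^sub>C 1"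
  using invariant by (simp_all add: invariant_state_def)

lemma haar_scaleC [simp]: "\<phi> (c *\<^sub>C x) = c * \<phi> x"
  by (simp add: clinear_scaleC[OF clinear_haar] scaleC_complex_def)

lemma bilinear_counit_left [simp]: "cbilinear (\<lambda>a b. \<epsilon> a *\<^sub>C b)"
  and bilinear_counit_right [simp]: "cbilinear (\<lambda>a b. \<epsilon> b *\<^sub>C a)"
  and bilinear_haar_left [simp]: "cbilinear (\<lambda>a b. \<phi> a *\<^sub>C b)"
  and bilinear_haar_right [simp]: "cbilinear (\<lambda>a b. \<phi> b *\<^sub>C a)"
  by (intro cbilinear_scaleC cbilinear_scaleC' clinear_counit clinear_haar clinear_id)+

lemma bilinear_antipode_left [simp]: "cbilinear (\<lambda>a b. \<S> a * b)"
  and bilinear_antipode_right [simp]: "cbilinear (\<lambda>a b. a * \<S> b)"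
  by (intro cbilinear_mult clinear_antipode clinear_id)+

lemma counit_counit: "tensor_lift (\<lambda>a b. \<epsilon> a * \<epsilon> b) (\<Delta> x) = \<epsilon> x"
proof -
  have "tensor_lift (\<lambda>a b. \<epsilon> a * \<epsilon> b) t = \<epsilon> (tensor_lift (\<lambda>a b. \<epsilon> a *\<^sub>C b) t)" for t
    by (rule tensor_ext[where t = t])
      (simp_all add: cbilinear_mult clinear_comp[OF clinear_counit clinear_tensor_lift]
        clinear_scaleC[OF clinear_counit] scaleC_complex_def)
  then show ?thesis by (simp add: counit_left)
qed

text \<open>The conjugate \<open>x \<mapsto> cnj (\<epsilon> (star x))\<close> is a second counit.\<close>

lemma counit_star: "\<epsilon> (star x) = cnj (\<epsilon> x)"
proof -
  define \<epsilon>' where "\<epsilon>' x = cnj (\<epsilon> (star x))" for x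
  have lin: "clinear \<epsilon>'"
    using clinear_counit by (simp add: \<epsilon>'_def semilinear_def scaleC_complex_def)
  have bil: "cbilinear (\<lambda>a (b::'a). \<epsilon>' a *\<^sub>C b)" by (rule cbilinear_scaleC[OF lin clinear_id])
  have aux: "tensor_lift (\<lambda>a (b::'a). \<epsilon>' a *\<^sub>C b) t = star (tensor_lift (\<lambda>a b. \<epsilon> a *\<^sub>C b) (star t))" for t
  proof (induction t rule: tensor_induct)
    case (add s t)
    then show ?case
      by (simp add: clinear_add[OF clinear_tensor_lift[OF bil]]
          clinear_add[OF clinear_tensor_lift[OF bilinear_counit_left]])
  next
    case (tprod a b)
    then show ?case
      by (simp add: bil) (simp add: \<epsilon>'_def)
  qed
  have left: "tensor_lift (\<lambda>a b. \<epsilon>' a *\<^sub>C b) (\<Delta> x) = x" for x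
    by (simp add: aux star_homD(4)[OF star_hom_comult, symmetric] counit_left)
  have "\<epsilon> (tensor_lift (\<lambda>a b. \<epsilon>' a *\<^sub>C b) t) = \<epsilon>' (tensor_lift (\<lambda>a b. \<epsilon> b *\<^sub>C a) t)" for t
    by (rule tensor_ext[where t = t])
      (simp_all add: clinear_comp[OF clinear_counit clinear_tensor_lift[OF bil]]
        clinear_comp[OF lin clinear_tensor_lift[OF bilinear_counit_right]] bil clinear_scaleC[OF lin]
        clinear_scaleC[OF clinear_counit] scaleC_complex_def mult.commute)
  from this[of "\<Delta> (star x)"] have "\<epsilon> (star x) = \<epsilon>' (star x)" by (simp add: left counit_right)
  then show ?thesis by (simp add: \<epsilon>'_def)
qed

lemma star_hom_counit: "star_hom \<epsilon>"
  by (simp add: star_hom_def counit_one counit_mult counit_star star_complex_def)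

section \<open>Hermitian symmetry and faithfulness of the Haar state\<close>

lemma haar_star: "\<phi> (star x) = cnj (\<phi> x)"
proof -
  note L = clinear_add[OF clinear_haar]
  \<comment> \<open>Polarization: reality of \<open>\<phi>\<close> on the square of
    \<open>1 + x\<close> controls the imaginary parts, on the square of
    \<open>1 + \<i> *\<^sub>C x\<close> the real parts.\<close>
  have real: "\<phi> (star z * z) \<in> \<real>" for z by (rule haar_pos)
  have "star (1 + x) * (1 + x) = (1 + star x * x) + (x + star x)"
    by (simp add: algebra_simps)
  then have "\<phi> (star (1 + x) * (1 + x)) = 1 + \<phi> (star x * x) + (\<phi> x + \<phi> (star x))"
    by (simp add: L haar_one)
  then have "\<phi> x + \<phi> (star x) \<in> \<real>"
    using real[of x] real[of "1 + x"] by (metis Reals_1 Reals_add Reals_diff add_diff_cancel_left')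
  then have im: "Im (\<phi> (star x)) = - Im (\<phi> x)" by (simp add: complex_is_Real_iff)
  have "star (1 + \<i> *\<^sub>C x) * (1 + \<i> *\<^sub>C x) = (1 + star x * x) + (\<i> *\<^sub>C x + (- \<i>) *\<^sub>C star x)"
    by (simp add: algebra_simps)
  then have "\<phi> (star (1 + \<i> *\<^sub>C x) * (1 + \<i> *\<^sub>C x)) = 1 + \<phi> (star x * x) + (\<i> * \<phi> x + (- \<i>) * \<phi> (star x))"
    by (simp only: L haar_one haar_scaleC)
  then have "\<i> * \<phi> x + (- \<i>) * \<phi> (star x) \<in> \<real>"
    using real[of x] real[of "1 + \<i> *\<^sub>C x"] by (metis Reals_1 Reals_add Reals_diff add_diff_cancel_left')
  then have "Re (\<phi> (star x)) = Re (\<phi> x)" by (simp add: complex_is_Real_iff)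
  with im show ?thesis by (simp add: complex_eq_iff)
qed

text \<open>Degenerate Cauchy-Schwarz: when the quadratic form vanishes at \<open>x\<close>, its
  value at \<open>star y - c *\<^sub>C x\<close> is real-affine in \<open>c\<close> and would become
  negative if \<open>\<phi> (y * x)\<close> were nonzero.\<close>

lemma haar_null:
  assumes "\<phi> (star x * x) = 0"
  shows "\<phi> (y * x) = 0"
proof (rule ccontr)
  assume ne: "\<phi> (y * x) \<noteq> 0"
  define p where "p = \<phi> (y * x)"
  define q where "q = Re (\<phi> (y * star y))"
  \<comment> \<open>The phase \<open>cnj p\<close> makes \<open>c * p\<close> real and
    \<open>t\<close> makes it \<open>(q + 1) / 2\<close>, so the form takes the value
    \<open>q - (q + 1) = -1\<close>.\<close>
  define t where "t = (q + 1) / (2 * (cmod p)\<^sup>2)"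
  define c where "c = complex_of_real t * cnj p"
  have "\<phi> (star x * star y) = cnj p"
    using haar_star[of "y * x"] by (simp add: star_mult p_def)
  moreover have "star (star y - c *\<^sub>C x) * (star y - c *\<^sub>C x) =
      y * star y - c *\<^sub>C (y * x) - cnj c *\<^sub>C (star x * star y) + (cnj c * c) *\<^sub>C (star x * x)"
    by (simp add: star_diff algebra_simps cvector.scale_right_diff_distrib)
  ultimately have "\<phi> (star (star y - c *\<^sub>C x) * (star y - c *\<^sub>C x)) = \<phi> (y * star y) - c * p - cnj c * cnj p"
    by (simp add: clinear_add[OF clinear_haar] clinear_diff[OF clinear_haar]
        assms p_def)
  moreover have "c * p = complex_of_real (t * (cmod p)\<^sup>2)"
    by (simp add: c_def mult.assoc complex_norm_square mult.commute del: of_real_power)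
  moreover have "cnj c * cnj p = complex_of_real (t * (cmod p)\<^sup>2)"
    by (simp add: c_def mult.assoc complex_norm_square mult.commute del: of_real_power)
  ultimately have "Re (\<phi> (star (star y - c *\<^sub>C x) * (star y - c *\<^sub>C x))) = q - 2 * (t * (cmod p)\<^sup>2)"
    by (simp add: q_def)
  moreover have "2 * (t * (cmod p)\<^sup>2) = q + 1"
    using ne by (simp add: t_def p_def)
  ultimately show False using haar_pos(2)[of "star y - c *\<^sub>C x"] by simp
qed

text \<open>
  Strong invariance, \<open>x\<^sub>1 \<phi>(y x\<^sub>2) = S(y\<^sub>1) \<phi>(y\<^sub>2 x)\<close>, shows that the right leg of \<open>\<Delta> x\<close> is null
  if \<open>x\<close> is.
\<close>

lemma haar_null_slice:
  assumes null: "\<And>y. \<phi> (y * x) = 0"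
  shows "tensor_lift (\<lambda>a b. \<phi> b *\<^sub>C a) ((1 \<otimes>\<^sub>C y) * \<Delta> x) = 0"
proof -
  define R :: "('a, 'a) tensor \<Rightarrow> 'a" where "R = tensor_lift (\<lambda>a b. \<phi> b *\<^sub>C a)"
  have R: "clinear R" unfolding R_def by (intro clinear_tensor_lift bilinear_haar_right)
  have R_mult: "R ((b \<otimes>\<^sub>C c) * t) = b * R ((1 \<otimes>\<^sub>C c) * t)" for b c t
    by (rule tensor_ext[where t = t])
      (simp_all add: clinear_comp[OF R clinear_mult_left] R_def
        clinear_comp[OF clinear_mult_left clinear_comp[OF clinear_tensor_lift[OF bilinear_haar_right] clinear_mult_left]]
        clinear_comp[OF clinear_tensor_lift[OF bilinear_haar_right] clinear_mult_left])
  define K where "K s = R (s * \<Delta> x)" for s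
  have K: "clinear K" unfolding K_def by (rule clinear_comp[OF R clinear_mult_right])
  \<comment> \<open>\<open>G\<close> is evaluated on the iterated coproduct of \<open>y\<close> in
    its two groupings. On \<open>u \<otimes> \<Delta> v\<close> it gives \<open>\<S> u\<close> times
    \<open>\<phi> (v * x)\<close>, hence zero; on \<open>\<Delta> a \<otimes> b\<close> the antipode
    cancels and leaves \<open>\<epsilon> a *\<^sub>C K (1 \<otimes> b)\<close>.\<close>
  define G where "G = tensor_lift (\<lambda>u s. \<S> u * K s)"
  have bilG: "cbilinear (\<lambda>u s. \<S> u * K s)" by (rule cbilinear_mult[OF clinear_antipode K])
  have G: "clinear G" unfolding G_def by (rule clinear_tensor_lift[OF bilG])
  have comult_lin: "clinear \<Delta>" by (rule star_homD(1)[OF star_hom_comult])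
  note id_lin = clinear_id'
  have "G (tensor_map id \<Delta> t) = 0" for t
  proof (rule tensor_ext[where t = t])
    show "G (tensor_map id \<Delta> (u \<otimes>\<^sub>C v)) = 0" for u v
      using haar_right[of "v * x"] null[of v]
      by (simp add: id_lin comult_lin G_def bilG)
        (simp add: K_def R_def star_homD(3)[OF star_hom_comult, symmetric])
  qed (intro clinear_comp[OF G] clinear_tensor_map id_lin comult_lin clinear_zero)+
  moreover have "G (tensor_assoc (tensor_map \<Delta> id t)) = K (1 \<otimes>\<^sub>C tensor_lift (\<lambda>a b. \<epsilon> a *\<^sub>C b) t)" for t
  proof (rule tensor_ext[where t = t])
    have G_assoc: "G (tensor_assoc (s \<otimes>\<^sub>C w)) = tensor_lift (\<lambda>a b. \<S> a * b) s * K (1 \<otimes>\<^sub>C w)" for s w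
    proof (rule tensor_ext[where t = s])
      show "clinear (\<lambda>s. G (tensor_assoc (s \<otimes>\<^sub>C w)))"
        by (intro clinear_comp[OF G] clinear_comp[OF clinear_tensor_assoc] clinear_tprod_left)
      show "clinear (\<lambda>s. tensor_lift (\<lambda>a b. \<S> a * b) s * K (1 \<otimes>\<^sub>C w))"
        by (rule clinear_comp[OF clinear_mult_right clinear_tensor_lift[OF bilinear_antipode_left]])
      show "G (tensor_assoc ((a \<otimes>\<^sub>C b) \<otimes>\<^sub>C w)) = tensor_lift (\<lambda>a b. \<S> a * b) (a \<otimes>\<^sub>C b) * K (1 \<otimes>\<^sub>C w)" for a b
        by (simp add: tensor_assoc_tprod G_def bilG)
          (simp add: K_def R_mult[of b] mult.assoc)
    qed
    show "G (tensor_assoc (tensor_map \<Delta> id (a \<otimes>\<^sub>C b))) = K (1 \<otimes>\<^sub>C tensor_lift (\<lambda>a b. \<epsilon> a *\<^sub>C b) (a \<otimes>\<^sub>C b))" for a b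
      by (simp add: id_lin comult_lin G_assoc antipode_left clinear_scaleC[OF K])
    show "clinear (\<lambda>t. G (tensor_assoc (tensor_map \<Delta> id t)))"
      by (intro clinear_comp[OF G] clinear_comp[OF clinear_tensor_assoc] clinear_tensor_map id_lin comult_lin)
    show "clinear (\<lambda>t. K (1 \<otimes>\<^sub>C tensor_lift (\<lambda>a b. \<epsilon> a *\<^sub>C b) t))"
      by (intro clinear_comp[OF K] clinear_comp[OF clinear_tprod_right] clinear_tensor_lift bilinear_counit_left)
  qed
  ultimately have "K (1 \<otimes>\<^sub>C y) = 0"
    using coassoc[of y] counit_left[of y] by metis
  then show ?thesis by (simp add: K_def R_def)
qed

text \<open>The null space \<open>N\<close> is a left coideal: the right legs of
  \<open>\<Delta> x\<close> stay in \<open>N\<close>. On \<open>N\<close> the counit vanishes,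
  because the antipode identity writes \<open>\<epsilon> x *\<^sub>C 1\<close> as a sum of terms
  \<open>\<S> b * d b\<close>, all killed by \<open>\<phi>\<close>. Applying the counit to the right
  leg of \<open>\<Delta> x\<close> then gives \<open>x = 0\<close>.\<close>

lemma haar_faithful:
  assumes "\<phi> (star x * x) = 0"
  shows "x = 0"
proof -
  define N where "N = {x. \<forall>y. \<phi> (y * x) = 0}"
  have decompose: "\<exists>F d. finite F \<and> \<Delta> x = (\<Sum>b\<in>F. b \<otimes>\<^sub>C d b) \<and> (\<forall>b\<in>F. d b \<in> N)" if "x \<in> N" for x
  proof -
    obtain F d where F: "finite F" "cvector.independent F" and t: "\<Delta> x = (\<Sum>b\<in>F. b \<otimes>\<^sub>C d b)"
      using tensor_eq_sum_basis by blast
    have "d b \<in> N" if "b \<in> F" for b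
    proof -
      have "\<phi> (y * d b) = 0" for y
      proof -
        have "0 = tensor_lift (\<lambda>a b. \<phi> b *\<^sub>C a) ((1 \<otimes>\<^sub>C y) * \<Delta> x)"
          using haar_null_slice[of x y] \<open>x \<in> N\<close> by (simp add: N_def)
        also have "\<dots> = (\<Sum>b\<in>F. \<phi> (y * d b) *\<^sub>C b)"
          by (simp add: t sum_distrib_left clinear_sum[OF clinear_tensor_lift[OF bilinear_haar_right]])
        finally show ?thesis using cvector.independentD[OF F(2) F(1) subset_refl] that by metis
      qed
      then show ?thesis by (simp add: N_def)
    qed
    then show ?thesis using F t by blast
  qed
  have counit_null: "\<epsilon> x = 0" if x: "x \<in> N" for x
  proof -
    obtain F d where F: "finite F" "\<forall>b\<in>F. d b \<in> N" and t: "\<Delta> x = (\<Sum>b\<in>F. b \<otimes>\<^sub>C d b)"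
      using decompose[OF x] by blast
    have "\<epsilon> x *\<^sub>C 1 = (\<Sum>b\<in>F. \<S> b * d b)"
      unfolding antipode_left[symmetric] t
      by (simp add: clinear_sum[OF clinear_tensor_lift[OF bilinear_antipode_left]])
    then have "\<phi> (\<epsilon> x *\<^sub>C 1) = (\<Sum>b\<in>F. \<phi> (\<S> b * d b))"
      by (simp add: clinear_sum[OF clinear_haar])
    then show ?thesis
      using F by (simp add: N_def haar_one scaleC_complex_def)
  qed
  have x: "x \<in> N" using haar_null[OF assms] by (simp add: N_def)
  obtain F d where F: "finite F" "\<forall>b\<in>F. d b \<in> N" and t: "\<Delta> x = (\<Sum>b\<in>F. b \<otimes>\<^sub>C d b)"
    using decompose[OF x] by blast
  have "x = tensor_lift (\<lambda>a b. \<epsilon> b *\<^sub>C a) (\<Delta> x)" by (simp add: counit_right)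
  also have "\<dots> = (\<Sum>b\<in>F. \<epsilon> (d b) *\<^sub>C b)"
    by (simp add: t clinear_sum[OF clinear_tensor_lift[OF bilinear_counit_right]])
  also have "\<dots> = 0" using F counit_null by simp
  finally show ?thesis .
qed

section \<open>Orthonormal bases for the Haar inner product\<close>

abbreviation ip :: "'a \<Rightarrow> 'a \<Rightarrow> complex" where "ip x y \<equiv> \<phi> (star x * y)"

lemma clinear_ip: "clinear (ip x)"
  by (rule clinear_comp[OF clinear_haar clinear_mult_left])

lemma ip_scale_left: "ip (c *\<^sub>C x) y = cnj c * ip x y"
  by simp

lemma ip_scale_right: "ip x (c *\<^sub>C y) = c * ip x y"
  by (simp add: clinear_scaleC[OF clinear_ip] scaleC_complex_def)

lemma cnj_ip: "cnj (ip x y) = ip y x"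
  by (simp add: haar_star[symmetric] star_mult)

text \<open>The expansion formula stands in for spanning. The index range \<open>i < n\<close>
  matches the coordinates of \<open>carrier_vec n\<close>, to which finite-dimensional subspaces are
  transferred later.\<close>

definition orthonormal_basis :: "nat \<Rightarrow> (nat \<Rightarrow> 'a) \<Rightarrow> 'a set \<Rightarrow> bool" where
  "orthonormal_basis n e V \<longleftrightarrow>
     (\<forall>i<n. e i \<in> V) \<and> (\<forall>i<n. \<forall>j<n. ip (e i) (e j) = (if i = j then 1 else 0)) \<and>
     (\<forall>x\<in>V. x = (\<Sum>i<n. ip (e i) x *\<^sub>C e i))"

text \<open>Gram-Schmidt: \<open>u\<close> is the projection of the new vector \<open>v\<close>, and
  faithfulness lets a nonzero remainder \<open>w\<close> be normalised.\<close>

lemma ex_orthonormal_basis: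
  assumes "finite F"
  shows "\<exists>n e. orthonormal_basis n e (cvector.span F)"
  using assms
proof (induction F)
  case empty
  show ?case by (intro exI[of _ 0]) (simp add: orthonormal_basis_def)
next
  case (insert v F)
  then obtain n e where ob: "orthonormal_basis n e (cvector.span F)" by blast
  have e: "e i \<in> cvector.span F" if "i < n" for i
    using ob that unfolding orthonormal_basis_def by blast
  have orth: "ip (e i) (e j) = (if i = j then 1 else 0)" if "i < n" "j < n" for i j
    using ob that unfolding orthonormal_basis_def by blast
  have expand: "x = (\<Sum>i<n. ip (e i) x *\<^sub>C e i)" if "x \<in> cvector.span F" for x
    using ob that unfolding orthonormal_basis_def by blast
  define u where "u = (\<Sum>i<n. ip (e i) v *\<^sub>C e i)"
  define w where "w = v - u"
  have u: "u \<in> cvector.span F"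
    unfolding u_def by (intro cvector.span_sum cvector.span_scale e) simp
  show ?case
  proof (cases "w = 0")
    case True
    then have "v \<in> cvector.span F" using u by (simp add: w_def)
    then have "cvector.span (insert v F) = cvector.span F" by (rule cvector.span_redundant)
    then show ?thesis using ob by auto
  next
    case False
    define r where "r = Re (ip w w)"
    have ipw: "ip w w = complex_of_real r"
      using haar_pos(1)[of w] by (simp add: r_def complex_is_Real_iff complex_eq_iff)
    have "r > 0"
      using False haar_faithful[of w] haar_pos(2)[of w] unfolding ipw by force
    define s where "s = complex_of_real (1 / sqrt r)"
    have s: "s * s * complex_of_real r = 1" "cnj s = s"
      using \<open>r > 0\<close> by (simp_all add: s_def of_real_mult[symmetric] del: of_real_mult)
    have orth_w: "ip (e i) w = 0" if "i < n" for i
    proof -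
      have "ip (e i) u = (\<Sum>j<n. ip (e j) v * ip (e i) (e j))"
        unfolding u_def by (simp add: clinear_sum[OF clinear_ip] ip_scale_right)
      also have "\<dots> = (\<Sum>j<n. if j = i then ip (e i) v else 0)"
        by (rule sum.cong) (use orth that in auto)
      also have "\<dots> = ip (e i) v" using that by simp
      finally show ?thesis by (simp add: w_def clinear_diff[OF clinear_ip])
    qed
    define e' where "e' = e(n := s *\<^sub>C w)"
    have e': "e' i = e i" if "i < n" for i using that by (simp add: e'_def)
    have e'n: "e' n = s *\<^sub>C w" by (simp add: e'_def)
    have ip_w: "ip w (e i) = 0" if "i < n" for i
      using orth_w[OF that] cnj_ip[of "e i" w] by simp
    have sub: "cvector.span F \<subseteq> cvector.span (insert v F)" by (rule cvector.span_mono) auto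
    have w: "w \<in> cvector.span (insert v F)"
      unfolding w_def using cvector.span_diff[OF cvector.span_base subsetD[OF sub u]] by simp
    have mem: "e' i \<in> cvector.span (insert v F)" if "i < Suc n" for i
      using that e sub w by (cases "i = n") (auto simp: e' e'n intro!: cvector.span_scale)
    have orth': "ip (e' i) (e' j) = (if i = j then 1 else 0)" if "i < Suc n" "j < Suc n" for i j
      using that orth s
      by (cases "i = n"; cases "j = n")
        (auto simp: e' e'n ip_scale_left ip_scale_right orth_w ip_w ipw mult.assoc)
    have expand': "x = (\<Sum>i<Suc n. ip (e' i) x *\<^sub>C e' i)" if x: "x \<in> cvector.span (insert v F)" for x
    proof -
      obtain k where k: "x - k *\<^sub>C v \<in> cvector.span F"
        using x by (auto simp: cvector.span_breakdown_eq)
      define y where "y = x - k *\<^sub>C w"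
      have "y = (x - k *\<^sub>C v) + k *\<^sub>C u" by (simp add: y_def w_def algebra_simps)
      then have y: "y \<in> cvector.span F" using k u cvector.span_add cvector.span_scale by metis
      have x_eq: "x = y + k *\<^sub>C w" by (simp add: y_def)
      have "ip w y = 0"
        by (subst expand[OF y]) (simp add: clinear_sum[OF clinear_ip] ip_scale_right ip_w)
      then have "ip (e' n) x = k * (s * complex_of_real r)"
        unfolding x_eq e'n ip_scale_left clinear_add[OF clinear_ip] ip_scale_right ipw s(2) by simp
      then have "ip (e' n) x *\<^sub>C e' n = (k * (s * s * complex_of_real r)) *\<^sub>C w"
        by (simp add: e'n algebra_simps)
      then have last: "ip (e' n) x *\<^sub>C e' n = k *\<^sub>C w" by (simp only: s mult_1_right)
      have "(\<Sum>i<n. ip (e' i) x *\<^sub>C e' i) = (\<Sum>i<n. ip (e i) y *\<^sub>C e i)"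
        by (rule sum.cong) (auto simp: e' x_eq clinear_add[OF clinear_ip] ip_scale_right orth_w)
      then have "(\<Sum>i<n. ip (e' i) x *\<^sub>C e' i) = y" using expand[OF y] by simp
      then show ?thesis using last by (simp add: x_eq)
    qed
    show ?thesis
      unfolding orthonormal_basis_def using mem orth' expand' by blast
  qed
qed

end

subsection \<open>The Cartesian product of discrete quantum groups\<close>

locale dqg_pair = G1: dqg \<Gamma>\<^sub>1 + G2: dqg \<Gamma>\<^sub>2
  for \<Gamma>\<^sub>1 :: "'a::complex_star_algebra quantum_group"
    and \<Gamma>\<^sub>2 :: "'b::complex_star_algebra quantum_group"
begin

abbreviation "\<Gamma> \<equiv> cartesian_product \<Gamma>\<^sub>1 \<Gamma>\<^sub>2"

lemma product_comult: "comult \<Gamma> = (\<lambda>x. tensor_interchange (tensor_map G1.\<Delta> G2.\<Delta> x))"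
  and product_counit: "counit \<Gamma> = tensor_lift (\<lambda>a b. G1.\<epsilon> a * G2.\<epsilon> b)"
  and product_antipode: "antipode \<Gamma> = tensor_map G1.\<S> G2.\<S>"
  and product_haar: "haar \<Gamma> = tensor_lift (\<lambda>a b. G1.\<phi> a * G2.\<phi> b)"
  by (simp_all add: cartesian_product_def)

lemmas comult_lin = star_homD(1)[OF G1.star_hom_comult] star_homD(1)[OF G2.star_hom_comult]

lemma star_hom_product_comult: "star_hom (comult \<Gamma>)"
  unfolding product_comult
  by (intro star_hom_comp[OF star_hom_tensor_interchange] star_hom_tensor_map
      G1.star_hom_comult G2.star_hom_comult)

lemma product_comult_tprod: "comult \<Gamma> (a \<otimes>\<^sub>C b) = tensor_interchange (G1.\<Delta> a \<otimes>\<^sub>C G2.\<Delta> b)"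
  by (simp add: product_comult comult_lin)

lemma star_hom_product_counit: "star_hom (counit \<Gamma>)"
  unfolding product_counit
  by (intro star_hom_tensor_lift G1.star_hom_counit G2.star_hom_counit mult.commute)

lemma product_counit_tprod: "counit \<Gamma> (a \<otimes>\<^sub>C b) = G1.\<epsilon> a * G2.\<epsilon> b"
  unfolding product_counit by (simp add: cbilinear_mult)

lemma clinear_product_haar: "clinear (haar \<Gamma>)"
  and product_haar_tprod: "haar \<Gamma> (a \<otimes>\<^sub>C b) = G1.\<phi> a * G2.\<phi> b"
  unfolding product_haar
  by (simp_all add: cbilinear_mult)

lemma clinear_product_antipode: "clinear (antipode \<Gamma>)"
  and product_antipode_tprod: "antipode \<Gamma> (a \<otimes>\<^sub>C b) = G1.\<S> a \<otimes>\<^sub>C G2.\<S> b"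
  unfolding product_antipode
  by simp_all

lemma product_lift:
  assumes B: "cbilinear B" and B1: "cbilinear B1" and B2: "cbilinear B2"
    and eq: "\<And>a b c d. B (a \<otimes>\<^sub>C b) (c \<otimes>\<^sub>C d) = B1 a c \<otimes>\<^sub>C B2 b d"
    and r: "clinear r"
      "\<And>a b. r (a \<otimes>\<^sub>C b) = tensor_lift B1 (G1.\<Delta> a) \<otimes>\<^sub>C tensor_lift B2 (G2.\<Delta> b)"
  shows "tensor_lift B (comult \<Gamma> x) = r x"
proof (rule tensor_ext[OF clinear_comp[OF clinear_tensor_lift[OF B] star_homD(1)[OF star_hom_product_comult]] r(1)])
  show "tensor_lift B (comult \<Gamma> (a \<otimes>\<^sub>C b)) = r (a \<otimes>\<^sub>C b)" for a b
    unfolding product_comult_tprod r(2)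
    by (rule tensor_lift_interchange[OF B cbilinear_tprod[OF clinear_id clinear_id] B1 B2 eq])
qed

text \<open>Both sides equal \<open>K\<close> applied to the iterated coproducts of the two factors,
  where \<open>K\<close> shuffles three legs of each factor into three pairs. Coassociativity of the
  factors then identifies the arguments of \<open>K\<close>.\<close>

lemma product_coassoc:
  "tensor_assoc (tensor_map (comult \<Gamma>) id (comult \<Gamma> x)) = tensor_map id (comult \<Gamma>) (comult \<Gamma> x)"
proof -
  note D = star_homD(1)[OF star_hom_product_comult]
  note id_lin = clinear_id'
  define I :: "(('a, 'b) tensor, (('a, 'a) tensor, ('b, 'b) tensor) tensor) tensor \<Rightarrow> _"
    where "I = tensor_map id tensor_interchange"
  have I: "clinear I"
    unfolding I_def by (rule clinear_tensor_map[OF id_lin star_homD(1)[OF star_hom_tensor_interchange]])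
  note X = star_homD(1)[OF star_hom_tensor_interchange]
  define K where "K p q = I (tensor_interchange (p \<otimes>\<^sub>C q))" for p q
  have K: "cbilinear K"
    unfolding K_def by (rule clinear_cbilinear[OF clinear_comp[OF I X] cbilinear_tprod[OF clinear_id clinear_id]])
  have right: "tensor_map id (comult \<Gamma>) (tensor_interchange (s \<otimes>\<^sub>C t)) =
      K (tensor_map id G1.\<Delta> s) (tensor_map id G2.\<Delta> t)" for s t
  proof (rule tensor_ext_bilinear[of "\<lambda>s t. tensor_map id (comult \<Gamma>) (tensor_interchange (s \<otimes>\<^sub>C t))"
        "\<lambda>s t. K (tensor_map id G1.\<Delta> s) (tensor_map id G2.\<Delta> t)"])
    show "cbilinear (\<lambda>(s::('a, 'a) tensor) (t::('b, 'b) tensor). tensor_map id (comult \<Gamma>) (tensor_interchange (s \<otimes>\<^sub>C t)))"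
      by (rule clinear_cbilinear[OF clinear_comp[OF clinear_tensor_map[OF id_lin D] X] cbilinear_tprod[OF clinear_id clinear_id]])
    show "cbilinear (\<lambda>s t. K (tensor_map id G1.\<Delta> s) (tensor_map id G2.\<Delta> t))"
      by (intro cbilinear_comp[OF K] clinear_tensor_map id_lin comult_lin)
  qed (simp add: tensor_interchange_tprod id_lin comult_lin D product_comult_tprod K_def I_def X)
  have left': "tensor_assoc (tensor_interchange (u \<otimes>\<^sub>C v) \<otimes>\<^sub>C (a \<otimes>\<^sub>C b)) =
      K (tensor_assoc (u \<otimes>\<^sub>C a)) (tensor_assoc (v \<otimes>\<^sub>C b))" for u v a b
  proof (rule tensor_ext_bilinear[where s = u and t = v])
    show "cbilinear (\<lambda>(u::('a, 'a) tensor) (v::('b, 'b) tensor). tensor_assoc (tensor_interchange (u \<otimes>\<^sub>C v) \<otimes>\<^sub>C (a \<otimes>\<^sub>C b)))"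
      by (rule clinear_cbilinear[OF clinear_comp[OF clinear_comp[OF clinear_tensor_assoc clinear_tprod_left] X]
            cbilinear_tprod[OF clinear_id clinear_id]])
    show "cbilinear (\<lambda>u v. K (tensor_assoc (u \<otimes>\<^sub>C a)) (tensor_assoc (v \<otimes>\<^sub>C b)))"
      by (intro cbilinear_comp[OF K] clinear_comp[OF clinear_tensor_assoc clinear_tprod_left])
  qed (simp add: tensor_interchange_tprod tensor_assoc_tprod K_def I_def id_lin X)
  have left: "tensor_assoc (tensor_map (comult \<Gamma>) id (tensor_interchange (s \<otimes>\<^sub>C t))) =
      K (tensor_assoc (tensor_map G1.\<Delta> id s)) (tensor_assoc (tensor_map G2.\<Delta> id t))" for s t
  proof (rule tensor_ext_bilinear[of "\<lambda>s t. tensor_assoc (tensor_map (comult \<Gamma>) id (tensor_interchange (s \<otimes>\<^sub>C t)))"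
        "\<lambda>s t. K (tensor_assoc (tensor_map G1.\<Delta> id s)) (tensor_assoc (tensor_map G2.\<Delta> id t))"])
    show "cbilinear (\<lambda>(s::('a, 'a) tensor) (t::('b, 'b) tensor). tensor_assoc (tensor_map (comult \<Gamma>) id (tensor_interchange (s \<otimes>\<^sub>C t))))"
      by (rule clinear_cbilinear[OF clinear_comp[OF clinear_comp[OF clinear_tensor_assoc clinear_tensor_map[OF D id_lin]] X]
            cbilinear_tprod[OF clinear_id clinear_id]])
    show "cbilinear (\<lambda>s t. K (tensor_assoc (tensor_map G1.\<Delta> id s)) (tensor_assoc (tensor_map G2.\<Delta> id t)))"
      by (intro cbilinear_comp[OF K] clinear_comp[OF clinear_tensor_assoc] clinear_tensor_map id_lin comult_lin)
  qed (simp add: tensor_interchange_tprod id_lin comult_lin D product_comult_tprod left')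
  show ?thesis
    by (rule tensor_ext[where t = x])
      (simp_all only: product_comult_tprod left right G1.coassoc G2.coassoc clinear_comp[OF clinear_tensor_assoc]
        clinear_comp[OF clinear_tensor_map[OF D id_lin] D] clinear_comp[OF clinear_tensor_map[OF id_lin D] D])
qed

text \<open>Rewriting \<open>t\<close> with orthonormal left legs \<open>e i\<close> and right legs
  \<open>f i\<close> removes the cross terms, and the value becomes a sum of the positive numbers
  \<open>G2.ip (f i) (f i)\<close>.\<close>

lemma product_haar_pos: "haar \<Gamma> (star t * t) \<in> \<real> \<and> Re (haar \<Gamma> (star t * t)) \<ge> 0"
proof -
  obtain F d where F: "finite F" and t: "t = (\<Sum>b\<in>F. b \<otimes>\<^sub>C d b)"
    using tensor_eq_sum_basis by blast
  obtain n e where "G1.orthonormal_basis n e (cvector.span F)"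
    using G1.ex_orthonormal_basis[OF F] by blast
  then have orth: "\<And>i j. i < n \<Longrightarrow> j < n \<Longrightarrow> G1.ip (e i) (e j) = (if i = j then 1 else 0)"
    and expand: "\<And>x. x \<in> cvector.span F \<Longrightarrow> x = (\<Sum>i<n. G1.ip (e i) x *\<^sub>C e i)"
    unfolding G1.orthonormal_basis_def by blast+
  define f where "f i = (\<Sum>b\<in>F. G1.ip (e i) b *\<^sub>C d b)" for i
  have "t = (\<Sum>b\<in>F. (\<Sum>i<n. G1.ip (e i) b *\<^sub>C e i) \<otimes>\<^sub>C d b)"
    unfolding t by (rule sum.cong[OF refl]) (metis expand cvector.span_base)
  also have "\<dots> = (\<Sum>i<n. e i \<otimes>\<^sub>C f i)"
    unfolding f_def
    by (simp only: clinear_sum[OF clinear_tprod_left] clinear_sum[OF clinear_tprod_right]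
        tprod_scaleC_left tprod_scaleC_right) (rule sum.swap)
  finally have t': "t = (\<Sum>i<n. e i \<otimes>\<^sub>C f i)" .
  have "haar \<Gamma> (star t * t) = (\<Sum>i<n. \<Sum>j<n. G1.ip (e i) (e j) * G2.ip (f i) (f j))"
    by (simp add: t' star_sum sum_distrib_left sum_distrib_right clinear_sum[OF clinear_product_haar]
        product_haar_tprod) (rule sum.swap)
  also have "\<dots> = (\<Sum>i<n. \<Sum>j<n. if i = j then G2.ip (f i) (f i) else 0)"
    by (intro sum.cong refl) (simp add: orth)
  also have "\<dots> = (\<Sum>i<n. G2.ip (f i) (f i))" by simp
  finally show ?thesis
    using G2.haar_pos by (simp add: sum_nonneg)
qed

lemma dqg_product: "discrete_quantum_group \<Gamma>"
proof -
  have "hopf_star_algebra \<Gamma>"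
    unfolding hopf_star_algebra_def
  proof (intro conjI allI product_coassoc clinear_product_antipode
      star_homD[OF star_hom_product_comult] star_homD(1-3)[OF star_hom_product_counit])
    fix x :: "('a, 'b) tensor"
    note eps = star_homD(1)[OF star_hom_product_counit]
    show "tensor_lift (\<lambda>a b. counit \<Gamma> a *\<^sub>C b) (comult \<Gamma> x) = x"
      by (rule product_lift[OF cbilinear_scaleC[OF eps clinear_id] G1.bilinear_counit_left G2.bilinear_counit_left _ clinear_id])
        (simp_all add: product_counit_tprod G1.counit_left G2.counit_left)
    show "tensor_lift (\<lambda>a b. counit \<Gamma> b *\<^sub>C a) (comult \<Gamma> x) = x"
      by (rule product_lift[OF cbilinear_scaleC'[OF clinear_id eps] G1.bilinear_counit_right G2.bilinear_counit_right _ clinear_id])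
        (simp_all add: product_counit_tprod G1.counit_right G2.counit_right)
    have r: "clinear (\<lambda>x. counit \<Gamma> x *\<^sub>C 1)"
      by (rule cbilinearD(2)[OF cbilinear_scaleC[OF eps clinear_id]])
    show "tensor_lift (\<lambda>a b. antipode \<Gamma> a * b) (comult \<Gamma> x) = counit \<Gamma> x *\<^sub>C 1"
      by (rule product_lift[OF cbilinear_mult[OF clinear_product_antipode clinear_id] G1.bilinear_antipode_left G2.bilinear_antipode_left _ r])
        (simp_all add: product_counit_tprod product_antipode_tprod G1.antipode_left G2.antipode_left one_tensor_def)
    show "tensor_lift (\<lambda>a b. a * antipode \<Gamma> b) (comult \<Gamma> x) = counit \<Gamma> x *\<^sub>C 1"
      by (rule product_lift[OF cbilinear_mult[OF clinear_id clinear_product_antipode] G1.bilinear_antipode_right G2.bilinear_antipode_right _ r])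
        (simp_all add: product_counit_tprod product_antipode_tprod G1.antipode_right G2.antipode_right one_tensor_def)
  qed
  moreover have "invariant_state \<Gamma>"
    unfolding invariant_state_def
  proof (intro conjI allI clinear_product_haar product_haar_pos[THEN conjunct1] product_haar_pos[THEN conjunct2])
    fix x :: "('a, 'b) tensor"
    show "haar \<Gamma> 1 = 1" by (simp add: one_tensor_def product_haar_tprod G1.haar_one G2.haar_one)
    have r: "clinear (\<lambda>x. haar \<Gamma> x *\<^sub>C 1)"
      by (rule cbilinearD(2)[OF cbilinear_scaleC[OF clinear_product_haar clinear_id]])
    show "tensor_lift (\<lambda>a b. haar \<Gamma> b *\<^sub>C a) (comult \<Gamma> x) = haar \<Gamma> x *\<^sub>C 1"
      by (rule product_lift[OF cbilinear_scaleC'[OF clinear_id clinear_product_haar] G1.bilinear_haar_right G2.bilinear_haar_right _ r])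
        (simp_all add: product_haar_tprod G1.haar_right G2.haar_right one_tensor_def)
    show "tensor_lift (\<lambda>a b. haar \<Gamma> a *\<^sub>C b) (comult \<Gamma> x) = haar \<Gamma> x *\<^sub>C 1"
      by (rule product_lift[OF cbilinear_scaleC[OF clinear_product_haar clinear_id] G1.bilinear_haar_left G2.bilinear_haar_left _ r])
        (simp_all add: product_haar_tprod G1.haar_left G2.haar_left one_tensor_def)
  qed
  ultimately show ?thesis by (simp add: discrete_quantum_group_def)
qed

end

subsection \<open>Coordinate calculus for \<open>\<complex>\<^sup>n \<otimes> H\<close>\<close>

lemma vec_tprod_carrier [simp]: "vec_tprod v h \<in> carrier_vec n \<longleftrightarrow> v \<in> carrier_vec n"
  unfolding vec_tprod_def by (rule map_carrier_vec)

lemma vec_tprod_index [simp]: "i < dim_vec v \<Longrightarrow> vec_tprod v h $ i = v $ i *\<^sub>C h"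
  by (simp add: vec_tprod_def)

lemma dim_vec_tprod [simp]: "dim_vec (vec_tprod v h) = dim_vec v"
  by (simp add: vec_tprod_def)

lemma vec_tprod_complex: "vec_tprod v (1::complex) = v"
  by (rule eq_vecI) (simp_all add: scaleC_complex_def)

lemma vec_tprod_add:
  assumes "v \<in> carrier_vec n" "w \<in> carrier_vec n"
  shows "vec_tprod (v + w) h = vec_tprod v h + vec_tprod w h"
  using assms by (intro eq_vecI) (simp_all add: scaleC_add_left)

lemma vec_tprod_smult: "vec_tprod (c \<cdot>\<^sub>v v) h = map_vec (scaleC c) (vec_tprod v h)"
  by (rule eq_vecI) simp_all

lemma map_vec_ident [simp]: "map_vec (\<lambda>x. x) v = v"
  by (rule eq_vecI) simp_all

lemma map_vec_comp: "map_vec f (map_vec g v) = map_vec (\<lambda>x. f (g x)) v"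
  by (rule eq_vecI) simp_all

lemma map_vec_add:
  assumes "semilinear \<sigma> f" "x \<in> carrier_vec n" "y \<in> carrier_vec n"
  shows "map_vec f (x + y) = map_vec f x + map_vec f y"
  using assms by (intro eq_vecI) (simp_all add: semilinear_def)

lemma map_vec_tprod: "clinear f \<Longrightarrow> map_vec f (vec_tprod v h) = vec_tprod v (f h)"
  by (rule eq_vecI) (simp_all add: clinear_scaleC)

lemma map_vec_star_tprod: "map_vec star (vec_tprod v h) = vec_tprod (map_vec cnj v) (star h)"
  by (rule eq_vecI) simp_all

lemma semilinear_star: "semilinear cnj star"
  by (simp add: semilinear_def)

lemma vec_sum_induct:
  assumes x: "x \<in> carrier_vec n"
    and add: "\<And>x y. x \<in> carrier_vec n \<Longrightarrow> y \<in> carrier_vec n \<Longrightarrow> P x \<Longrightarrow> P y \<Longrightarrow> P (x + y)"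
    and zero: "P (vec n (\<lambda>_. 0))"
    and unit: "\<And>i. i < n \<Longrightarrow> P (vec n (\<lambda>j. if j = i then x $ i else 0))"
  shows "P (x :: 'h::complex_vector vec)"
proof -
  have "k \<le> n \<Longrightarrow> P (vec n (\<lambda>i. if i < k then x $ i else 0))" for k
  proof (induction k)
    case (Suc k)
    have "vec n (\<lambda>i. if i < Suc k then x $ i else 0) =
        vec n (\<lambda>i. if i < k then x $ i else 0) + vec n (\<lambda>j. if j = k then x $ k else 0)"
      by (rule eq_vecI) (auto simp: less_Suc_eq)
    then show ?case using Suc by (simp add: add unit)
  qed (simp add: zero)
  from this[of n] have "P (vec n (\<lambda>i. if i < n then x $ i else 0))" by simp
  also have "vec n (\<lambda>i. if i < n then x $ i else 0) = x"
    by (rule eq_vecI) (use x in auto)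
  finally show ?thesis .
qed

text \<open>Elementary tensors absorb scalars and zero, so an identity between additive expressions
  over \<open>\<complex>\<^sup>n \<otimes> H\<close> has to be checked only on them. The amplified
  algebra and module laws are lifted from the laws over \<complex> in this way.\<close>

lemma vec_tensor_induct [consumes 1, case_names add tprod]:
  assumes x: "x \<in> carrier_vec n"
    and add: "\<And>x y. x \<in> carrier_vec n \<Longrightarrow> y \<in> carrier_vec n \<Longrightarrow> P x \<Longrightarrow> P y \<Longrightarrow> P (x + y)"
    and tprod: "\<And>v h. v \<in> carrier_vec n \<Longrightarrow> P (vec_tprod v h)"
  shows "P (x :: 'h::complex_vector vec)"
proof (rule vec_sum_induct[OF x])
  show "P (y + z)" if "y \<in> carrier_vec n" "z \<in> carrier_vec n" "P y" "P z" for y z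
    using that by (rule add)
next
  have "vec n (\<lambda>_. 0) = vec_tprod (0\<^sub>v n) (0::'h)"
    by (rule eq_vecI) simp_all
  then show "P (vec n (\<lambda>_. 0))" using tprod[of "0\<^sub>v n" 0] by simp
  fix i assume "i < n"
  have "vec n (\<lambda>j. if j = i then x $ i else 0) = vec_tprod (unit_vec n i) (x $ i)"
    by (rule eq_vecI) (use \<open>i < n\<close> in \<open>auto simp: scaleC_one\<close>)
  then show "P (vec n (\<lambda>j. if j = i then x $ i else 0))" using tprod[of "unit_vec n i"] by simp
qed

lemma vec_tensor_induct3 [consumes 3, case_names add1 add2 add3 tprod]:
  fixes x y z :: "'h::complex_vector vec"
  assumes x: "x \<in> carrier_vec n" and y: "y \<in> carrier_vec m" and z: "z \<in> carrier_vec k"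
    and add1: "\<And>x x' y z. x \<in> carrier_vec n \<Longrightarrow> x' \<in> carrier_vec n \<Longrightarrow> y \<in> carrier_vec m \<Longrightarrow> z \<in> carrier_vec k \<Longrightarrow>
      P x y z \<Longrightarrow> P x' y z \<Longrightarrow> P (x + x') y z"
    and add2: "\<And>x y y' z. x \<in> carrier_vec n \<Longrightarrow> y \<in> carrier_vec m \<Longrightarrow> y' \<in> carrier_vec m \<Longrightarrow> z \<in> carrier_vec k \<Longrightarrow>
      P x y z \<Longrightarrow> P x y' z \<Longrightarrow> P x (y + y') z"
    and add3: "\<And>x y z z'. x \<in> carrier_vec n \<Longrightarrow> y \<in> carrier_vec m \<Longrightarrow> z \<in> carrier_vec k \<Longrightarrow> z' \<in> carrier_vec k \<Longrightarrow>
      P x y z \<Longrightarrow> P x y z' \<Longrightarrow> P x y (z + z')"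
    and tprod: "\<And>u v w f g h. u \<in> carrier_vec n \<Longrightarrow> v \<in> carrier_vec m \<Longrightarrow> w \<in> carrier_vec k \<Longrightarrow>
      P (vec_tprod u f) (vec_tprod v g) (vec_tprod w h)"
  shows "P x y z"
  using x
proof (induction x rule: vec_tensor_induct)
  case (tprod u f)
  note u = this
  show ?case using y
  proof (induction y rule: vec_tensor_induct)
    case (tprod v g)
    show ?case using z
      by (induction z rule: vec_tensor_induct) (simp_all add: add3 assms(7) u tprod)
  qed (simp add: add2 u z)
qed (simp add: add1 y z)

lemma vec_semilinear_expand:
  assumes f: "vec_semilinear \<sigma> n k f" and v: "v \<in> carrier_vec n" and l: "l < k"
  shows "f v $ l = (\<Sum>i<n. \<sigma> (v $ i) *\<^sub>C (f (unit_vec n i) $ l))"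
proof -
  have carrier: "f x \<in> carrier_vec k" if "x \<in> carrier_vec n" for x
    using f that by (simp add: vec_semilinear_def)
  have dim: "dim_vec (f x) = k" if "x \<in> carrier_vec n" for x
    using carrier[OF that] by simp
  have scale: "f (c \<cdot>\<^sub>v x) $ l = \<sigma> c *\<^sub>C (f x $ l)" if "x \<in> carrier_vec n" for c x
    using f that l dim[OF that] unfolding vec_semilinear_def by (metis index_map_vec(1))
  have add: "f (x + y) $ l = f x $ l + f y $ l" if "x \<in> carrier_vec n" "y \<in> carrier_vec n" for x y
    using f that l dim[OF that(2)] unfolding vec_semilinear_def by (metis index_add_vec(1))
  have zero: "f (0\<^sub>v n) $ l = 0"
    using add[of "0\<^sub>v n" "0\<^sub>v n"] by simp
  have partial: "m \<le> n \<Longrightarrow> f (vec n (\<lambda>i. if i < m then v $ i else 0)) $ l =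
      (\<Sum>i<m. \<sigma> (v $ i) *\<^sub>C (f (unit_vec n i) $ l))" for m
  proof (induction m)
    case 0
    have "vec n (\<lambda>i. if i < 0 then v $ i else 0) = 0\<^sub>v n" by (rule eq_vecI) simp_all
    then show ?case using zero by simp
  next
    case (Suc m)
    have "vec n (\<lambda>i. if i < Suc m then v $ i else 0) =
        vec n (\<lambda>i. if i < m then v $ i else 0) + v $ m \<cdot>\<^sub>v unit_vec n m"
      by (rule eq_vecI) (use Suc.prems in \<open>auto simp: less_Suc_eq\<close>)
    then show ?case using Suc by (simp add: add scale)
  qed
  moreover have "vec n (\<lambda>i. if i < n then v $ i else 0) = v"
    by (rule eq_vecI) (use v in auto)
  ultimately show ?thesis using partial[of n] by simp
qed

lemma amplify2_carrier [simp]: "amplify2 k f x y \<in> carrier_vec k"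
  and amplify_carrier [simp]: "amplify k g x \<in> carrier_vec k"
  and amplify_corep_carrier [simp]: "amplify_corep k \<delta> x \<in> carrier_vec k"
  by (simp_all add: amplify2_def amplify_def amplify_corep_def)

lemma map_vec_amplify2:
  assumes "clinear h" "\<And>x y. h (x * y) = h x * h y"
  shows "map_vec h (amplify2 k f x y) = amplify2 k f (map_vec h x) (map_vec h y)"
  by (rule eq_vecI) (simp_all add: amplify2_def assms clinear_sum[OF assms(1)] clinear_scaleC[OF assms(1)])

lemma map_vec_amplify:
  assumes "clinear h"
  shows "map_vec h (amplify k f x) = amplify k f (map_vec h x)"
  by (rule eq_vecI) (simp_all add: amplify_def clinear_sum[OF assms(1)] clinear_scaleC[OF assms(1)])

lemma map_vec_hom_amplify2:
  "star_hom h \<Longrightarrow> map_vec h (amplify2 k f x y) = amplify2 k f (map_vec h x) (map_vec h y)"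
  by (simp add: map_vec_amplify2 star_homD)

lemma map_vec_hom_tprod_one: "star_hom f \<Longrightarrow> map_vec f (vec_tprod v 1) = vec_tprod v 1"
  by (simp add: map_vec_tprod star_homD)

lemma map_vec_scaleC_amplify2:
  "amplify2 k f X (map_vec (scaleC c) y) = map_vec (scaleC c) (amplify2 k f X y)"
  by (rule eq_vecI) (simp_all add: amplify2_def cvector.scale_sum_right mult.commute)

lemma amplify2_add_left:
  assumes "x \<in> carrier_vec n" "x' \<in> carrier_vec n"
  shows "amplify2 k f (x + x') y = amplify2 k f x y + amplify2 k f x' y"
  using assms by (intro eq_vecI)
    (simp_all add: amplify2_def distrib_right scaleC_add_right sum.distrib)

lemma amplify2_add_right:
  assumes "y \<in> carrier_vec n" "y' \<in> carrier_vec n"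
  shows "amplify2 k f x (y + y') = amplify2 k f x y + amplify2 k f x y'"
  using assms by (intro eq_vecI)
    (simp_all add: amplify2_def distrib_left scaleC_add_right sum.distrib)

lemma amplify_add:
  assumes "x \<in> carrier_vec n" "x' \<in> carrier_vec n"
  shows "amplify k f (x + x') = amplify k f x + amplify k f x'"
  using assms by (intro eq_vecI) (simp_all add: amplify_def scaleC_add_right sum.distrib)

lemma amplify_corep_add:
  assumes "x \<in> carrier_vec n" "x' \<in> carrier_vec n"
  shows "amplify_corep k f (x + x') = amplify_corep k f x + amplify_corep k f x'"
  using assms by (intro eq_vecI) (simp_all add: amplify_corep_def tprod_add_right sum.distrib)

lemma vec_semilinear_carrier: "vec_semilinear \<sigma> n k f \<Longrightarrow> v \<in> carrier_vec n \<Longrightarrow> f v \<in> carrier_vec k"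
  by (simp add: vec_semilinear_def)

lemma vec_sesquilinear_carrier:
  "vec_sesquilinear \<sigma> \<tau> n m k f \<Longrightarrow> v \<in> carrier_vec n \<Longrightarrow> w \<in> carrier_vec m \<Longrightarrow> f v w \<in> carrier_vec k"
  unfolding vec_sesquilinear_def by (blast intro: vec_semilinear_carrier)

lemma vec_sesquilinear_expand:
  assumes f: "vec_sesquilinear \<sigma> \<tau> n m k f" and v: "v \<in> carrier_vec n" and w: "w \<in> carrier_vec m"
    and l: "l < k"
  shows "f v w $ l = (\<Sum>i<n. \<Sum>j<m. (\<sigma> (v $ i) * \<tau> (w $ j)) * (f (unit_vec n i) (unit_vec m j) $ l))"
proof -
  have "f v w $ l = (\<Sum>i<n. \<sigma> (v $ i) *\<^sub>C (f (unit_vec n i) w $ l))"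
    by (rule vec_semilinear_expand[OF _ v l]) (use f w in \<open>simp add: vec_sesquilinear_def\<close>)
  moreover have "f (unit_vec n i) w $ l = (\<Sum>j<m. \<tau> (w $ j) *\<^sub>C (f (unit_vec n i) (unit_vec m j) $ l))" for i
    by (rule vec_semilinear_expand[OF _ w l]) (use f in \<open>simp add: vec_sesquilinear_def\<close>)
  ultimately show ?thesis
    by (simp add: scaleC_complex_def sum_distrib_left mult.assoc)
qed

text \<open>\<open>amplify2\<close> sees \<open>f\<close> only on unit vectors and is linear in the
  coordinates, so a conjugate-linear slot of \<open>f\<close> receives the conjugated vector. The
  auxiliary \<open>v'\<close> and \<open>w'\<close> treat the bilinear case and both sesquilinear
  cases at once.\<close>

lemma amplify2_tprod_aux:
  assumes f: "vec_sesquilinear \<sigma> \<tau> n m k f" and v: "v \<in> carrier_vec n" and w: "w \<in> carrier_vec m"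
    and v': "v' \<in> carrier_vec n" "\<And>i. i < n \<Longrightarrow> \<sigma> (v' $ i) = v $ i"
    and w': "w' \<in> carrier_vec m" "\<And>i. i < m \<Longrightarrow> \<tau> (w' $ i) = w $ i"
  shows "amplify2 k f (vec_tprod v g) (vec_tprod w h) = vec_tprod (f v' w') (g * h)"
proof (rule eq_vecI)
  have c: "f v' w' \<in> carrier_vec k" by (rule vec_sesquilinear_carrier[OF f v'(1) w'(1)])
  then show "dim_vec (amplify2 k f (vec_tprod v g) (vec_tprod w h)) = dim_vec (vec_tprod (f v' w') (g * h))"
    by (simp add: amplify2_def)
  fix l assume "l < dim_vec (vec_tprod (f v' w') (g * h))"
  then have l: "l < k" using c by simp
  have "amplify2 k f (vec_tprod v g) (vec_tprod w h) $ l =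
      (\<Sum>i<n. \<Sum>j<m. ((v $ i * w $ j) * (f (unit_vec n i) (unit_vec m j) $ l)) *\<^sub>C (g * h))"
    using v w l by (simp add: amplify2_def mult_ac)
  also have "\<dots> = (\<Sum>i<n. \<Sum>j<m. (v $ i * w $ j) * (f (unit_vec n i) (unit_vec m j) $ l)) *\<^sub>C (g * h)"
    by (simp add: cvector.scale_sum_left)
  also have "(\<Sum>i<n. \<Sum>j<m. (v $ i * w $ j) * (f (unit_vec n i) (unit_vec m j) $ l)) = f v' w' $ l"
    unfolding vec_sesquilinear_expand[OF f v'(1) w'(1) l] by (intro sum.cong refl) (simp add: v' w')
  finally show "amplify2 k f (vec_tprod v g) (vec_tprod w h) $ l = vec_tprod (f v' w') (g * h) $ l"
    using c l by simp
qed

lemma amplify2_tprod: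
  assumes "vec_bilinear n m k f" "v \<in> carrier_vec n" "w \<in> carrier_vec m"
  shows "amplify2 k f (vec_tprod v g) (vec_tprod w h) = vec_tprod (f v w) (g * h)"
  using assms by (intro amplify2_tprod_aux) auto

lemma amplify2_tprod_right:
  assumes "vec_sesquilinear (\<lambda>c. c) cnj n m k f" "v \<in> carrier_vec n" "w \<in> carrier_vec m"
  shows "amplify2 k f (vec_tprod v g) (vec_tprod (map_vec cnj w) h) = vec_tprod (f v w) (g * h)"
  using assms by (intro amplify2_tprod_aux) auto

lemma amplify2_tprod_left:
  assumes "vec_sesquilinear cnj (\<lambda>c. c) n m k f" "v \<in> carrier_vec n" "w \<in> carrier_vec m"
  shows "amplify2 k f (vec_tprod (map_vec cnj v) g) (vec_tprod w h) = vec_tprod (f v w) (g * h)"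
  using assms by (intro amplify2_tprod_aux) auto

lemma amplify2_complex:
  assumes "vec_bilinear n m k f" "v \<in> carrier_vec n" "w \<in> carrier_vec m"
  shows "amplify2 k f v w = f v w"
  using amplify2_tprod[OF assms, where g = "1::complex" and h = "1::complex"] by (simp add: vec_tprod_complex)

lemma amplify_tprod:
  assumes f: "vec_semilinear cnj n k f" and v: "v \<in> carrier_vec n"
  shows "amplify k f (vec_tprod (map_vec cnj v) h) = vec_tprod (f v) h"
proof (rule eq_vecI)
  have c: "f v \<in> carrier_vec k" by (rule vec_semilinear_carrier[OF f v])
  then show "dim_vec (amplify k f (vec_tprod (map_vec cnj v) h)) = dim_vec (vec_tprod (f v) h)"
    by (simp add: amplify_def)
  fix l assume "l < dim_vec (vec_tprod (f v) h)"
  then have l: "l < k" using c by simp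
  show "amplify k f (vec_tprod (map_vec cnj v) h) $ l = vec_tprod (f v) h $ l"
    using c l v by (simp add: amplify_def vec_semilinear_expand[OF f v l] cvector.scale_sum_left scaleC_complex_def
        mult.commute)
qed

lemma amplify_corep_tprod:
  assumes \<delta>: "vec_linear n k \<delta>" and v: "v \<in> carrier_vec n"
  shows "amplify_corep k \<delta> (vec_tprod v h) = map_vec (\<lambda>g. g \<otimes>\<^sub>C h) (\<delta> v)"
proof (rule eq_vecI)
  have c: "\<delta> v \<in> carrier_vec k" by (rule vec_semilinear_carrier[OF \<delta> v])
  then show "dim_vec (amplify_corep k \<delta> (vec_tprod v h)) = dim_vec (map_vec (\<lambda>g. g \<otimes>\<^sub>C h) (\<delta> v))"
    by (simp add: amplify_corep_def)
  fix l assume "l < dim_vec (map_vec (\<lambda>g. g \<otimes>\<^sub>C h) (\<delta> v))"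
  then have l: "l < k" using c by simp
  show "amplify_corep k \<delta> (vec_tprod v h) $ l = map_vec (\<lambda>g. g \<otimes>\<^sub>C h) (\<delta> v) $ l"
    using c l v by (simp add: amplify_corep_def vec_semilinear_expand[OF \<delta> v l]
        clinear_sum[OF clinear_tprod_left])
qed

subsection \<open>Amplified algebras and modules\<close>

locale fd_star_alg =
  fixes A :: fd_algebra
  assumes star_alg: "fd_star_algebra A"
begin

abbreviation mult_amp :: "'h vec \<Rightarrow> 'h vec \<Rightarrow> 'h::complex_star_algebra vec" (infixl "\<odot>" 70) where
  "x \<odot> y \<equiv> amplify2 (adim A) (amult A) x y"

abbreviation star_amp :: "'h vec \<Rightarrow> 'h::complex_star_algebra vec" where
  "star_amp x \<equiv> amplify (adim A) (astar A) (map_vec star x)"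

abbreviation one_amp :: "'h::complex_star_algebra vec" ("\<one>\<^sub>A") where
  "\<one>\<^sub>A \<equiv> vec_tprod (aone A) 1"

lemma amult_carrier: "v \<in> acarrier A \<Longrightarrow> w \<in> acarrier A \<Longrightarrow> amult A v w \<in> acarrier A"
  using star_alg by (auto simp: fd_star_algebra_def intro: vec_sesquilinear_carrier)

lemma amult_assoc:
  "v \<in> acarrier A \<Longrightarrow> w \<in> acarrier A \<Longrightarrow> u \<in> acarrier A \<Longrightarrow>
    amult A (amult A v w) u = amult A v (amult A w u)"
  using star_alg by (simp add: fd_star_algebra_def)

lemma aone_mult:
  "v \<in> acarrier A \<Longrightarrow> amult A (aone A) v = v" "v \<in> acarrier A \<Longrightarrow> amult A v (aone A) = v"
  using star_alg by (simp_all add: fd_star_algebra_def)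

lemma astar_carrier: "v \<in> acarrier A \<Longrightarrow> astar A v \<in> acarrier A"
  and astar_astar: "v \<in> acarrier A \<Longrightarrow> astar A (astar A v) = v"
  using star_alg by (auto simp: fd_star_algebra_def intro: vec_semilinear_carrier)

lemma astar_mult:
  "v \<in> acarrier A \<Longrightarrow> w \<in> acarrier A \<Longrightarrow> astar A (amult A v w) = amult A (astar A w) (astar A v)"
  using star_alg by (simp add: fd_star_algebra_def)

lemma aone_carrier [simp]: "aone A \<in> acarrier A"
  and bilinear_amult: "vec_bilinear (adim A) (adim A) (adim A) (amult A)"
  and semilinear_astar: "vec_semilinear cnj (adim A) (adim A) (astar A)"
  using star_alg by (simp_all add: fd_star_algebra_def)

lemmas mult_tprod = amplify2_tprod[OF bilinear_amult]

lemma star_amp_tprod: "v \<in> acarrier A \<Longrightarrow> star_amp (vec_tprod v h) = vec_tprod (astar A v) (star h)"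
  by (simp add: map_vec_star_tprod amplify_tprod[OF semilinear_astar])

lemma star_amp_add:
  assumes "x \<in> carrier_vec (adim A)" "y \<in> carrier_vec (adim A)"
  shows "star_amp (x + y) = star_amp x + star_amp y"
  using assms by (simp add: map_vec_add[OF semilinear_star] amplify_add[of _ "adim A"])

lemma mult_add:
  assumes "x \<in> carrier_vec (adim A)" "y \<in> carrier_vec (adim A)"
  shows "(x + y) \<odot> z = x \<odot> z + y \<odot> z" "z \<odot> (x + y) = z \<odot> x + z \<odot> y"
  using assms by (rule amplify2_add_left, rule amplify2_add_right)

lemma mult_assoc:
  assumes "x \<in> carrier_vec (adim A)" "y \<in> carrier_vec (adim A)" "z \<in> carrier_vec (adim A)"
  shows "(x \<odot> y) \<odot> z = x \<odot> (y \<odot> z)"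
  using assms
  by (induction rule: vec_tensor_induct3) (simp_all add: mult_add mult_tprod amult_carrier amult_assoc mult.assoc)

lemma one_mult:
  assumes "x \<in> carrier_vec (adim A)"
  shows "\<one>\<^sub>A \<odot> x = x" "x \<odot> \<one>\<^sub>A = x"
  using assms by (induction x rule: vec_tensor_induct) (simp_all add: mult_add mult_tprod aone_mult)

lemma star_amp_mult:
  assumes "x \<in> carrier_vec (adim A)" "y \<in> carrier_vec (adim A)"
  shows "star_amp (x \<odot> y) = star_amp y \<odot> star_amp x"
  using assms(1)
proof (induction x rule: vec_tensor_induct)
  case (tprod u h)
  show ?case using assms(2)
    by (induction y rule: vec_tensor_induct)
      (simp_all add: mult_add star_amp_add mult_tprod star_amp_tprod tprod amult_carrier astar_carrier astar_mult star_mult)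
qed (simp add: mult_add star_amp_add)

lemma star_amp_star_amp:
  assumes "x \<in> carrier_vec (adim A)"
  shows "star_amp (star_amp x) = x"
  using assms
  by (induction x rule: vec_tensor_induct)
    (simp_all add: star_amp_add star_amp_tprod astar_carrier astar_astar)

lemma astar_aone: "astar A (aone A) = aone A"
proof -
  have c: "astar A (aone A) \<in> acarrier A" by (rule astar_carrier) simp_all
  have "astar A (aone A) = amult A (astar A (aone A)) (astar A (astar A (aone A)))"
    by (simp add: astar_astar aone_mult c)
  also have "\<dots> = astar A (amult A (astar A (aone A)) (aone A))" by (simp add: astar_mult c)
  finally show ?thesis by (simp add: astar_astar aone_mult c)
qed

lemma star_amp_one: "star_amp \<one>\<^sub>A = \<one>\<^sub>A"
  by (simp add: star_amp_tprod astar_aone)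

lemma map_vec_mult: "star_hom f \<Longrightarrow> map_vec f (x \<odot> y) = map_vec f x \<odot> map_vec f y"
  by (simp add: map_vec_amplify2 star_homD)

lemma map_vec_star_amp: "star_hom f \<Longrightarrow> map_vec f (star_amp x) = star_amp (map_vec f x)"
  by (simp add: map_vec_amplify star_homD map_vec_comp)

lemma commute_scalar:
  assumes "X \<in> carrier_vec (adim A)" and f: "clinear f" and comm: "\<And>h. f h * t = t * f h"
  shows "map_vec f X \<odot> vec_tprod (aone A) t = vec_tprod (aone A) t \<odot> map_vec f X"
  using assms(1)
  by (induction X rule: vec_tensor_induct)
    (simp_all add: mult_add map_vec_add[OF f] map_vec_tprod[OF f] mult_tprod aone_mult comm)

end

text \<open>Scalars can be absorbed into the linear first argument of \<open>lip\<close>, which is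
  why there is no case for scalar multiples.\<close>

lemma full_inner_product_induct:
  assumes full: "full_inner_product A m lip" and lip: "vec_sesquilinear (\<lambda>c. c) \<tau> m m (adim A) lip"
    and a: "a \<in> acarrier A"
    and base: "\<And>x y. x \<in> carrier_vec m \<Longrightarrow> y \<in> carrier_vec m \<Longrightarrow> P (lip x y)"
    and add: "\<And>a b. a \<in> acarrier A \<Longrightarrow> b \<in> acarrier A \<Longrightarrow> P a \<Longrightarrow> P b \<Longrightarrow> P (a + b)"
  shows "P a"
proof -
  interpret vec_space "TYPE(complex)" "adim A" .
  have sl: "vec_semilinear (\<lambda>c. c) m (adim A) (\<lambda>x. lip x y)" if "y \<in> carrier_vec m" for y
    using lip that by (simp add: vec_sesquilinear_def)
  have lip_scale: "c \<cdot>\<^sub>v lip x y = lip (c \<cdot>\<^sub>v x) y" if "x \<in> carrier_vec m" "y \<in> carrier_vec m" for c x y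
  proof -
    have "lip (c \<cdot>\<^sub>v x) y = map_vec (scaleC c) (lip x y)"
      using sl[OF that(2)] that(1) by (simp add: vec_semilinear_def)
    then show ?thesis by (simp add: scaleC_complex_def smult_vec_def map_vec_def)
  qed
  have lip_carrier: "lip x y \<in> acarrier A" if "x \<in> carrier_vec m" "y \<in> carrier_vec m" for x y
    by (rule vec_sesquilinear_carrier[OF lip that])
  define S where "S = {lip x y | x y. x \<in> carrier_vec m \<and> y \<in> carrier_vec m}"
  \<comment> \<open>Quantifying over all multiples makes \<open>M\<close> a subspace although
    \<open>P\<close> is only assumed to be additive.\<close>
  define M where "M = {a \<in> acarrier A. \<forall>c. P (c \<cdot>\<^sub>v a)}"
  have S: "S \<subseteq> M"
    using lip_carrier lip_scale base by (auto simp: S_def M_def)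
  have "0\<^sub>v (adim A) = 0 \<cdot>\<^sub>v lip (0\<^sub>v m) (0\<^sub>v m)"
    using lip_carrier[of "0\<^sub>v m" "0\<^sub>v m"] by (intro eq_vecI) auto
  then have "P (0\<^sub>v (adim A))"
    using lip_scale[of "0\<^sub>v m" "0\<^sub>v m" 0] base[of "0 \<cdot>\<^sub>v 0\<^sub>v m" "0\<^sub>v m"] by simp
  then have "submodule class_ring M V"
    by unfold_locales (auto simp: M_def module_vec_simps smult_add_distrib_vec smult_smult_assoc add class_ring_simps)
  then have "span S \<subseteq> M"
    using S by (intro span_is_subset) auto
  moreover have "span S = acarrier A"
    using full by (simp add: full_inner_product_def S_def)
  ultimately have "a \<in> M" using a by blast
  then have "P (1 \<cdot>\<^sub>v a)" unfolding M_def by blast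
  then show ?thesis by simp
qed

section \<open>Hilbert bimodules with coefficients in a star-algebra\<close>

locale imprimitivity =
  A: fd_star_alg A for A +
  fixes B :: fd_algebra and m :: nat and l r lip rip
  assumes bimodule: "imprimitivity_bimodule A B m l r lip rip"
begin

notation A.mult_amp (infixl "\<odot>" 70)

abbreviation act :: "'h vec \<Rightarrow> 'h vec \<Rightarrow> 'h::complex_star_algebra vec" (infixr "\<rhd>" 65) where
  "X \<rhd> x \<equiv> amplify2 m l X x"

abbreviation ract :: "'h vec \<Rightarrow> 'h vec \<Rightarrow> 'h::complex_star_algebra vec" (infixl "\<lhd>" 65) where
  "x \<lhd> Y \<equiv> amplify2 m r x Y"

abbreviation Lip :: "'h vec \<Rightarrow> 'h vec \<Rightarrow> 'h::complex_star_algebra vec" where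
  "Lip x y \<equiv> amplify2 (adim A) lip x (map_vec star y)"

abbreviation Rip :: "'h vec \<Rightarrow> 'h vec \<Rightarrow> 'h::complex_star_algebra vec" where
  "Rip x y \<equiv> amplify2 (adim B) rip (map_vec star x) y"

lemma left_module: "left_hilbert_module A m l lip" and right_module: "right_hilbert_module B m r rip"
  and full_lip: "full_inner_product A m lip"
  using bimodule by (simp_all add: imprimitivity_bimodule_def)

lemma bilinear_l: "vec_bilinear (adim A) m m l"
  and sesquilinear_lip: "vec_sesquilinear (\<lambda>c. c) cnj m m (adim A) lip"
  using left_module by (simp_all add: left_hilbert_module_def)

lemma bilinear_r: "vec_bilinear m (adim B) m r"
  and sesquilinear_rip: "vec_sesquilinear cnj (\<lambda>c. c) m m (adim B) rip"
  using right_module by (simp_all add: right_hilbert_module_def)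

lemmas base_carrier [simp] =
  vec_sesquilinear_carrier[OF bilinear_l] vec_sesquilinear_carrier[OF bilinear_r]
  vec_sesquilinear_carrier[OF sesquilinear_lip] vec_sesquilinear_carrier[OF sesquilinear_rip]

lemma l_one: "x \<in> carrier_vec m \<Longrightarrow> l (aone A) x = x"
  and l_mult: "a \<in> acarrier A \<Longrightarrow> b \<in> acarrier A \<Longrightarrow> x \<in> carrier_vec m \<Longrightarrow> l (amult A a b) x = l a (l b x)"
  and lip_l: "a \<in> acarrier A \<Longrightarrow> x \<in> carrier_vec m \<Longrightarrow> y \<in> carrier_vec m \<Longrightarrow> lip (l a x) y = amult A a (lip x y)"
  and astar_lip: "x \<in> carrier_vec m \<Longrightarrow> y \<in> carrier_vec m \<Longrightarrow> astar A (lip x y) = lip y x"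
  using left_module by (simp_all add: left_hilbert_module_def)

lemma l_r: "a \<in> acarrier A \<Longrightarrow> x \<in> carrier_vec m \<Longrightarrow> b \<in> acarrier B \<Longrightarrow> l a (r x b) = r (l a x) b"
  and rip_l: "a \<in> acarrier A \<Longrightarrow> x \<in> carrier_vec m \<Longrightarrow> y \<in> carrier_vec m \<Longrightarrow> rip (l a x) y = rip x (l (astar A a) y)"
  and l_lip: "x \<in> carrier_vec m \<Longrightarrow> y \<in> carrier_vec m \<Longrightarrow> z \<in> carrier_vec m \<Longrightarrow> l (lip x y) z = r x (rip y z)"
  using bimodule by (simp_all add: imprimitivity_bimodule_def)

lemma lip_l_right:
  assumes "a \<in> acarrier A" "x \<in> carrier_vec m" "y \<in> carrier_vec m"
  shows "lip x (l a y) = amult A (lip x y) (astar A a)"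
proof -
  have "lip x (l a y) = astar A (lip (l a y) x)" using assms by (simp add: astar_lip)
  then show ?thesis using assms by (simp add: lip_l A.astar_mult astar_lip)
qed

lemmas amp_tprod =
  amplify2_tprod[OF bilinear_l] amplify2_tprod[OF bilinear_r]
  amplify2_tprod_right[OF sesquilinear_lip] amplify2_tprod_left[OF sesquilinear_rip]

lemmas amp_simps = amp_tprod map_vec_star_tprod A.mult_tprod amplify_tprod[OF A.semilinear_astar]
  A.amult_carrier A.astar_carrier

lemmas amp_adds =
  amplify2_add_left[of _ m] amplify2_add_left[of _ "adim A"] amplify2_add_left[of _ "adim B"]
  amplify2_add_right[of _ m] amplify2_add_right[of _ "adim A"] amplify2_add_right[of _ "adim B"]
  amplify_add[of _ "adim A"] map_vec_add[OF semilinear_star, of _ m]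
  map_vec_add[OF semilinear_star, of _ "adim A"] map_vec_add[OF semilinear_star, of _ "adim B"]

lemma Lip_tprod_one: "x \<in> carrier_vec m \<Longrightarrow> y \<in> carrier_vec m \<Longrightarrow>
    Lip (vec_tprod x 1) (vec_tprod y 1) = vec_tprod (lip x y) (1 :: 'h::complex_star_algebra)"
  and Rip_tprod_one: "x \<in> carrier_vec m \<Longrightarrow> y \<in> carrier_vec m \<Longrightarrow>
    Rip (vec_tprod x 1) (vec_tprod y 1) = vec_tprod (rip x y) (1 :: 'h)"
  by (simp_all add: amp_simps)

lemma act_mult:
  assumes "X \<in> carrier_vec (adim A)" "Y \<in> carrier_vec (adim A)" "x \<in> carrier_vec m"
  shows "(X \<odot> Y) \<rhd> x = X \<rhd> Y \<rhd> x"
  using assms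
  by (induction rule: vec_tensor_induct3) (simp_all add: amp_adds amp_simps l_mult mult.assoc)

lemma act_one:
  assumes "x \<in> carrier_vec m"
  shows "A.one_amp \<rhd> x = x"
  using assms by (induction x rule: vec_tensor_induct) (simp_all add: amp_adds amp_simps l_one)

lemma Lip_act_left:
  assumes "X \<in> carrier_vec (adim A)" "x \<in> carrier_vec m" "y \<in> carrier_vec m"
  shows "Lip (X \<rhd> x) y = X \<odot> Lip x y"
  using assms
  by (induction rule: vec_tensor_induct3) (simp_all add: amp_adds amp_simps lip_l mult.assoc)

lemma Lip_act_right:
  assumes "X \<in> carrier_vec (adim A)" "x \<in> carrier_vec m" "y \<in> carrier_vec m"
  shows "Lip x (X \<rhd> y) = Lip x y \<odot> A.star_amp X"
  using assms
  by (induction rule: vec_tensor_induct3) (simp_all add: amp_adds amp_simps lip_l_right star_mult mult.assoc)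

lemma Rip_act:
  assumes "X \<in> carrier_vec (adim A)" "x \<in> carrier_vec m" "y \<in> carrier_vec m"
  shows "Rip (X \<rhd> x) y = Rip x (A.star_amp X \<rhd> y)"
  using assms
  by (induction rule: vec_tensor_induct3) (simp_all add: amp_adds amp_simps rip_l star_mult mult.assoc)

lemma Lip_act:
  assumes "x \<in> carrier_vec m" "y \<in> carrier_vec m" "z \<in> carrier_vec m"
  shows "Lip x y \<rhd> z = x \<lhd> Rip y z"
  using assms
  by (induction rule: vec_tensor_induct3) (simp_all add: amp_adds amp_simps l_lip mult.assoc)

lemma act_ract:
  assumes "X \<in> carrier_vec (adim A)" "x \<in> carrier_vec m" "Y \<in> carrier_vec (adim B)"
  shows "(X \<rhd> x) \<lhd> Y = X \<rhd> (x \<lhd> Y)"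
  using assms
  by (induction rule: vec_tensor_induct3) (simp_all add: amp_adds amp_simps l_r mult.assoc)

lemmas lip_induct = full_inner_product_induct[OF full_lip sesquilinear_lip, consumes 1, case_names lip add]

text \<open>Multiplying \<open>X\<close> by \<open>lip x y\<close> on the right gives the inner
  product of \<open>X \<rhd> x\<close> with \<open>y\<close>, so the action determines this product.
  By fullness the unit is a sum of such inner products.\<close>

lemma act_faithful:
  assumes X: "X \<in> carrier_vec (adim A)" and Y: "Y \<in> carrier_vec (adim A)"
    and eq: "\<And>z. z \<in> carrier_vec m \<Longrightarrow> X \<rhd> vec_tprod z 1 = Y \<rhd> vec_tprod z 1"
  shows "X = Y"
proof -
  have "X \<odot> vec_tprod a 1 = Y \<odot> vec_tprod a 1" if "a \<in> acarrier A" for a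
    using that
  proof (induction a rule: lip_induct)
    case (lip x y)
    have "Z \<odot> vec_tprod (lip x y) 1 = Lip (Z \<rhd> vec_tprod x 1) (vec_tprod y 1)"
      if "Z \<in> carrier_vec (adim A)" for Z :: "'a vec"
      using that lip by (simp add: Lip_act_left Lip_tprod_one[symmetric])
    then show ?case using X Y eq[OF lip(1)] by simp
  next
    case (add a b)
    then show ?case by (simp add: vec_tprod_add amp_adds)
  qed
  from this[of "aone A"] show ?thesis using X Y by (simp add: A.one_mult)
qed

text \<open>The compatibility of the inner products expresses \<open>lip x y\<close> acting on
  \<open>w\<close> through \<open>Rip y w\<close>. Fullness of \<open>lip\<close> then recovers
  \<open>w\<close> as the unit acting on it.\<close>

lemma Rip_nondegenerate:
  assumes w: "w \<in> carrier_vec m" and w': "w' \<in> carrier_vec m"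
    and eq: "\<And>x. x \<in> carrier_vec m \<Longrightarrow> Rip (vec_tprod x 1) w = Rip (vec_tprod x 1) w'"
  shows "w = w'"
proof -
  have "vec_tprod a 1 \<rhd> w = vec_tprod a 1 \<rhd> w'" if "a \<in> acarrier A" for a
    using that
  proof (induction a rule: lip_induct)
    case (lip x y)
    have "vec_tprod (lip x y) 1 \<rhd> z = vec_tprod x 1 \<lhd> Rip (vec_tprod y 1) z"
      if "z \<in> carrier_vec m" for z :: "'a vec"
      using that lip by (simp add: Lip_act Lip_tprod_one[symmetric])
    then show ?case using w w' eq[OF lip(2)] by simp
  next
    case (add a b)
    then show ?case by (simp add: vec_tprod_add amp_adds)
  qed
  from this[of "aone A"] show ?thesis using w w' by (simp add: act_one)
qed

end

subsection \<open>Inner coactions\<close>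

text \<open>Such a \<open>U\<close> is a unitary corepresentation with coefficients in
  \<open>A\<close>: in leg notation the coproduct condition reads
  \<open>U\<^sub>1\<^sub>2 U\<^sub>1\<^sub>3\<close>. The amplified operations are spelled out
  because their notation exists only inside \<open>fd_star_alg\<close>;
  \<open>implements_iff\<close> folds them back.\<close>

definition implements ::
  "'h::complex_star_algebra quantum_group \<Rightarrow> fd_algebra \<Rightarrow> (complex vec \<Rightarrow> 'h vec) \<Rightarrow> 'h vec \<Rightarrow> bool" where
  "implements \<Gamma> A \<alpha> U \<longleftrightarrow>
     (let n = adim A; f = amult A; U' = amplify n (astar A) (map_vec star U) in
      U \<in> carrier_vec n \<and>
      amplify2 n f U' U = vec_tprod (aone A) 1 \<and> amplify2 n f U U' = vec_tprod (aone A) 1 \<and>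
      map_vec (comult \<Gamma>) U = amplify2 n f (map_vec (\<lambda>x. x \<otimes>\<^sub>C 1) U) (map_vec (\<lambda>x. 1 \<otimes>\<^sub>C x) U) \<and>
      map_vec (counit \<Gamma>) U = aone A \<and>
      (\<forall>a\<in>carrier_vec n. \<alpha> a = amplify2 n f (amplify2 n f U (vec_tprod a 1)) U'))"

context fd_star_alg
begin

lemma implements_iff:
  "implements \<Gamma> A \<alpha> U \<longleftrightarrow>
     U \<in> carrier_vec (adim A) \<and> star_amp U \<odot> U = \<one>\<^sub>A \<and> U \<odot> star_amp U = \<one>\<^sub>A \<and>
     map_vec (comult \<Gamma>) U = map_vec (\<lambda>x. x \<otimes>\<^sub>C 1) U \<odot> map_vec (\<lambda>x. 1 \<otimes>\<^sub>C x) U \<and>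
     map_vec (counit \<Gamma>) U = aone A \<and>
     (\<forall>a\<in>acarrier A. \<alpha> a = U \<odot> vec_tprod a 1 \<odot> star_amp U)"
  unfolding implements_def Let_def ..

lemma implementsD:
  assumes "implements \<Gamma> A \<alpha> U"
  shows "U \<in> carrier_vec (adim A)" "star_amp U \<odot> U = \<one>\<^sub>A" "U \<odot> star_amp U = \<one>\<^sub>A"
    "map_vec (comult \<Gamma>) U = map_vec (\<lambda>x. x \<otimes>\<^sub>C 1) U \<odot> map_vec (\<lambda>x. 1 \<otimes>\<^sub>C x) U"
    "map_vec (counit \<Gamma>) U = aone A"
    "a \<in> acarrier A \<Longrightarrow> \<alpha> a = U \<odot> vec_tprod a 1 \<odot> star_amp U"
  using assms by (simp_all add: implements_iff)

lemma implements_intertwines: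
  assumes U: "implements \<Gamma> A \<alpha> U" and a: "a \<in> acarrier A"
  shows "\<alpha> a \<odot> U = U \<odot> vec_tprod a 1"
  using a by (simp add: implementsD[OF U] mult_assoc one_mult)

text \<open>For central \<open>p\<close> the element \<open>p \<otimes> 1\<close> commutes with all
  of \<open>A \<otimes> H\<close>, hence with \<open>U\<close>, and the conjugation cancels.\<close>

lemma implements_central_fixed:
  assumes U: "implements \<Gamma> A \<alpha> U" and p: "p \<in> acarrier A"
    and central: "\<And>a. a \<in> acarrier A \<Longrightarrow> amult A p a = amult A a p"
  shows "\<alpha> p = vec_tprod p 1"
proof -
  note D = implementsD[OF U]
  have comm: "X \<odot> vec_tprod p 1 = vec_tprod p 1 \<odot> X" if "X \<in> carrier_vec (adim A)" for X
    using that by (induction X rule: vec_tensor_induct) (simp_all add: mult_add mult_tprod p central)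
  then have "\<alpha> p = vec_tprod p 1 \<odot> U \<odot> star_amp U"
    by (simp only: D(6)[OF p] comm[OF D(1)])
  then show ?thesis using D(1,3) p by (simp add: mult_assoc one_mult)
qed

end

section \<open>Equivariant bimodules and implementing unitaries\<close>

context imprimitivity
begin

text \<open>In leg notation this is \<open>U\<^sub>1\<^sub>2\<close> acting on
  \<open>y\<^sub>1\<^sub>3\<close>. It turns the corepresentation identity for
  \<open>\<delta>\<close> into the coproduct condition on \<open>U\<close>, and back.\<close>

lemma amplify_corep_act:
  fixes \<delta> :: "complex vec \<Rightarrow> 'h::complex_star_algebra vec"
  assumes \<delta>: "vec_linear m m \<delta>" and U: "U \<in> carrier_vec (adim A)"
    and eq: "\<And>z. z \<in> carrier_vec m \<Longrightarrow> \<delta> z = U \<rhd> vec_tprod z 1" and y: "y \<in> carrier_vec m"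
  shows "amplify_corep m \<delta> y = map_vec (\<lambda>x. x \<otimes>\<^sub>C 1) U \<rhd> map_vec (\<lambda>x. 1 \<otimes>\<^sub>C x) y"
  using y
proof (induction y rule: vec_tensor_induct)
  case (add x y)
  then show ?case by (simp add: amplify_corep_add[of _ m] map_vec_add[OF clinear_tprod_right, of _ m] amp_adds)
next
  case (tprod z h)
  have "map_vec (\<lambda>g. g \<otimes>\<^sub>C h) (U \<rhd> vec_tprod z 1) = map_vec (\<lambda>x. x \<otimes>\<^sub>C 1) U \<rhd> vec_tprod z (1 \<otimes>\<^sub>C h)"
    using U
    by (induction U rule: vec_tensor_induct)
      (simp_all add: amp_adds amp_simps map_vec_add[OF clinear_tprod_left, of _ m]
        map_vec_add[OF clinear_tprod_left, of _ "adim A"] tprod map_vec_tprod)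
  then show ?case
    by (simp add: tprod amplify_corep_tprod[OF \<delta>] eq map_vec_tprod)
qed

text \<open>Right linearity of \<open>\<delta>\<close> gives \<open>\<delta> (l (lip x y) z) =
  \<delta> (r x (rip y z)) = Lip (\<delta> x) (vec_tprod y 1) \<rhd> vec_tprod z 1\<close>, so
  \<open>\<delta>\<close> after a left multiplication is again a left multiplication. Equivariance
  of \<open>rip\<close> makes \<open>U\<close> isometric, equivariance of \<open>lip\<close> makes
  it implement \<open>\<alpha>\<close>.\<close>

lemma implements_of_bimodule:
  fixes \<alpha> :: "complex vec \<Rightarrow> 'h::complex_star_algebra vec"
  assumes \<Gamma>: "dqg \<Gamma>" and coaction: "coaction \<Gamma> A \<alpha>" and corep: "corepresentation \<Gamma> m \<delta>"
    and \<delta>_r: "\<And>x b. x \<in> carrier_vec m \<Longrightarrow> b \<in> acarrier B \<Longrightarrow> \<delta> (r x b) = \<delta> x \<lhd> vec_tprod b 1"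
    and \<alpha>_lip: "\<And>x y. x \<in> carrier_vec m \<Longrightarrow> y \<in> carrier_vec m \<Longrightarrow> \<alpha> (lip x y) = Lip (\<delta> x) (\<delta> y)"
    and rip_\<delta>: "\<And>x y. x \<in> carrier_vec m \<Longrightarrow> y \<in> carrier_vec m \<Longrightarrow> vec_tprod (rip x y) 1 = Rip (\<delta> x) (\<delta> y)"
  shows "\<exists>U. implements \<Gamma> A \<alpha> U"
proof -
  interpret dqg \<Gamma> by (rule \<Gamma>)
  have lin\<delta>: "vec_linear m m \<delta>" using corep by (simp add: corepresentation_def)
  have \<delta>_add: "\<delta> (x + y) = \<delta> x + \<delta> y" and \<delta>_carrier: "\<delta> x \<in> carrier_vec m"
    if "x \<in> carrier_vec m" "y \<in> carrier_vec m" for x y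
    using lin\<delta> that by (simp_all add: vec_semilinear_def)
  have lin\<alpha>: "vec_linear (adim A) (adim A) \<alpha>" using coaction by (simp add: coaction_def corepresentation_def)
  have l_add: "l (a + b) z = l a z + l b z" if "a \<in> acarrier A" "b \<in> acarrier A" "z \<in> carrier_vec m" for a b z
    using bilinear_l that by (simp add: vec_sesquilinear_def vec_semilinear_def)
  have "\<exists>X\<in>carrier_vec (adim A). \<forall>z\<in>carrier_vec m. \<delta> (l a z) = X \<rhd> vec_tprod z 1"
    if "a \<in> acarrier A" for a
    using that
  proof (induction a rule: lip_induct)
    case (lip x y)
    have "\<delta> (l (lip x y) z) = Lip (\<delta> x) (vec_tprod y 1) \<rhd> vec_tprod z 1" if "z \<in> carrier_vec m" for z
      using lip that by (simp add: l_lip \<delta>_r Lip_act \<delta>_carrier Lip_tprod_one Rip_tprod_one)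
    then show ?case by (intro bexI[of _ "Lip (\<delta> x) (vec_tprod y 1)"]) simp_all
  next
    case (add a b)
    then obtain X Y where X: "X \<in> carrier_vec (adim A)" "\<forall>z\<in>carrier_vec m. \<delta> (l a z) = X \<rhd> vec_tprod z 1"
      and Y: "Y \<in> carrier_vec (adim A)" "\<forall>z\<in>carrier_vec m. \<delta> (l b z) = Y \<rhd> vec_tprod z 1" by blast
    then show ?case using add(1,2)
      by (intro bexI[of _ "X + Y"]) (simp_all add: l_add \<delta>_add amp_adds)
  qed
  \<comment> \<open>At the unit of \<open>A\<close> the left multiplication disappears and
    \<open>\<delta>\<close> itself is left multiplication by \<open>U\<close>.\<close>
  from this[of "aone A"] obtain U where U: "U \<in> carrier_vec (adim A)"
    and "\<forall>z\<in>carrier_vec m. \<delta> (l (aone A) z) = U \<rhd> vec_tprod z 1" by auto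
  then have \<delta>: "\<delta> z = U \<rhd> vec_tprod z 1" if "z \<in> carrier_vec m" for z
    using that by (simp add: l_one)
  have star_U_U: "A.star_amp U \<odot> U = A.one_amp"
  proof (rule act_faithful)
    fix z :: "complex vec" assume z: "z \<in> carrier_vec m"
    show "A.star_amp U \<odot> U \<rhd> vec_tprod z 1 = A.one_amp \<rhd> vec_tprod z 1"
    proof (rule Rip_nondegenerate)
      fix x :: "complex vec" assume x: "x \<in> carrier_vec m"
      have "Rip (vec_tprod x 1) (A.star_amp U \<odot> U \<rhd> vec_tprod z 1) = Rip (\<delta> x) (\<delta> z)"
        using x z U by (simp add: act_mult Rip_act[symmetric] \<delta>)
      then show "Rip (vec_tprod x 1) (A.star_amp U \<odot> U \<rhd> vec_tprod z 1) =
          Rip (vec_tprod x 1) (A.one_amp \<rhd> vec_tprod z 1)"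
        using x z by (simp add: rip_\<delta>[symmetric] Lip_tprod_one Rip_tprod_one act_one)
    qed simp_all
  qed simp_all
  have \<alpha>: "\<alpha> a = U \<odot> vec_tprod a 1 \<odot> A.star_amp U" if "a \<in> acarrier A" for a
    using that
  proof (induction a rule: lip_induct)
    case (lip x y)
    have "\<alpha> (lip x y) = Lip (U \<rhd> vec_tprod x 1) (U \<rhd> vec_tprod y 1)"
      using lip by (simp add: \<alpha>_lip \<delta>)
    also have "\<dots> = U \<odot> (Lip (vec_tprod x 1) (vec_tprod y 1) \<odot> A.star_amp U)"
      using lip U by (simp add: Lip_act_left Lip_act_right A.mult_assoc)
    finally show ?case using lip U by (simp add: Lip_tprod_one Rip_tprod_one A.mult_assoc)
  next
    case (add a b)
    then have "\<alpha> (a + b) = \<alpha> a + \<alpha> b" using lin\<alpha> by (simp add: vec_semilinear_def)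
    then show ?case using add by (simp add: vec_tprod_add A.mult_add)
  qed
  \<comment> \<open>Coisometry is unitality of \<open>\<alpha>\<close>, read through the formula for
    \<open>\<alpha>\<close> just obtained.\<close>
  have U_star_U: "U \<odot> A.star_amp U = A.one_amp"
    using \<alpha>[of "aone A"] coaction U by (simp add: coaction_def A.one_mult)
  have counit: "map_vec \<epsilon> U = A.one_amp"
  proof (rule act_faithful)
    fix z :: "complex vec" assume z: "z \<in> carrier_vec m"
    have "map_vec \<epsilon> U \<rhd> vec_tprod z 1 = map_vec \<epsilon> (\<delta> z)"
      using z by (simp add: \<delta> map_vec_amplify2 counit_mult map_vec_tprod counit_one)
    also have "\<dots> = z" using corep z by (simp add: corepresentation_def)
    also have "\<dots> = A.one_amp \<rhd> vec_tprod z 1" using act_one[OF z] by (simp add: vec_tprod_complex)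
    finally show "map_vec \<epsilon> U \<rhd> vec_tprod z 1 = A.one_amp \<rhd> vec_tprod z 1" .
  qed (use U in simp_all)
  have comult: "map_vec \<Delta> U = map_vec (\<lambda>x. x \<otimes>\<^sub>C 1) U \<odot> map_vec (\<lambda>x. 1 \<otimes>\<^sub>C x) U"
  proof (rule act_faithful)
    fix z :: "complex vec" assume z: "z \<in> carrier_vec m"
    have "map_vec \<Delta> U \<rhd> vec_tprod z 1 = map_vec \<Delta> (\<delta> z)"
      using z by (simp add: \<delta> map_vec_hom_amplify2 map_vec_hom_tprod_one star_hom_comult)
    also have "\<dots> = amplify_corep m \<delta> (\<delta> z)" using corep z by (simp add: corepresentation_def)
    also have "\<dots> = map_vec (\<lambda>x. x \<otimes>\<^sub>C 1) U \<rhd> map_vec (\<lambda>x. 1 \<otimes>\<^sub>C x) (\<delta> z)"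
      by (rule amplify_corep_act[OF lin\<delta> U \<delta> \<delta>_carrier[OF z z]])
    also have "map_vec (\<lambda>x. 1 \<otimes>\<^sub>C x) (\<delta> z) = map_vec (\<lambda>x. 1 \<otimes>\<^sub>C x) U \<rhd> vec_tprod z 1"
      using z by (simp add: \<delta> map_vec_hom_amplify2 map_vec_hom_tprod_one star_hom_tprod_right)
    finally show "map_vec \<Delta> U \<rhd> vec_tprod z 1 = (map_vec (\<lambda>x. x \<otimes>\<^sub>C 1) U \<odot> map_vec (\<lambda>x. 1 \<otimes>\<^sub>C x) U) \<rhd> vec_tprod z 1"
      using z U by (simp add: act_mult)
  qed (use U in simp_all)
  show ?thesis
    using U star_U_U U_star_U comult counit \<alpha> by (auto simp: A.implements_iff vec_tprod_complex)
qed

text \<open>The corepresentation is \<open>x \<mapsto> U \<rhd> (x \<otimes> 1)\<close>. As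
  \<open>U\<close> acts from the left, it commutes with the right action and, being unitary,
  preserves \<open>rip\<close>; on \<open>lip\<close> it produces the conjugation by
  \<open>U\<close>. Hence any bimodule over \<open>A\<close> becomes equivariant with the trivial
  coaction on \<open>B\<close>.\<close>

lemma bimodule_of_implements:
  assumes \<Gamma>: "dqg \<Gamma>" and impl: "implements \<Gamma> A \<alpha> U"
  shows "equivariantly_morita_equivalent \<Gamma> A \<alpha> B (trivial_coaction :: _ \<Rightarrow> 'h::complex_star_algebra vec)"
proof -
  interpret dqg \<Gamma> by (rule \<Gamma>)
  note D = A.implementsD[OF impl]
  note U = D(1)
  define \<delta> where "\<delta> x = U \<rhd> vec_tprod x 1" for x
  have \<delta>_carrier: "\<delta> x \<in> carrier_vec m" for x by (simp add: \<delta>_def)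
  have lin: "vec_linear m m \<delta>"
    by (simp add: vec_semilinear_def \<delta>_def vec_tprod_add amp_adds vec_tprod_smult map_vec_scaleC_amplify2)
  have corep: "corepresentation \<Gamma> m \<delta>"
    unfolding corepresentation_def
  proof (intro conjI ballI lin)
    fix x :: "complex vec" assume x: "x \<in> carrier_vec m"
    have "amplify_corep m \<delta> (\<delta> x) = map_vec (\<lambda>x. x \<otimes>\<^sub>C 1) U \<rhd> map_vec (\<lambda>x. 1 \<otimes>\<^sub>C x) (\<delta> x)"
      by (rule amplify_corep_act[OF lin U \<delta>_def \<delta>_carrier])
    also have "map_vec (\<lambda>y. (1 :: 'h) \<otimes>\<^sub>C y) (\<delta> x) = map_vec (\<lambda>x. 1 \<otimes>\<^sub>C x) U \<rhd> vec_tprod x 1"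
      by (simp add: \<delta>_def map_vec_hom_amplify2 map_vec_hom_tprod_one star_hom_tprod_right)
    also have "map_vec (\<lambda>x. x \<otimes>\<^sub>C 1) U \<rhd> map_vec (\<lambda>x. 1 \<otimes>\<^sub>C x) U \<rhd> vec_tprod x 1 = map_vec \<Delta> U \<rhd> vec_tprod x 1"
      using x U by (simp add: D(4) act_mult)
    also have "\<dots> = map_vec \<Delta> (\<delta> x)"
      by (simp add: \<delta>_def map_vec_hom_amplify2 map_vec_hom_tprod_one star_hom_comult)
    finally show "map_vec \<Delta> (\<delta> x) = amplify_corep m \<delta> (\<delta> x)" ..
    have "map_vec \<epsilon> (\<delta> x) = map_vec \<epsilon> U \<rhd> vec_tprod x 1"
      by (simp add: \<delta>_def map_vec_amplify2 counit_mult map_vec_tprod counit_one)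
    also have "\<dots> = A.one_amp \<rhd> vec_tprod x 1" by (simp add: D(5) vec_tprod_complex)
    also have "\<dots> = x" using act_one[OF x] by (simp add: vec_tprod_complex)
    finally show "map_vec \<epsilon> (\<delta> x) = x" .
  qed
  show ?thesis
    unfolding equivariantly_morita_equivalent_def trivial_coaction_def
  proof (intro exI conjI ballI)
    show "imprimitivity_bimodule A B m l r lip rip" by (rule bimodule)
    show "corepresentation \<Gamma> m \<delta>" by (rule corep)
    show "\<delta> (l a x) = \<alpha> a \<rhd> \<delta> x" if "a \<in> acarrier A" "x \<in> carrier_vec m" for a x
    proof -
      have "\<alpha> a \<in> carrier_vec (adim A)" using D(6)[OF that(1)] by simp
      then have "\<alpha> a \<rhd> \<delta> x = (\<alpha> a \<odot> U) \<rhd> vec_tprod x 1"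
        using that U by (simp add: \<delta>_def act_mult)
      also have "\<dots> = U \<rhd> vec_tprod a 1 \<rhd> vec_tprod x 1"
        using that U by (simp add: A.implements_intertwines[OF impl] act_mult)
      also have "vec_tprod a 1 \<rhd> vec_tprod x (1 :: 'h) = vec_tprod (l a x) 1"
        using that by (simp add: amp_simps)
      finally show ?thesis by (simp add: \<delta>_def)
    qed
    show "\<delta> (r x b) = \<delta> x \<lhd> vec_tprod b 1" if "x \<in> carrier_vec m" "b \<in> acarrier B" for x b
      using that U by (simp add: \<delta>_def act_ract amp_simps)
    show "\<alpha> (lip x y) = Lip (\<delta> x) (\<delta> y)" if "x \<in> carrier_vec m" "y \<in> carrier_vec m" for x y
      using that U by (simp add: \<delta>_def Lip_act_left Lip_act_right Lip_tprod_one Rip_tprod_one D(6) A.mult_assoc)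
    show "vec_tprod (rip x y) 1 = Rip (\<delta> x) (\<delta> y)" if "x \<in> carrier_vec m" "y \<in> carrier_vec m" for x y
      using that U by (simp add: \<delta>_def Rip_act act_mult[symmetric] D(2) act_one Lip_tprod_one Rip_tprod_one)
  qed
qed

end

text \<open>The bimodule is returned together with \<open>U\<close>: it also serves to decompose
  central elements of amplifications of \<open>A\<close>, and to realise the Morita equivalence for
  the product.\<close>

lemma torsion_free_implements:
  fixes \<alpha> :: "complex vec \<Rightarrow> 'h::complex_star_algebra vec"
  assumes \<Gamma>: "dqg \<Gamma>" and tf: "torsion_free \<Gamma>" and coaction: "coaction \<Gamma> A \<alpha>"
  obtains k m l r lip rip U where "imprimitivity A (trivial_algebra k) m l r lip rip" "implements \<Gamma> A \<alpha> U"
proof -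
  from tf coaction obtain k where "equivariantly_morita_equivalent \<Gamma> A \<alpha> (trivial_algebra k) trivial_coaction"
    by (auto simp: torsion_free_def)
  then obtain m l r lip rip \<delta> where E: "imprimitivity_bimodule A (trivial_algebra k) m l r lip rip"
    "corepresentation \<Gamma> m \<delta>"
    "\<forall>x\<in>carrier_vec m. \<forall>b\<in>acarrier (trivial_algebra k). \<delta> (r x b) = amplify2 m r (\<delta> x) (trivial_coaction b)"
    "\<forall>x\<in>carrier_vec m. \<forall>y\<in>carrier_vec m. \<alpha> (lip x y) = amplify2 (adim A) lip (\<delta> x) (map_vec star (\<delta> y))"
    "\<forall>x\<in>carrier_vec m. \<forall>y\<in>carrier_vec m. trivial_coaction (rip x y) =
       amplify2 (adim (trivial_algebra k)) rip (map_vec star (\<delta> x)) (\<delta> y)"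
    unfolding equivariantly_morita_equivalent_def by blast
  have "fd_star_algebra A" using coaction by (simp add: coaction_def fd_cstar_algebra_def)
  then have imp: "imprimitivity A (trivial_algebra k) m l r lip rip"
    using E(1) by unfold_locales
  have "\<exists>U. implements \<Gamma> A \<alpha> U"
    by (rule imprimitivity.implements_of_bimodule[OF imp \<Gamma> coaction E(2)])
      (use E(3-5) in \<open>simp_all add: trivial_coaction_def\<close>)
  with imp that show thesis by blast
qed

subsection \<open>The norm of a state\<close>

context dqg
begin

definition nrm :: "'a \<Rightarrow> real" where "nrm x = sqrt (Re (ip x x))"

lemma nrm_nonneg: "nrm x \<ge> 0"
  using haar_pos(2)[of x] by (simp add: nrm_def)

lemma ip_self: "ip x x = complex_of_real ((nrm x)\<^sup>2)"
  using haar_pos[of x] by (simp add: nrm_def complex_is_Real_iff complex_eq_iff)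

lemma nrm_eq_0: "nrm x = 0 \<longleftrightarrow> x = 0"
proof
  assume "nrm x = 0"
  then show "x = 0" using haar_faithful[of x] by (simp add: ip_self)
qed (simp add: nrm_def clinear_0[OF clinear_haar])

lemma nrm_0 [simp]: "nrm 0 = 0"
  by (simp add: nrm_eq_0)

lemma nrm_scaleC: "nrm (c *\<^sub>C x) = cmod c * nrm x"
proof -
  have "ip (c *\<^sub>C x) (c *\<^sub>C x) = cnj c * (c * ip x x)"
    by (simp only: ip_scale_left ip_scale_right mult.left_commute)
  also have "\<dots> = complex_of_real ((cmod c * nrm x)\<^sup>2)"
    by (simp add: ip_self power_mult_distrib complex_norm_square mult_ac del: of_real_power)
  finally have "nrm (c *\<^sub>C x) = sqrt ((cmod c * nrm x)\<^sup>2)" by (simp add: nrm_def)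
  then show ?thesis by (simp add: real_sqrt_abs nrm_nonneg abs_mult)
qed

lemma nrm_Cauchy_Schwarz: "cmod (ip x y) \<le> nrm x * nrm y"
proof (cases "nrm x = 0")
  case True
  then have "x = 0" by (simp add: nrm_eq_0)
  then show ?thesis by (simp add: clinear_0[OF clinear_haar] True)
next
  case False
  then have pos: "nrm x > 0" using nrm_nonneg[of x] by simp
  define c where "c = ip x y / complex_of_real ((nrm x)\<^sup>2)"
  define z where "z = y - c *\<^sub>C x"
  have "ip x z = ip x y - c * complex_of_real ((nrm x)\<^sup>2)"
    unfolding z_def clinear_diff[OF clinear_ip] ip_scale_right ip_self ..
  then have orth: "ip x z = 0" using pos by (simp add: c_def)
  have "ip z z = ip z y - c * ip z x"
    by (subst (2) z_def) (simp add: clinear_diff[OF clinear_ip] ip_scale_right)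
  also have "ip z x = 0" using orth cnj_ip[of x z] by simp
  also have "ip z y = ip y y - cnj c * ip x y"
    using cnj_ip[of y z] unfolding z_def clinear_diff[OF clinear_ip] ip_scale_right
    by (metis cnj_ip complex_cnj_diff complex_cnj_mult)
  finally have "ip z z = ip y y - cnj c * ip x y" by simp
  moreover have "cnj c * ip x y = complex_of_real ((cmod (ip x y))\<^sup>2 / (nrm x)\<^sup>2)"
    by (simp add: c_def complex_norm_square mult.commute del: of_real_power)
  ultimately have "(cmod (ip x y))\<^sup>2 / (nrm x)\<^sup>2 \<le> (nrm y)\<^sup>2"
    using haar_pos(2)[of z] unfolding ip_self[of y] by simp
  then have "(cmod (ip x y))\<^sup>2 \<le> (nrm x * nrm y)\<^sup>2"
    using pos by (simp add: field_simps power_mult_distrib)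
  then show ?thesis by (rule power2_le_imp_le) (simp add: nrm_nonneg)
qed

lemma nrm_triangle: "nrm (x + y) \<le> nrm x + nrm y"
proof (rule power2_le_imp_le)
  have "ip (x + y) (x + y) = ip x x + ip x y + ip y x + ip y y"
    by (simp add: distrib_left distrib_right clinear_add[OF clinear_haar])
  then have "Re (ip (x + y) (x + y)) = (nrm x)\<^sup>2 + Re (ip x y) + Re (ip y x) + (nrm y)\<^sup>2"
    by (simp add: ip_self)
  moreover have "Re (ip x y) \<le> nrm x * nrm y" "Re (ip y x) \<le> nrm x * nrm y"
    using nrm_Cauchy_Schwarz[of x y] nrm_Cauchy_Schwarz[of y x] complex_Re_le_cmod[of "ip x y"]
      complex_Re_le_cmod[of "ip y x"] by (simp_all add: mult.commute)
  ultimately show "(nrm (x + y))\<^sup>2 \<le> (nrm x + nrm y)\<^sup>2"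
    by (simp add: ip_self power2_sum del: star_add)
qed (simp add: nrm_nonneg)

lemma nrm_sum: "nrm (sum f S) \<le> (\<Sum>i\<in>S. nrm (f i))"
proof (induction S rule: infinite_finite_induct)
  case (insert x S)
  then show ?case using nrm_triangle[of "f x" "sum f S"] by simp
qed (simp_all add: nrm_eq_0)

end

subsection \<open>Coactions on finite-dimensional subalgebras\<close>

text \<open>\<open>comult_mem\<close> puts the left leg of the coproduct in \<open>H\<close>, which
  is what makes the coproduct a coaction of \<open>\<Gamma>\<close> on \<open>H\<close>.\<close>

locale fd_subalgebra = dqg \<Gamma> for \<Gamma> :: "'a::complex_star_algebra quantum_group" +
  fixes H :: "'a set" and n :: nat and e :: "nat \<Rightarrow> 'a"
  assumes basis: "orthonormal_basis n e H" and subspace: "cvector.subspace H"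
    and one_mem: "1 \<in> H" and mult_mem: "x \<in> H \<Longrightarrow> y \<in> H \<Longrightarrow> x * y \<in> H"
    and star_mem: "x \<in> H \<Longrightarrow> star x \<in> H"
    and comult_mem: "x \<in> H \<Longrightarrow> \<Delta> x \<in> cvector.span {y \<otimes>\<^sub>C z | y z. y \<in> H}"
begin

lemma e_mem: "i < n \<Longrightarrow> e i \<in> H"
  and orthonormal: "i < n \<Longrightarrow> j < n \<Longrightarrow> ip (e i) (e j) = (if i = j then 1 else 0)"
  using basis unfolding orthonormal_basis_def by blast+

lemma expand: "x \<in> H \<Longrightarrow> (\<Sum>i<n. ip (e i) x *\<^sub>C e i) = x"
  using basis unfolding orthonormal_basis_def by metis

text \<open>The operator norm of left multiplication by \<open>a\<close> on \<open>H\<close> with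
  the Haar inner product; restricted to \<open>H\<close> it is the C*-norm.\<close>

definition opn :: "'a \<Rightarrow> real" where
  "opn a = Sup ((\<lambda>y. nrm (a * y)) ` {y \<in> H. nrm y \<le> 1})"

lemma ball_nonempty: "{y \<in> H. nrm y \<le> 1} \<noteq> {}"
proof -
  have "0 \<in> H" "nrm 0 \<le> 1" using subspace by (simp_all add: cvector.subspace_0 nrm_eq_0)
  then show ?thesis by blast
qed

text \<open>In the unit ball all coefficients against the orthonormal basis have modulus at most 1,
  so the norms of the finitely many \<open>a * e i\<close> give a bound.\<close>

lemma opn_bdd: "bdd_above ((\<lambda>y. nrm (a * y)) ` {y \<in> H. nrm y \<le> 1})"
proof (rule bdd_aboveI2)
  fix y assume y: "y \<in> {y \<in> H. nrm y \<le> 1}"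
  have coeff: "cmod (ip (e i) y) \<le> 1" if "i < n" for i
  proof -
    have "nrm (e i) = 1" using orthonormal[OF that that] by (simp add: nrm_def)
    then show ?thesis using nrm_Cauchy_Schwarz[of "e i" y] y by simp
  qed
  have "a * y = (\<Sum>i<n. ip (e i) y *\<^sub>C (a * e i))"
    using expand[of y] y by (metis (no_types, lifting) mem_Collect_eq scaleC_mult_right sum.cong sum_distrib_left)
  then have "nrm (a * y) \<le> (\<Sum>i<n. nrm (ip (e i) y *\<^sub>C (a * e i)))" by (simp only: nrm_sum)
  also have "\<dots> \<le> (\<Sum>i<n. nrm (a * e i))"
    unfolding nrm_scaleC by (rule sum_mono) (simp add: coeff mult_left_le_one_le nrm_nonneg)
  finally show "nrm (a * y) \<le> (\<Sum>i<n. nrm (a * e i))" .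
qed

lemma opn_le: "(\<And>y. y \<in> H \<Longrightarrow> nrm y \<le> 1 \<Longrightarrow> nrm (a * y) \<le> C) \<Longrightarrow> opn a \<le> C"
  unfolding opn_def using ball_nonempty by (intro cSup_least) auto

lemma nrm_mult_le1: "y \<in> H \<Longrightarrow> nrm y \<le> 1 \<Longrightarrow> nrm (a * y) \<le> opn a"
  unfolding opn_def by (rule cSup_upper[OF _ opn_bdd]) auto

lemma opn_nonneg: "opn a \<ge> 0"
proof -
  have "nrm (a * 0) \<le> opn a"
    by (rule nrm_mult_le1) (use subspace in \<open>simp_all add: cvector.subspace_0 nrm_eq_0\<close>)
  moreover have "nrm (a * 0) \<ge> 0" by (rule nrm_nonneg)
  ultimately show ?thesis by simp
qed

lemma nrm_mult_le:
  assumes y: "y \<in> H"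
  shows "nrm (a * y) \<le> opn a * nrm y"
proof (cases "nrm y = 0")
  case True
  then have "y = 0" by (simp add: nrm_eq_0)
  then have "nrm (a * y) = 0" by (simp add: nrm_eq_0)
  then show ?thesis by (simp add: True)
next
  case False
  then have pos: "nrm y > 0" using nrm_nonneg[of y] by simp
  define s where "s = complex_of_real (1 / nrm y)"
  have s: "cmod s = 1 / nrm y" using pos by (simp add: s_def norm_divide)
  have "nrm (a * (s *\<^sub>C y)) \<le> opn a"
    by (rule nrm_mult_le1) (use y subspace pos s in \<open>simp_all add: cvector.subspace_scale nrm_scaleC\<close>)
  then show ?thesis
    using pos by (simp add: nrm_scaleC s field_simps)
qed

lemma opn_triangle: "opn (a + b) \<le> opn a + opn b"
proof (rule opn_le)
  fix y assume "y \<in> H" "nrm y \<le> 1"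
  then have "nrm (a * y) \<le> opn a" "nrm (b * y) \<le> opn b" by (auto intro: nrm_mult_le1)
  then show "nrm ((a + b) * y) \<le> opn a + opn b"
    using nrm_triangle[of "a * y" "b * y"] by (simp add: distrib_right)
qed

lemma opn_scaleC_le: "opn (c *\<^sub>C a) \<le> cmod c * opn a"
  by (rule opn_le) (simp add: nrm_scaleC nrm_mult_le1 mult_left_mono)

lemma opn_scaleC: "opn (c *\<^sub>C a) = cmod c * opn a"
proof (cases "c = 0")
  case True
  then show ?thesis using opn_scaleC_le[of 0 a] opn_nonneg[of "0 *\<^sub>C a"] by simp
next
  case False
  have "opn (inverse c *\<^sub>C c *\<^sub>C a) \<le> cmod (inverse c) * opn (c *\<^sub>C a)" by (rule opn_scaleC_le)
  then have "opn a \<le> inverse (cmod c) * opn (c *\<^sub>C a)"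
    using False by (simp add: norm_inverse del: inverse_eq_divide)
  then have "cmod c * opn a \<le> opn (c *\<^sub>C a)"
    using False by (simp add: field_simps)
  then show ?thesis using opn_scaleC_le[of c a] by simp
qed

lemma opn_eq_0:
  shows "opn a = 0 \<longleftrightarrow> a = 0"
proof
  assume "opn a = 0"
  then have "nrm (a * 1) \<le> 0" using nrm_mult_le[OF one_mem, of a] by simp
  then show "a = 0" using nrm_nonneg[of a] by (simp add: nrm_eq_0)
next
  assume "a = 0"
  then show "opn a = 0" using opn_scaleC[of 0 0] by simp
qed

lemma opn_mult:
  assumes b: "b \<in> H"
  shows "opn (a * b) \<le> opn a * opn b"
proof (rule opn_le)
  fix y assume y: "y \<in> H" "nrm y \<le> 1"
  have "nrm (a * (b * y)) \<le> opn a * nrm (b * y)" by (rule nrm_mult_le) (simp add: mult_mem b y)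
  also have "\<dots> \<le> opn a * opn b" by (rule mult_left_mono[OF nrm_mult_le1[OF y] opn_nonneg])
  finally show "nrm (a * b * y) \<le> opn a * opn b" by (simp add: mult.assoc)
qed

text \<open>Left multiplication by \<open>star a\<close> is the adjoint of left multiplication by
  \<open>a\<close>, so Cauchy-Schwarz bounds the square of \<open>nrm (a * y)\<close> by the norm of
  \<open>star a * a * y\<close>.\<close>

lemma opn_square_le:
  assumes a: "a \<in> H"
  shows "(opn a)\<^sup>2 \<le> opn (star a * a)"
proof -
  have "opn a \<le> sqrt (opn (star a * a))"
  proof (rule opn_le)
    fix y assume y: "y \<in> H" "nrm y \<le> 1"
    have "(nrm (a * y))\<^sup>2 = Re (ip y (star a * a * y))"
      using ip_self[of "a * y"] by (simp add: star_mult mult.assoc)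
    also have "\<dots> \<le> cmod (ip y (star a * a * y))" by (rule complex_Re_le_cmod)
    also have "\<dots> \<le> nrm y * nrm (star a * a * y)" by (rule nrm_Cauchy_Schwarz)
    also have "\<dots> \<le> 1 * opn (star a * a)"
      by (intro mult_mono nrm_mult_le1 y nrm_nonneg) simp
    finally show "nrm (a * y) \<le> sqrt (opn (star a * a))" by (simp add: real_le_rsqrt)
  qed
  then have "(opn a)\<^sup>2 \<le> (sqrt (opn (star a * a)))\<^sup>2" using opn_nonneg by (rule power_mono)
  then show ?thesis by (simp add: opn_nonneg)
qed

text \<open>Combine \<open>opn_square_le\<close> with submultiplicativity and cancel one factor
  \<open>opn a\<close>.\<close>

lemma opn_star_le:
  assumes a: "a \<in> H"
  shows "opn a \<le> opn (star a)"
proof (cases "opn a = 0")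
  case True
  then show ?thesis by (simp add: opn_nonneg)
next
  case False
  then have pos: "opn a > 0" using opn_nonneg[of a] by simp
  have "opn a * opn a \<le> opn (star a) * opn a"
    using opn_square_le[OF a] opn_mult[OF a, of "star a"] by (simp add: power2_eq_square)
  then show ?thesis using pos by simp
qed

lemma opn_cstar:
  assumes a: "a \<in> H"
  shows "opn (star a * a) = (opn a)\<^sup>2"
proof -
  have "opn (star a) \<le> opn a" using opn_star_le[OF star_mem[OF a]] by simp
  then have "opn (star a) * opn a \<le> opn a * opn a" by (intro mult_right_mono opn_nonneg)
  then have "opn (star a * a) \<le> (opn a)\<^sup>2"
    using opn_mult[OF a, of "star a"] by (simp add: power2_eq_square)
  then show ?thesis using opn_square_le[OF a] by simp
qed

section \<open>Coordinates on \<open>H\<close> and the coproduct as a coaction\<close>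

definition from_vec :: "complex vec \<Rightarrow> 'a" where "from_vec v = (\<Sum>i<n. (v $ i) *\<^sub>C e i)"

definition to_vec :: "'a \<Rightarrow> complex vec" where "to_vec x = vec n (\<lambda>i. ip (e i) x)"

text \<open>Realises \<open>n\<close> coordinates as an element of \<open>H \<otimes> K\<close>
  inside \<open>\<complex>[\<Gamma>] \<otimes> K\<close>. This map is injective and carries the
  amplified operations to those of the tensor product, so the coaction axioms for
  \<open>coact\<close>, except the counit axiom, are checked after applying it, as Hopf algebra
  identities.\<close>

definition tensor_vec :: "'k vec \<Rightarrow> ('a, 'k::complex_vector) tensor" where
  "tensor_vec x = (\<Sum>i<n. e i \<otimes>\<^sub>C (x $ i))"

definition slice :: "nat \<Rightarrow> ('a, 'k) tensor \<Rightarrow> 'k::complex_vector" where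
  "slice i = tensor_lift (\<lambda>x y. ip (e i) x *\<^sub>C y)"

definition alg :: fd_algebra where
  "alg = \<lparr> adim = n, amult = (\<lambda>v w. to_vec (from_vec v * from_vec w)), aone = to_vec 1,
     astar = (\<lambda>v. to_vec (star (from_vec v))) \<rparr>"

definition coact :: "complex vec \<Rightarrow> 'a vec" where
  "coact v = vec n (\<lambda>i. slice i (\<Delta> (from_vec v)))"

lemma adim_alg [simp]: "adim alg = n" and aone_alg [simp]: "aone alg = to_vec 1"
  and amult_alg: "amult alg v w = to_vec (from_vec v * from_vec w)"
  and astar_alg: "astar alg v = to_vec (star (from_vec v))"
  by (simp_all add: alg_def)

lemma from_vec_mem [simp]: "from_vec v \<in> H"
  unfolding from_vec_def by (intro cvector.subspace_sum subspace cvector.subspace_scale e_mem) simp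

lemma to_vec_carrier [simp]: "to_vec x \<in> carrier_vec n" and coact_carrier [simp]: "coact v \<in> carrier_vec n"
  by (simp_all add: to_vec_def coact_def)

lemma from_vec_to_vec: "x \<in> H \<Longrightarrow> from_vec (to_vec x) = x"
  by (simp add: from_vec_def to_vec_def expand)

lemma to_vec_from_vec:
  assumes "v \<in> carrier_vec n"
  shows "to_vec (from_vec v) = v"
proof (rule eq_vecI)
  fix i assume "i < dim_vec v"
  then have i: "i < n" using assms by simp
  have "ip (e i) (from_vec v) = (\<Sum>j<n. if i = j then v $ j else 0)"
    unfolding from_vec_def clinear_sum[OF clinear_ip] ip_scale_right
    by (intro sum.cong refl) (simp add: orthonormal i)
  also have "\<dots> = v $ i" using i by simp
  finally show "to_vec (from_vec v) $ i = v $ i" by (simp add: to_vec_def i)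
qed (use assms in \<open>simp add: to_vec_def\<close>)

lemma to_vec_add: "to_vec (x + y) = to_vec x + to_vec y"
  and to_vec_scaleC: "to_vec (c *\<^sub>C x) = map_vec (scaleC c) (to_vec x)"
  by (rule eq_vecI; simp add: to_vec_def clinear_add[OF clinear_ip] scaleC_complex_def)+

lemma from_vec_add:
  "v \<in> carrier_vec n \<Longrightarrow> w \<in> carrier_vec n \<Longrightarrow> from_vec (v + w) = from_vec v + from_vec w"
  by (simp add: from_vec_def scaleC_add_left sum.distrib)

lemma from_vec_smult: "v \<in> carrier_vec n \<Longrightarrow> from_vec (c \<cdot>\<^sub>v v) = c *\<^sub>C from_vec v"
  by (simp add: from_vec_def cvector.scale_sum_right)

lemma star_algebra: "fd_star_algebra alg"
  unfolding fd_star_algebra_def vec_sesquilinear_def vec_semilinear_def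
  by (simp add: amult_alg astar_alg from_vec_add from_vec_smult distrib_left distrib_right to_vec_add to_vec_scaleC
      from_vec_to_vec to_vec_from_vec mult_mem star_mem one_mem mult.assoc star_mult)

lemma cstar_algebra: "fd_cstar_algebra alg"
proof -
  have zero: "from_vec (0\<^sub>v n) = 0" by (simp add: from_vec_def)
  have inj: "from_vec v = 0 \<longleftrightarrow> v = 0\<^sub>v n" if "v \<in> carrier_vec n" for v
    using to_vec_from_vec[OF that] to_vec_from_vec[of "0\<^sub>v n"] zero by auto
  have "cstar_norm alg (\<lambda>v. opn (from_vec v))"
    unfolding cstar_norm_def
    by (simp add: amult_alg astar_alg opn_nonneg opn_eq_0 inj from_vec_add opn_triangle from_vec_smult opn_scaleC
        from_vec_to_vec mult_mem star_mem opn_mult opn_cstar)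
  then show ?thesis using star_algebra by (auto simp: fd_cstar_algebra_def)
qed

lemma bilinear_slice: "cbilinear (\<lambda>x y. ip (e i) x *\<^sub>C y)"
  by (rule cbilinear_scaleC[OF clinear_ip clinear_id])

lemma clinear_slice: "clinear (slice i)"
  unfolding slice_def by (rule clinear_tensor_lift[OF bilinear_slice])

lemma slice_tprod: "slice i (x \<otimes>\<^sub>C y) = ip (e i) x *\<^sub>C y"
  unfolding slice_def by (rule tensor_lift_tprod[OF bilinear_slice])

lemma tensor_vec_slices:
  assumes "t \<in> cvector.span {y \<otimes>\<^sub>C z | y z. y \<in> H}"
  shows "tensor_vec (vec n (\<lambda>i. slice i t)) = t"
proof -
  have "(\<Sum>i<n. e i \<otimes>\<^sub>C slice i t) = t"
    using assms
  proof (induction rule: cvector.span_induct_alt)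
    case base
    then show ?case by (simp add: clinear_0[OF clinear_slice] clinear_0[OF clinear_tprod_right])
  next
    case (step c s t)
    then obtain y z where s: "s = y \<otimes>\<^sub>C z" and y: "y \<in> H" by blast
    have "(\<Sum>i<n. e i \<otimes>\<^sub>C slice i s) = (\<Sum>i<n. ip (e i) y *\<^sub>C e i) \<otimes>\<^sub>C z"
      by (simp only: s slice_tprod tprod_scaleC_right tprod_scaleC_left clinear_sum[OF clinear_tprod_left])
    then have "(\<Sum>i<n. e i \<otimes>\<^sub>C slice i s) = s" by (simp only: expand[OF y] s)
    then show ?case
      using step by (simp add: clinear_add[OF clinear_slice] clinear_scaleC[OF clinear_slice] tprod_add_right
          sum.distrib cvector.scale_sum_right[symmetric])
  qed
  then show ?thesis by (simp add: tensor_vec_def)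
qed

lemma tensor_vec_coact: "tensor_vec (coact v) = \<Delta> (from_vec v)"
  unfolding coact_def by (rule tensor_vec_slices[OF comult_mem]) simp

lemma tensor_vec_inj:
  fixes x y :: "'k::complex_vector vec"
  assumes x: "x \<in> carrier_vec n" and y: "y \<in> carrier_vec n" and eq: "tensor_vec x = tensor_vec y"
  shows "x = y"
proof -
  have "slice i (tensor_vec x) = x $ i" if "i < n" for x :: "'k vec" and i
  proof -
    have "slice i (tensor_vec x) = (\<Sum>j<n. ip (e i) (e j) *\<^sub>C (x $ j))"
      by (simp add: tensor_vec_def clinear_sum[OF clinear_slice] slice_tprod)
    also have "\<dots> = (\<Sum>j<n. if i = j then x $ j else 0)"
      by (intro sum.cong refl) (simp add: orthonormal that)
    also have "\<dots> = x $ i" using that by simp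
    finally show ?thesis .
  qed
  then have "x $ i = y $ i" if "i < n" for i using eq that by metis
  then show ?thesis using x y by (intro eq_vecI) auto
qed

lemma tensor_vec_add:
  "x \<in> carrier_vec n \<Longrightarrow> y \<in> carrier_vec n \<Longrightarrow> tensor_vec (x + y) = tensor_vec x + tensor_vec y"
  by (simp add: tensor_vec_def tprod_add_right sum.distrib)

lemma tensor_vec_tprod: "v \<in> carrier_vec n \<Longrightarrow> tensor_vec (vec_tprod v h) = from_vec v \<otimes>\<^sub>C h"
  by (simp add: tensor_vec_def from_vec_def clinear_sum[OF clinear_tprod_left])

lemma tensor_vec_map: "x \<in> carrier_vec n \<Longrightarrow> clinear f \<Longrightarrow> tensor_vec (map_vec f x) = tensor_map id f (tensor_vec x)"
  by (simp add: tensor_vec_def clinear_sum[OF clinear_tensor_map[OF clinear_id']])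

interpretation A: fd_star_alg alg
  by unfold_locales (rule star_algebra)

lemma tensor_vec_mult:
  assumes "x \<in> carrier_vec n" "y \<in> carrier_vec n"
  shows "tensor_vec (amplify2 n (amult alg) x y) = tensor_vec x * tensor_vec y"
  using assms(1)
proof (induction x rule: vec_tensor_induct)
  case (add x x')
  then show ?case by (simp add: amplify2_add_left[of _ n] tensor_vec_add distrib_right)
next
  case (tprod v g)
  show ?case using assms(2)
  proof (induction y rule: vec_tensor_induct)
    case (add y y')
    then show ?case by (simp add: amplify2_add_right[of _ n] tensor_vec_add distrib_left)
  next
    case (tprod w h)
    have "amplify2 n (amult alg) (vec_tprod v g) (vec_tprod w h) = vec_tprod (to_vec (from_vec v * from_vec w)) (g * h)"
      using A.mult_tprod[of v w g h] \<open>v \<in> _\<close> tprod by (simp add: amult_alg)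
    then show ?case using \<open>v \<in> _\<close> tprod
      by (simp only: tensor_vec_tprod to_vec_carrier from_vec_to_vec mult_mem from_vec_mem tprod_mult)
  qed
qed

lemma tensor_vec_star:
  assumes "x \<in> carrier_vec n"
  shows "tensor_vec (amplify n (astar alg) (map_vec star x)) = star (tensor_vec x)"
  using assms
proof (induction x rule: vec_tensor_induct)
  case (add x y)
  then show ?case
    by (simp add: map_vec_add[OF semilinear_star, of _ n] amplify_add[of _ n] tensor_vec_add)
next
  case (tprod v h)
  have "amplify n (astar alg) (map_vec star (vec_tprod v h)) = vec_tprod (to_vec (star (from_vec v))) (star h)"
    using A.star_amp_tprod[of v h] tprod by (simp add: astar_alg)
  then show ?case using tprod
    by (simp only: tensor_vec_tprod to_vec_carrier from_vec_to_vec star_mem from_vec_mem star_tprod)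
qed

lemma coact_linear: "vec_linear n n coact"
proof -
  have lin: "clinear (\<lambda>x. slice i (\<Delta> x))" for i
    by (rule clinear_comp[OF clinear_slice star_homD(1)[OF star_hom_comult]])
  have "coact (v + w) = coact v + coact w" if "v \<in> carrier_vec n" "w \<in> carrier_vec n" for v w
    by (rule eq_vecI) (simp_all add: coact_def from_vec_add that clinear_add[OF lin])
  moreover have "coact (c \<cdot>\<^sub>v v) = map_vec (scaleC c) (coact v)" if "v \<in> carrier_vec n" for c v
    by (rule eq_vecI) (simp_all add: coact_def from_vec_smult that clinear_scaleC[OF lin])
  ultimately show ?thesis by (simp add: vec_semilinear_def)
qed

text \<open>Each coordinate of \<open>amplify_corep\<close> holds the last two legs together,
  whereas the coproduct on the left leg groups the first two; the reassociation reconciles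
  them.\<close>

lemma tensor_vec_amplify_corep:
  assumes "y \<in> carrier_vec n"
  shows "tensor_vec (amplify_corep n coact y) = tensor_assoc (tensor_map \<Delta> id (tensor_vec y))"
proof -
  note D = star_homD(1)[OF star_hom_comult]
  have map: "tensor_map id (\<lambda>g. g \<otimes>\<^sub>C h) t = tensor_assoc (t \<otimes>\<^sub>C h)" for t :: "('a, 'a) tensor" and h :: 'a
  proof (rule tensor_ext[of "tensor_map id (\<lambda>g. g \<otimes>\<^sub>C h)" "\<lambda>t. tensor_assoc (t \<otimes>\<^sub>C h)"])
    show "clinear (tensor_map id (\<lambda>g::'a. g \<otimes>\<^sub>C h))"
      by (rule clinear_tensor_map[OF clinear_id' clinear_tprod_left])
  qed (simp_all add: clinear_comp[OF clinear_tensor_assoc clinear_tprod_left]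
      tensor_map_tprod[OF clinear_id' clinear_tprod_left] tensor_assoc_tprod)
  show ?thesis using assms
  proof (induction y rule: vec_tensor_induct)
    case (add x y)
    then show ?case
      by (simp only: amplify_corep_add[of _ n] tensor_vec_add amplify_corep_carrier clinear_add[OF clinear_tensor_assoc]
          clinear_add[OF clinear_tensor_map[OF D clinear_id']])
  next
    case (tprod v h)
    then show ?case
      by (simp add: amplify_corep_tprod[OF coact_linear] tensor_vec_map tensor_vec_coact map tensor_vec_tprod
          tensor_map_tprod[OF D clinear_id])
  qed
qed

lemma coact_coaction: "coaction \<Gamma> alg coact"
proof -
  note D = star_homD[OF star_hom_comult]
  have counit: "map_vec \<epsilon> (coact x) = x" if x: "x \<in> carrier_vec n" for x
  proof -
    have "from_vec (map_vec \<epsilon> y) = tensor_lift (\<lambda>a b. \<epsilon> b *\<^sub>C a) (tensor_vec y)" if "y \<in> carrier_vec n" for y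
      using that by (simp add: from_vec_def tensor_vec_def
          clinear_sum[OF clinear_tensor_lift[OF bilinear_counit_right]])
    then have "from_vec (map_vec \<epsilon> (coact x)) = from_vec x"
      by (simp add: tensor_vec_coact counit_right)
    then have "to_vec (from_vec (map_vec \<epsilon> (coact x))) = to_vec (from_vec x)" by simp
    then show ?thesis using x by (simp add: to_vec_from_vec)
  qed
  have comult: "map_vec \<Delta> (coact x) = amplify_corep n coact (coact x)" for x
    by (rule tensor_vec_inj)
      (simp_all add: tensor_vec_map tensor_vec_amplify_corep tensor_vec_coact D(1) coassoc)
  have one: "coact (aone alg) = vec_tprod (aone alg) 1"
    by (rule tensor_vec_inj)
      (simp_all add: tensor_vec_coact tensor_vec_tprod from_vec_to_vec one_mem D(2) one_tensor_def)
  have mult: "coact (amult alg x y) = amplify2 n (amult alg) (coact x) (coact y)" for x y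
    by (rule tensor_vec_inj, simp_all only: tensor_vec_mult coact_carrier amplify2_carrier)
      (simp add: amult_alg tensor_vec_coact from_vec_to_vec mult_mem D(3))
  have star: "coact (astar alg x) = amplify n (astar alg) (map_vec star (coact x))" for x
    by (rule tensor_vec_inj, simp_all only: tensor_vec_star coact_carrier amplify_carrier)
      (simp add: astar_alg tensor_vec_coact from_vec_to_vec star_mem D(4))
  show ?thesis
    unfolding coaction_def corepresentation_def
    using cstar_algebra coact_linear comult counit one mult star by simp
qed

text \<open>Torsion-freeness makes the coproduct, viewed as a coaction on \<open>H\<close>,
  conjugation by a unitary, and such a coaction fixes central elements.\<close>

lemma comult_central:
  assumes tf: "torsion_free \<Gamma>" and p: "p \<in> H" and central: "\<And>x. x \<in> H \<Longrightarrow> p * x = x * p"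
  shows "\<Delta> p = p \<otimes>\<^sub>C 1"
proof -
  obtain U where U: "implements \<Gamma> alg coact U"
    using torsion_free_implements[OF dqg_axioms tf coact_coaction] by blast
  have "coact (to_vec p) = vec_tprod (to_vec p) 1"
    by (rule A.implements_central_fixed[OF U]) (simp_all add: amult_alg from_vec_to_vec p central)
  then have "tensor_vec (coact (to_vec p)) = tensor_vec (vec_tprod (to_vec p) 1)" by simp
  then show ?thesis by (simp add: tensor_vec_coact tensor_vec_tprod from_vec_to_vec p)
qed

end

subsection \<open>Bicharacters\<close>

lemma ex_dual_functional:
  fixes F :: "'a::complex_vector set"
  assumes "cvector.independent F"
  obtains \<omega> :: "'a \<Rightarrow> complex" where "clinear \<omega>" "\<And>x. x \<in> F \<Longrightarrow> \<omega> x = (if x = b then 1 else 0)"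
proof -
  obtain g :: "'a \<Rightarrow> complex" where "Vector_Spaces.linear scaleC scaleC g"
    "\<forall>x\<in>F. g x = (if x = b then 1 else 0)"
    using cvector_pair.linear_independent_extend[OF assms, of "\<lambda>x. if x = b then 1 else 0"] by blast
  then show thesis using that[of g] by (simp add: clinear_iff)
qed

text \<open>Writing the difference with independent left legs, a functional dual to one of them
  isolates the corresponding right leg.\<close>

lemma tensor_separated:
  fixes s t :: "('a::complex_vector, 'b::complex_vector) tensor"
  assumes "\<And>\<omega>. clinear \<omega> \<Longrightarrow> tensor_lift (\<lambda>a b. (\<omega> a :: complex) *\<^sub>C b) s = tensor_lift (\<lambda>a b. \<omega> a *\<^sub>C b) t"
  shows "s = t"
proof -
  obtain F d where F: "finite F" "cvector.independent F" and eq: "s - t = (\<Sum>b\<in>F. b \<otimes>\<^sub>C d b)"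
    using tensor_eq_sum_basis by blast
  have "d b = 0" if b: "b \<in> F" for b
  proof -
    obtain \<omega> :: "'a \<Rightarrow> complex" where \<omega>: "clinear \<omega>" "\<And>x. x \<in> F \<Longrightarrow> \<omega> x = (if x = b then 1 else 0)"
      using ex_dual_functional[OF F(2)] by blast
    have bil: "cbilinear (\<lambda>a (b::'b). \<omega> a *\<^sub>C b)" by (rule cbilinear_scaleC[OF \<omega>(1) clinear_id])
    note lin = clinear_tensor_lift[OF bil]
    have "0 = tensor_lift (\<lambda>a b. \<omega> a *\<^sub>C b) (s - t)"
      using assms[OF \<omega>(1)] by (simp add: clinear_diff[OF lin])
    also have "\<dots> = (\<Sum>x\<in>F. \<omega> x *\<^sub>C d x)"
      by (simp add: eq clinear_sum[OF lin] bil)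
    also have "\<dots> = (\<Sum>x\<in>F. if x = b then d x else 0)"
      by (intro sum.cong refl) (simp add: \<omega>(2))
    also have "\<dots> = d b" using F b by simp
    finally show ?thesis by simp
  qed
  then have "s - t = 0" by (simp add: eq clinear_0[OF clinear_tprod_right])
  then show ?thesis by simp
qed

context dqg_pair
begin

text \<open>Both maps are Hopf star-homomorphisms onto the factors. Coactions of the product
  restrict along them, and for a bicharacter they express triviality when the other variable is
  trivial.\<close>

definition proj1 :: "('a, 'b) tensor \<Rightarrow> 'a" where "proj1 = tensor_lift (\<lambda>a b. G2.\<epsilon> b *\<^sub>C a)"
definition proj2 :: "('a, 'b) tensor \<Rightarrow> 'b" where "proj2 = tensor_lift (\<lambda>a b. G1.\<epsilon> a *\<^sub>C b)"

end

text \<open>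
  The left slices \<open>(\<omega> \<otimes> id)(\<zeta>)\<close> of a unitary bicharacter form a finite-dimensional Hopf
  \<open>*\<close>-subalgebra of \<open>\<complex>[\<Gamma>\<^sub>2]\<close>.
\<close>

locale bicharacter = dqg_pair \<Gamma>\<^sub>1 \<Gamma>\<^sub>2
  for \<Gamma>\<^sub>1 :: "'a::complex_star_algebra quantum_group"
    and \<Gamma>\<^sub>2 :: "'b::complex_star_algebra quantum_group" +
  fixes \<zeta> :: "('a, 'b) tensor"
  assumes comult_left: "tensor_map G1.\<Delta> (\<lambda>b. b) \<zeta> =
      tensor_map (\<lambda>a. a \<otimes>\<^sub>C 1) (\<lambda>b. b) \<zeta> * tensor_map (\<lambda>a. 1 \<otimes>\<^sub>C a) (\<lambda>b. b) \<zeta>"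
    and comult_right: "tensor_map (\<lambda>a. a) G2.\<Delta> \<zeta> =
      tensor_map (\<lambda>a. a) (\<lambda>b. 1 \<otimes>\<^sub>C b) \<zeta> * tensor_map (\<lambda>a. a) (\<lambda>b. b \<otimes>\<^sub>C 1) \<zeta>"
    and isometric: "star \<zeta> * \<zeta> = 1"
    and proj: "proj1 \<zeta> = 1" "proj2 \<zeta> = 1"
begin

definition slice :: "('a \<Rightarrow> complex) \<Rightarrow> ('a, 'k) tensor \<Rightarrow> 'k::complex_vector" where
  "slice \<omega> = tensor_lift (\<lambda>a b. \<omega> a *\<^sub>C b)"

definition slices :: "'b set" where "slices = {slice \<omega> \<zeta> | \<omega>. clinear \<omega>}"

definition conv :: "('a \<Rightarrow> complex) \<Rightarrow> ('a \<Rightarrow> complex) \<Rightarrow> 'a \<Rightarrow> complex" where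
  "conv \<omega> \<omega>' x = tensor_lift (\<lambda>a a'. \<omega> a * \<omega>' a') (G1.\<Delta> x)"

lemma slice_tprod: "clinear \<omega> \<Longrightarrow> slice \<omega> (a \<otimes>\<^sub>C b) = \<omega> a *\<^sub>C b"
  unfolding slice_def by (rule tensor_lift_tprod[OF cbilinear_scaleC[OF _ clinear_id]])

lemma clinear_slice: "clinear \<omega> \<Longrightarrow> clinear (slice \<omega>)"
  unfolding slice_def by (rule clinear_tensor_lift[OF cbilinear_scaleC[OF _ clinear_id]])

lemma slicesI: "clinear \<omega> \<Longrightarrow> slice \<omega> \<zeta> \<in> slices"
  by (auto simp: slices_def)

lemma slicesE:
  assumes "x \<in> slices"
  obtains \<omega> where "clinear \<omega>" "x = slice \<omega> \<zeta>"
  using assms by (auto simp: slices_def)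

lemma clinear_conv:
  assumes "clinear \<omega>" "clinear \<omega>'"
  shows "clinear (conv \<omega> \<omega>')"
  unfolding conv_def by (rule clinear_comp[OF clinear_tensor_lift[OF cbilinear_mult[OF assms]] comult_lin(1)])

text \<open>Apply \<open>\<omega> \<otimes> \<omega>' \<otimes> id\<close> to
  \<open>comult_left\<close>: one side becomes the product of slices, the other the slice at the
  convolution \<open>conv\<close>.\<close>

lemma slice_mult:
  assumes \<omega>: "clinear \<omega>" and \<omega>': "clinear \<omega>'"
  shows "slice \<omega> \<zeta> * slice \<omega>' \<zeta> = slice (conv \<omega> \<omega>') \<zeta>"
proof -
  note [simp] = comult_lin
  let ?P = "tensor_lift (\<lambda>a a'. \<omega> a * \<omega>' a')"
  have P: "clinear ?P" "\<And>a b. ?P (a \<otimes>\<^sub>C b) = \<omega> a * \<omega>' b"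
    using cbilinear_mult[OF \<omega> \<omega>'] by simp_all
  let ?S = "tensor_lift (\<lambda>s (y::'b). ?P s *\<^sub>C y)"
  have bil: "cbilinear (\<lambda>s (y::'b). ?P s *\<^sub>C y)" by (rule cbilinear_scaleC[OF P(1) clinear_id])
  note S = clinear_tensor_lift[OF bil]
  have "?S (tensor_map G1.\<Delta> (\<lambda>b. b) t) = slice (conv \<omega> \<omega>') t" for t
    by (rule tensor_ext[where t = t])
      (simp_all add: clinear_comp[OF S clinear_tensor_map] clinear_slice clinear_conv \<omega> \<omega>' bil
        slice_tprod conv_def[symmetric])
  moreover have "?S (tensor_map (\<lambda>a. a \<otimes>\<^sub>C 1) (\<lambda>b. b) s * tensor_map (\<lambda>a. 1 \<otimes>\<^sub>C a) (\<lambda>b. b) t) =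
      slice \<omega> s * slice \<omega>' t" for s t
  proof (rule tensor_ext_bilinear[where s = s and t = t])
    show "cbilinear (\<lambda>s t. ?S (tensor_map (\<lambda>a. a \<otimes>\<^sub>C 1) (\<lambda>b. b) s * tensor_map (\<lambda>a. 1 \<otimes>\<^sub>C a) (\<lambda>b. b) t))"
      by (intro clinear_cbilinear[OF S] cbilinear_mult clinear_tensor_map) simp_all
    show "cbilinear (\<lambda>s t. slice \<omega> s * slice \<omega>' t :: 'b)" by (intro cbilinear_mult clinear_slice \<omega> \<omega>')
  qed (simp add: bil P(2) slice_tprod \<omega> \<omega>')
  ultimately show ?thesis using comult_left by metis
qed

text \<open>Multiplying the first two legs of \<open>comult_left\<close>, with the antipode on the
  second, collapses the coproduct to the counit and shows that
  \<open>tensor_map G1.\<S> (\<lambda>b. b) \<zeta>\<close> is a right inverse of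
  \<open>\<zeta>\<close>. As \<open>star \<zeta>\<close> is a left inverse, the two agree.\<close>

lemma star_eq_antipode: "star \<zeta> = tensor_map G1.\<S> (\<lambda>b. b) \<zeta>"
proof -
  note [simp] = comult_lin
  let ?P = "tensor_lift (\<lambda>a a'. a * G1.\<S> a')"
  have P: "clinear ?P" "\<And>a b. ?P (a \<otimes>\<^sub>C b) = a * G1.\<S> b"
    by simp_all
  let ?M = "tensor_lift (\<lambda>s (y::'b). ?P s \<otimes>\<^sub>C y)"
  have bil: "cbilinear (\<lambda>s (y::'b). ?P s \<otimes>\<^sub>C y)" by (rule cbilinear_tprod[OF P(1) clinear_id])
  note M = clinear_tensor_lift[OF bil]
  have "?M (tensor_map G1.\<Delta> (\<lambda>b. b) t) = 1 \<otimes>\<^sub>C proj2 t" for t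
    by (rule tensor_ext[where t = t])
      (simp_all add: clinear_comp[OF M clinear_tensor_map] bil G1.antipode_right
        clinear_comp[OF clinear_tprod_right clinear_tensor_lift] proj2_def)
  moreover have "?M (tensor_map (\<lambda>a. a \<otimes>\<^sub>C 1) (\<lambda>b. b) s * tensor_map (\<lambda>a. 1 \<otimes>\<^sub>C a) (\<lambda>b. b) t) =
      s * tensor_map G1.\<S> (\<lambda>b. b) t" for s t
  proof (rule tensor_ext_bilinear[where s = s and t = t])
    show "cbilinear (\<lambda>s t. ?M (tensor_map (\<lambda>a. a \<otimes>\<^sub>C 1) (\<lambda>b. b) s * tensor_map (\<lambda>a. 1 \<otimes>\<^sub>C a) (\<lambda>b. b) t))"
      by (intro clinear_cbilinear[OF M] cbilinear_mult clinear_tensor_map) simp_all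
    show "cbilinear (\<lambda>(s::('a, 'b) tensor) t. s * tensor_map G1.\<S> (\<lambda>b. b) t)"
      by (intro cbilinear_mult clinear_tensor_map G1.clinear_antipode) simp_all
  qed (simp add: bil P)
  ultimately have inv: "\<zeta> * tensor_map G1.\<S> (\<lambda>b. b) \<zeta> = 1"
    using comult_left proj by (metis one_tensor_def)
  have "star \<zeta> = star \<zeta> * (\<zeta> * tensor_map G1.\<S> (\<lambda>b. b) \<zeta>)" by (simp add: inv)
  also have "\<dots> = tensor_map G1.\<S> (\<lambda>b. b) \<zeta>" by (simp only: mult.assoc[symmetric] isometric mult_1_left)
  finally show ?thesis .
qed

lemma slice_functional:
  assumes \<omega>: "clinear \<omega>" and \<omega>': "clinear \<omega>'"
  shows "slice (\<lambda>a. \<omega> a + \<omega>' a) t = slice \<omega> t + slice \<omega>' t" "slice (\<lambda>a. c * \<omega> a) t = c *\<^sub>C slice \<omega> t"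
proof -
  have p: "clinear (\<lambda>a. \<omega> a + \<omega>' a)" "clinear (\<lambda>a. c * \<omega> a)"
    using assms by (simp_all add: semilinear_def scaleC_complex_def algebra_simps)
  note lin = clinear_add[OF clinear_slice[OF \<omega>]] clinear_add[OF clinear_slice[OF \<omega>']]
  show "slice (\<lambda>a. \<omega> a + \<omega>' a) t = slice \<omega> t + slice \<omega>' t"
    by (induction t rule: tensor_induct)
      (simp_all add: clinear_add[OF clinear_slice[OF p(1)]] lin slice_tprod[OF p(1)] slice_tprod assms scaleC_add_left)
  show "slice (\<lambda>a. c * \<omega> a) t = c *\<^sub>C slice \<omega> t"
  proof (induction t rule: tensor_induct)
    case (tprod a b)
    show ?case unfolding slice_tprod[OF p(2)] slice_tprod[OF \<omega>] by simp
  qed (simp add: clinear_add[OF clinear_slice[OF p(2)]] lin scaleC_add_right)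
qed

lemma subspace_slices: "cvector.subspace slices"
proof (rule cvector.subspaceI)
  show "0 \<in> slices"
    using slicesI[OF clinear_comp[OF clinear_mult_left G1.clinear_counit], of 0]
      slice_functional(2)[OF G1.clinear_counit G1.clinear_counit, of 0 \<zeta>] by simp
next
  fix x y assume "x \<in> slices" "y \<in> slices"
  then obtain \<omega> \<omega>' where \<omega>: "clinear \<omega>" "clinear \<omega>'" and xy: "x = slice \<omega> \<zeta>" "y = slice \<omega>' \<zeta>"
    by (metis slicesE)
  then have "clinear (\<lambda>a. \<omega> a + \<omega>' a)" by (simp add: semilinear_def scaleC_add_right algebra_simps)
  from slicesI[OF this] show "x + y \<in> slices" by (simp add: xy slice_functional(1)[OF \<omega>])
next
  fix c x assume "x \<in> slices"
  then obtain \<omega> where \<omega>: "clinear \<omega>" and x: "x = slice \<omega> \<zeta>" by (rule slicesE)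
  from slicesI[OF clinear_comp[OF clinear_mult_left \<omega>]] show "c *\<^sub>C x \<in> slices"
    by (metis x slice_functional(2)[OF \<omega> \<omega>])
qed

text \<open>By \<open>comult_right\<close> the coproduct of the right leg is
  \<open>\<zeta>\<^sub>1\<^sub>3 \<zeta>\<^sub>1\<^sub>2\<close>. A term
  \<open>a \<otimes> c\<close> of the left factor turns the functional into
  \<open>\<omega> (a * x)\<close> and places \<open>c\<close> in the last leg, so the first
  remaining leg is again a slice.\<close>

lemma comult_slice:
  assumes \<omega>: "clinear \<omega>"
  shows "G2.\<Delta> (slice \<omega> \<zeta>) \<in> cvector.span {y \<otimes>\<^sub>C z | y z. y \<in> slices}"
proof -
  note [simp] = comult_lin
  let ?sl = "slice \<omega> :: ('a, ('b, 'b) tensor) tensor \<Rightarrow> _"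
  note lin = clinear_slice[OF \<omega>]
  let ?f = "tensor_map (\<lambda>a::'a. a) (\<lambda>b::'b. (1::'b) \<otimes>\<^sub>C b)" and ?g = "tensor_map (\<lambda>a::'a. a) (\<lambda>b::'b. b \<otimes>\<^sub>C (1::'b))"
  have "G2.\<Delta> (slice \<omega> t) = ?sl (tensor_map (\<lambda>a. a) G2.\<Delta> t)" for t
    by (rule tensor_ext[where t = t])
      (simp_all add: clinear_comp[OF comult_lin(2) lin] clinear_comp[OF lin clinear_tensor_map] slice_tprod \<omega>
        clinear_scaleC[OF comult_lin(2)])
  then have "G2.\<Delta> (slice \<omega> \<zeta>) = ?sl (?f \<zeta> * ?g \<zeta>)" by (simp add: comult_right)
  moreover have "?sl (?f t * ?g \<zeta>) \<in> cvector.span {y \<otimes>\<^sub>C z | y z. y \<in> slices}" for t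
  proof (induction t rule: tensor_induct)
    case (add s t)
    then show ?case
      by (simp add: clinear_add[OF clinear_tensor_map] distrib_right clinear_add[OF lin] cvector.span_add)
  next
    case (tprod a c)
    have \<omega>a: "clinear (\<lambda>x. \<omega> (a * x))" by (rule clinear_comp[OF \<omega> clinear_mult_left])
    have "?sl (?f (a \<otimes>\<^sub>C c) * ?g s) = slice (\<lambda>x. \<omega> (a * x)) s \<otimes>\<^sub>C c" for s
      by (rule tensor_ext[where t = s])
        (simp_all add: clinear_comp[OF lin clinear_comp[OF clinear_mult_left clinear_tensor_map]]
          clinear_comp[OF clinear_tprod_left clinear_slice[OF \<omega>a]] slice_tprod[OF \<omega>a]
          slice_tprod[OF \<omega>])
    then show ?case using slicesI[OF \<omega>a] by (auto intro!: cvector.span_base)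
  qed
  ultimately show ?thesis by simp
qed

text \<open>The involution turns the slice of \<open>\<zeta>\<close> at \<open>\<omega>\<close> into
  the slice of \<open>star \<zeta>\<close> at the conjugate functional \<open>\<omega>'\<close>;
  \<open>star_eq_antipode\<close> then moves the antipode from \<open>\<zeta>\<close> into the
  functional.\<close>

lemma star_slice:
  assumes \<omega>: "clinear \<omega>"
  shows "star (slice \<omega> \<zeta>) \<in> slices"
proof -
  define \<omega>' where "\<omega>' a = cnj (\<omega> (star a))" for a
  have \<omega>': "clinear \<omega>'"
    using \<omega> by (simp add: \<omega>'_def semilinear_def scaleC_complex_def)
  have "star (slice \<omega> t :: 'b) = slice \<omega>' (star t)" for t
    by (induction t rule: tensor_induct)
      (simp_all add: clinear_add[OF clinear_slice] \<omega> \<omega>' slice_tprod, simp add: \<omega>'_def)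
  moreover have "slice \<omega>' (tensor_map G1.\<S> (\<lambda>b. b) t) = slice (\<lambda>a. \<omega>' (G1.\<S> a)) t" for t :: "('a, 'b) tensor"
    by (rule tensor_ext[where t = t])
      (simp_all add: clinear_comp[OF clinear_slice clinear_tensor_map] \<omega>' clinear_slice slice_tprod
        clinear_comp[OF \<omega>' G1.clinear_antipode])
  ultimately show ?thesis
    using slicesI[OF clinear_comp[OF \<omega>' G1.clinear_antipode]] by (simp add: star_eq_antipode)
qed

text \<open>As a finite sum, \<open>\<zeta>\<close> has finitely many right legs, and these span
  every slice. A maximal independent set of slices is therefore finite and spans exactly the
  subspace of slices.\<close>

lemma slices_orthonormal_basis: "\<exists>n e. G2.orthonormal_basis n e slices"
proof -
  obtain F d where F: "finite F" and eq: "\<zeta> = (\<Sum>b\<in>F. b \<otimes>\<^sub>C d b)"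
    using tensor_eq_sum_basis by blast
  have "slice \<omega> \<zeta> \<in> cvector.span (d ` F)" if "clinear \<omega>" for \<omega>
    unfolding eq clinear_sum[OF clinear_slice[OF that]] slice_tprod[OF that]
    by (intro cvector.span_sum cvector.span_scale cvector.span_base) auto
  then have fin: "slices \<subseteq> cvector.span (d ` F)" by (auto simp: slices_def)
  obtain B where B: "B \<subseteq> slices" "cvector.independent B" "slices \<subseteq> cvector.span B"
    using cvector.maximal_independent_subset by blast
  have "finite B"
    using cvector.independent_span_bound[OF finite_imageI[OF F] B(2)] B(1) fin by blast
  moreover have "cvector.span B = slices"
    using B subspace_slices cvector.span_minimal by blast
  ultimately show ?thesis using G2.ex_orthonormal_basis by metis
qed

text \<open>Invariance says that the Haar state is a two-sided integral for convolution:
  \<open>conv G1.\<phi> \<omega>\<close> and \<open>conv \<omega> G1.\<phi>\<close> are both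
  \<omega>(1) times the state. Slicing transports this to products, so the slice at the Haar state
  commutes with all slices.\<close>

lemma haar_slice_absorbs:
  assumes \<omega>: "clinear \<omega>"
  shows "slice G1.\<phi> \<zeta> * slice \<omega> \<zeta> = \<omega> 1 *\<^sub>C slice G1.\<phi> \<zeta>" "slice \<omega> \<zeta> * slice G1.\<phi> \<zeta> = \<omega> 1 *\<^sub>C slice G1.\<phi> \<zeta>"
proof -
  note \<phi> = G1.clinear_haar
  have "tensor_lift (\<lambda>a a'. G1.\<phi> a * \<omega> a') t = \<omega> (tensor_lift (\<lambda>a b. G1.\<phi> a *\<^sub>C b) t)" for t
    by (rule tensor_ext[where t = t])
      (simp_all add: cbilinear_mult \<phi> \<omega> clinear_comp[OF \<omega> clinear_tensor_lift]
        clinear_scaleC[OF \<omega>] scaleC_complex_def)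
  then have "conv G1.\<phi> \<omega> = (\<lambda>x. \<omega> 1 * G1.\<phi> x)"
    by (simp add: fun_eq_iff conv_def G1.haar_left clinear_scaleC[OF \<omega>] scaleC_complex_def)
  then show "slice G1.\<phi> \<zeta> * slice \<omega> \<zeta> = \<omega> 1 *\<^sub>C slice G1.\<phi> \<zeta>"
    by (simp only: slice_mult[OF \<phi> \<omega>] slice_functional(2)[OF \<phi> \<phi>])
  have "tensor_lift (\<lambda>a a'. \<omega> a * G1.\<phi> a') t = \<omega> (tensor_lift (\<lambda>a b. G1.\<phi> b *\<^sub>C a) t)" for t
    by (rule tensor_ext[where t = t])
      (simp_all add: cbilinear_mult \<phi> \<omega> clinear_comp[OF \<omega> clinear_tensor_lift]
        clinear_scaleC[OF \<omega>] scaleC_complex_def mult.commute)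
  then have "conv \<omega> G1.\<phi> = (\<lambda>x. \<omega> 1 * G1.\<phi> x)"
    by (simp add: fun_eq_iff conv_def G1.haar_right clinear_scaleC[OF \<omega>] scaleC_complex_def)
  then show "slice \<omega> \<zeta> * slice G1.\<phi> \<zeta> = \<omega> 1 *\<^sub>C slice G1.\<phi> \<zeta>"
    by (simp only: slice_mult[OF \<omega> \<phi>] slice_functional(2)[OF \<phi> \<phi>])
qed

lemma bicharacter_trivial:
  assumes tf: "torsion_free \<Gamma>\<^sub>2"
  shows "\<zeta> = 1"
proof -
  obtain n e where "G2.orthonormal_basis n e slices" using slices_orthonormal_basis by blast
  then interpret H: fd_subalgebra \<Gamma>\<^sub>2 slices n e
  proof (unfold_locales, goal_cases)
    case 3
    show ?case using slicesI[OF G1.clinear_counit] proj(2) by (simp add: slice_def proj2_def)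
  next
    case (4 x y)
    then show ?case by (auto simp: slices_def slice_mult intro: clinear_conv)
  next
    case (5 x)
    then show ?case by (auto elim!: slicesE intro: star_slice)
  next
    case (6 x)
    from \<open>x \<in> slices\<close> obtain \<omega> where "clinear \<omega>" "x = slice \<omega> \<zeta>" by (rule slicesE)
    then show ?case by (simp only: comult_slice)
  qed (use subspace_slices in auto)
  define p where "p = slice G1.\<phi> \<zeta>"
  have p: "p \<in> slices" unfolding p_def by (rule slicesI[OF G1.clinear_haar])
  have "G2.\<Delta> p = p \<otimes>\<^sub>C 1"
    by (rule H.comult_central[OF tf p]) (auto simp: slices_def p_def haar_slice_absorbs)
  \<comment> \<open>Apply the counit to the left leg of the identity for the coproduct of
    \<open>p\<close>.\<close>
  then have "p = G2.\<epsilon> p *\<^sub>C 1"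
    using G2.counit_left[of p] by simp
  \<comment> \<open>State and counit act on different legs, hence commute. The normalisation of
    \<open>proj1 \<zeta>\<close> thus fixes the scalar as the Haar value of 1.\<close>
  moreover have "G2.\<epsilon> (slice G1.\<phi> t) = G1.\<phi> (proj1 t)" for t
    by (rule tensor_ext[where t = t])
      (simp_all add: clinear_comp[OF G2.clinear_counit clinear_slice] proj1_def
        clinear_comp[OF G1.clinear_haar clinear_tensor_lift] slice_tprod clinear_scaleC[OF G2.clinear_counit]
        scaleC_complex_def mult.commute)
  ultimately have "p = 1" by (simp add: p_def proj G1.haar_one)
  \<comment> \<open>With \<open>p = 1\<close> the absorption identity evaluates every slice.\<close>
  then have "slice \<omega> \<zeta> = slice \<omega> 1" if "clinear \<omega>" for \<omega>
    using haar_slice_absorbs(1)[OF that] that by (simp add: p_def[symmetric] one_tensor_def slice_tprod)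
  then show ?thesis unfolding slice_def by (rule tensor_separated)
qed

end

subsection \<open>Unitaries and commutators\<close>

context fd_star_alg
begin

definition unitary :: "'h::complex_star_algebra vec \<Rightarrow> bool" where
  "unitary X \<longleftrightarrow> X \<in> carrier_vec (adim A) \<and> star_amp X \<odot> X = \<one>\<^sub>A \<and> X \<odot> star_amp X = \<one>\<^sub>A"

lemma unitary_carrier: "unitary X \<Longrightarrow> X \<in> carrier_vec (adim A)"
  by (simp add: unitary_def)

lemma unitary_cancel:
  assumes "unitary X" "Y \<in> carrier_vec (adim A)"
  shows "star_amp X \<odot> (X \<odot> Y) = Y" "X \<odot> (star_amp X \<odot> Y) = Y"
  using assms by (simp_all add: mult_assoc[symmetric] unitary_def one_mult)

lemma unitary_map: "star_hom f \<Longrightarrow> unitary X \<Longrightarrow> unitary (map_vec f X)"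
  by (simp add: unitary_def map_vec_star_amp[symmetric] map_vec_mult[symmetric] map_vec_hom_tprod_one)

lemma unitary_mult:
  assumes X: "unitary X" and Y: "unitary Y"
  shows "unitary (X \<odot> Y)"
proof -
  note c = unitary_carrier[OF X] unitary_carrier[OF Y]
  have "star_amp (star_amp X) = X" using c by (simp add: star_amp_star_amp)
  then show ?thesis
    using X Y c by (simp add: unitary_def star_amp_mult mult_assoc unitary_cancel[OF X] unitary_cancel[OF Y])
qed

text \<open>The order is such that \<open>W \<odot> V \<odot> commutator V W = V \<odot> W\<close>
  for unitaries.\<close>

definition commutator :: "'h::complex_star_algebra vec \<Rightarrow> 'h vec \<Rightarrow> 'h vec" where
  "commutator V W = star_amp V \<odot> (star_amp W \<odot> (V \<odot> W))"

lemma commutator_carrier [simp]: "commutator V W \<in> carrier_vec (adim A)"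
  by (simp add: commutator_def)

lemma map_vec_commutator:
  "star_hom f \<Longrightarrow> map_vec f (commutator V W) = commutator (map_vec f V) (map_vec f W)"
  by (simp add: commutator_def map_vec_mult map_vec_star_amp)

text \<open>Inserting W \<open>star_amp W\<close> after the inner \<open>V1\<close> exposes
  \<open>commutator V1 W\<close> with \<open>star_amp V2\<close> on its left; \<open>comm\<close>
  moves it out to the front.\<close>

lemma commutator_mult_left:
  assumes V1: "unitary V1" and V2: "unitary V2" and W: "unitary W"
    and comm: "commutator V1 W \<odot> star_amp V2 = star_amp V2 \<odot> commutator V1 W"
  shows "commutator (V1 \<odot> V2) W = commutator V1 W \<odot> commutator V2 W"
proof -
  note c = unitary_carrier[OF V1] unitary_carrier[OF V2] unitary_carrier[OF W]
  have "commutator V1 W \<odot> commutator V2 W =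
      (commutator V1 W \<odot> star_amp V2) \<odot> (star_amp W \<odot> (V2 \<odot> W))"
    using c by (simp add: commutator_def[of V2] mult_assoc)
  also have "\<dots> = star_amp V2 \<odot> (commutator V1 W \<odot> (star_amp W \<odot> (V2 \<odot> W)))"
    using c by (simp only: comm) (simp add: mult_assoc)
  also have "\<dots> = commutator (V1 \<odot> V2) W"
    using c by (simp add: commutator_def mult_assoc star_amp_mult unitary_cancel[OF W])
  finally show ?thesis ..
qed

text \<open>Here the commutator with \<open>W1\<close> is moved to the right past \<open>W2\<close>,
  so the factors come out in reversed order. This is the source of the order of the legs in
  \<open>comult_right\<close>.\<close>

lemma commutator_mult_right:
  assumes V: "unitary V" and W1: "unitary W1" and W2: "unitary W2"
    and comm: "commutator V W1 \<odot> W2 = W2 \<odot> commutator V W1"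
  shows "commutator V (W1 \<odot> W2) = commutator V W2 \<odot> commutator V W1"
proof -
  note c = unitary_carrier[OF V] unitary_carrier[OF W1] unitary_carrier[OF W2]
  have "commutator V W2 \<odot> commutator V W1 =
      star_amp V \<odot> (star_amp W2 \<odot> (V \<odot> (W2 \<odot> commutator V W1)))"
    using c by (simp add: commutator_def[of V W2] mult_assoc)
  also have "\<dots> = star_amp V \<odot> (star_amp W2 \<odot> (V \<odot> (commutator V W1 \<odot> W2)))"
    by (simp only: comm)
  also have "\<dots> = commutator V (W1 \<odot> W2)"
    using c by (simp add: commutator_def mult_assoc star_amp_mult unitary_cancel[OF V])
  finally show ?thesis ..
qed

lemma commutator_eq_one:
  assumes V: "unitary V" and W: "unitary W" and one: "commutator V W = \<one>\<^sub>A"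
  shows "V \<odot> W = W \<odot> V"
proof -
  note c = unitary_carrier[OF V] unitary_carrier[OF W]
  have "W \<odot> (V \<odot> commutator V W) = V \<odot> W"
    using c by (simp add: commutator_def unitary_cancel[OF V] unitary_cancel[OF W])
  then show ?thesis using c by (simp add: one one_mult)
qed

text \<open>An elementary tensor splits as \<open>v \<otimes> 1\<close> times
  \<open>1 \<otimes> g y\<close>: centrality handles the first factor and commuting coefficients the
  second. It is used for copies of one commutator and one unitary sitting in different legs.\<close>

lemma central_commute:
  assumes Z: "Z \<in> carrier_vec (adim A)" and Y: "Y \<in> carrier_vec (adim A)"
    and central: "\<And>v. v \<in> acarrier A \<Longrightarrow> Z \<odot> vec_tprod v 1 = vec_tprod v 1 \<odot> Z"
    and f: "star_hom f" and g: "clinear g" and fg: "\<And>x y. f x * g y = g y * f x"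
  shows "map_vec f Z \<odot> map_vec g Y = map_vec g Y \<odot> map_vec f Z"
  using Y
proof (induction Y rule: vec_tensor_induct)
  case (add x y)
  then show ?case by (simp add: map_vec_add[OF g] mult_add)
next
  case (tprod v y)
  have split: "vec_tprod v (g y) = vec_tprod v 1 \<odot> vec_tprod (aone A) (g y)"
    using tprod by (simp add: mult_tprod aone_mult)
  have comm1: "map_vec f Z \<odot> vec_tprod v 1 = vec_tprod v 1 \<odot> map_vec f Z"
    using arg_cong[OF central[OF tprod], of "map_vec f"] by (simp add: map_vec_mult f map_vec_hom_tprod_one)
  have comm2: "map_vec f Z \<odot> vec_tprod (aone A) (g y) = vec_tprod (aone A) (g y) \<odot> map_vec f Z"
    by (rule commute_scalar[OF Z star_homD(1)[OF f] fg])
  have "map_vec f Z \<odot> vec_tprod v (g y) = (map_vec f Z \<odot> vec_tprod v 1) \<odot> vec_tprod (aone A) (g y)"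
    using Z tprod by (simp add: split mult_assoc)
  also have "\<dots> = vec_tprod v 1 \<odot> (map_vec f Z \<odot> vec_tprod (aone A) (g y))"
    using Z tprod by (simp add: comm1 mult_assoc)
  also have "\<dots> = vec_tprod v (g y) \<odot> map_vec f Z"
    using Z tprod by (simp add: comm2 split mult_assoc)
  finally show ?case by (simp add: map_vec_tprod g)
qed

lemma implements_unitary: "implements \<Gamma> A \<alpha> U \<Longrightarrow> unitary U"
  by (simp add: implements_iff unitary_def)

lemma mult_scalar:
  assumes "X \<in> carrier_vec (adim A)"
  shows "X \<odot> vec_tprod (aone A) t = map_vec (\<lambda>h. h * t) X"
  using assms
  by (induction X rule: vec_tensor_induct)
    (simp_all add: mult_add map_vec_add[OF clinear_mult_right] map_vec_tprod clinear_mult_right mult_tprod aone_mult)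

text \<open>If the convolution of \<open>q\<close> and \<open>q'\<close> is the identity,
  coassociativity recovers \<open>\<alpha>\<close> by applying \<open>q\<close> to an inner copy of
  \<open>\<alpha>\<close> and \<open>q'\<close> to the outer one. The inner copy is conjugation by
  \<open>V\<close>, and \<open>comm\<close> lets the outer coefficient slip inside that
  conjugation.\<close>

lemma iterated_inner:
  fixes \<alpha> :: "complex vec \<Rightarrow> 'h::complex_star_algebra vec"
  assumes \<alpha>: "corepresentation \<Gamma> (adim A) \<alpha>" and q: "star_hom q" and q': "star_hom q'"
    and id: "\<And>z. tensor_lift (\<lambda>s t. q s * q' t) (comult \<Gamma> z) = z"
    and V: "V \<in> carrier_vec (adim A)"
      "\<And>a. a \<in> acarrier A \<Longrightarrow> map_vec q (\<alpha> a) = V \<odot> vec_tprod a 1 \<odot> star_amp V"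
    and comm: "\<And>h. star_amp V \<odot> vec_tprod (aone A) (q' h) = vec_tprod (aone A) (q' h) \<odot> star_amp V"
    and a: "a \<in> acarrier A"
  shows "\<alpha> a = V \<odot> map_vec q' (\<alpha> a) \<odot> star_amp V"
proof -
  let ?m = "tensor_lift (\<lambda>s t. q s * q' t)"
  note Q = star_homD(1)[OF q] and Q' = star_homD(1)[OF q']
  have bil: "cbilinear (\<lambda>s t. q s * q' t)" by (rule cbilinear_mult[OF Q Q'])
  have m: "clinear ?m" by (rule clinear_tensor_lift[OF bil])
  have lin: "vec_linear (adim A) (adim A) \<alpha>" using \<alpha> by (simp add: corepresentation_def)
  have aux: "map_vec ?m (amplify_corep (adim A) \<alpha> y) = V \<odot> map_vec q' y \<odot> star_amp V"
    if "y \<in> carrier_vec (adim A)" for y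
    using that
  proof (induction y rule: vec_tensor_induct)
    case (add x y)
    then show ?case using V(1)
      by (simp add: amplify_corep_add[of _ "adim A"] map_vec_add[OF m, of _ "adim A"] map_vec_add[OF Q'] mult_add)
  next
    case (tprod v h)
    have "map_vec ?m (amplify_corep (adim A) \<alpha> (vec_tprod v h)) = map_vec (\<lambda>g. g * q' h) (map_vec q (\<alpha> v))"
      using tprod by (simp add: amplify_corep_tprod[OF lin] map_vec_comp bil)
    also have "\<dots> = (V \<odot> vec_tprod v 1 \<odot> star_amp V) \<odot> vec_tprod (aone A) (q' h)"
      using tprod by (simp add: V(2) mult_scalar)
    also have "\<dots> = V \<odot> vec_tprod v 1 \<odot> (star_amp V \<odot> vec_tprod (aone A) (q' h))"
      using V(1) by (simp add: mult_assoc)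
    also have "\<dots> = V \<odot> (vec_tprod v 1 \<odot> vec_tprod (aone A) (q' h)) \<odot> star_amp V"
      using V(1) tprod by (simp only: comm) (simp add: mult_assoc)
    also have "vec_tprod v 1 \<odot> vec_tprod (aone A) (q' h) = map_vec q' (vec_tprod v h)"
      using tprod by (simp add: mult_tprod aone_mult map_vec_tprod Q')
    finally show ?case .
  qed
  have c: "\<alpha> a \<in> carrier_vec (adim A)" by (rule vec_semilinear_carrier[OF lin a])
  have "\<alpha> a = map_vec ?m (map_vec (comult \<Gamma>) (\<alpha> a))"
    by (simp add: map_vec_comp id)
  also have "map_vec (comult \<Gamma>) (\<alpha> a) = amplify_corep (adim A) \<alpha> (\<alpha> a)"
    using \<alpha> a by (simp add: corepresentation_def)
  finally show ?thesis using aux[OF c] by simp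
qed

end

subsection \<open>Minimal central components of a Hilbert bimodule\<close>

lemma map_vec_scaleC_complex: "map_vec (scaleC c) v = c \<cdot>\<^sub>v (v :: complex vec)"
  by (rule eq_vecI) (simp_all add: scaleC_complex_def)

lemma map_vec_scaleC_tprod: "map_vec (scaleC c) (vec_tprod v h) = vec_tprod v (c *\<^sub>C h)"
  by (rule eq_vecI) (simp_all add: mult.commute)

lemma vec_tprod_inj:
  assumes "v \<in> carrier_vec n" "v \<noteq> 0\<^sub>v n" and eq: "vec_tprod v x = vec_tprod v y"
  shows "x = y"
proof -
  obtain i where i: "i < n" "v $ i \<noteq> 0" using assms by (metis carrier_vecD eq_vecI index_zero_vec)
  then have "v $ i *\<^sub>C x = v $ i *\<^sub>C y" using arg_cong[OF eq, of "\<lambda>z. z $ i"] assms(1) by simp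
  then show ?thesis using i by simp
qed

locale trivial_imprimitivity = imprimitivity A "trivial_algebra k" m l r lip rip
  for A k m l r lip rip
begin

text \<open>The summand of the bimodule cut out by the \<open>i\<close>-th minimal projection of the
  sum of copies of \<complex>. These summands correspond to the simple blocks of
  \<open>A\<close>.\<close>

definition corner :: "nat \<Rightarrow> complex vec \<Rightarrow> bool" where
  "corner i x \<longleftrightarrow> i < k \<and> x \<in> carrier_vec m \<and> r x (unit_vec k i) = x"

lemma trivial_simps [simp]: "adim (trivial_algebra k) = k"
  "amult (trivial_algebra k) x y = vec k (\<lambda>i. x $ i * y $ i)"
  by (simp_all add: trivial_algebra_def)

lemma rip_carrier [simp]: "x \<in> carrier_vec m \<Longrightarrow> y \<in> carrier_vec m \<Longrightarrow> rip x y \<in> carrier_vec k"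
  using base_carrier(4)[of x y] by simp

lemma r_mult:
  "x \<in> carrier_vec m \<Longrightarrow> b \<in> carrier_vec k \<Longrightarrow> c \<in> carrier_vec k \<Longrightarrow>
    r (r x b) c = r x (vec k (\<lambda>i. b $ i * c $ i))"
  using right_module by (simp add: right_hilbert_module_def)

lemma r_one: "x \<in> carrier_vec m \<Longrightarrow> r x (vec k (\<lambda>_. 1)) = x"
  using right_module by (simp add: right_hilbert_module_def trivial_algebra_def)

lemma r_add: "x \<in> carrier_vec m \<Longrightarrow> b \<in> carrier_vec k \<Longrightarrow> c \<in> carrier_vec k \<Longrightarrow> r x (b + c) = r x b + r x c"
  and r_smult: "x \<in> carrier_vec m \<Longrightarrow> b \<in> carrier_vec k \<Longrightarrow> r x (s \<cdot>\<^sub>v b) = s \<cdot>\<^sub>v r x b"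
  using bilinear_r by (simp_all add: vec_sesquilinear_def vec_semilinear_def map_vec_scaleC_complex)

lemma rip_r:
  "x \<in> carrier_vec m \<Longrightarrow> y \<in> carrier_vec m \<Longrightarrow> b \<in> carrier_vec k \<Longrightarrow>
    rip x (r y b) = vec k (\<lambda>i. rip x y $ i * b $ i)"
  using right_module by (simp add: right_hilbert_module_def)

lemma rip_definite: "x \<in> carrier_vec m \<Longrightarrow> rip x x = 0\<^sub>v k \<Longrightarrow> x = 0\<^sub>v m"
  using right_module by (simp add: right_hilbert_module_def)

lemma corner_r:
  assumes x: "corner i x" and b: "b \<in> carrier_vec k"
  shows "r x b = b $ i \<cdot>\<^sub>v x"
proof -
  have i: "i < k" and xm: "x \<in> carrier_vec m" and xr: "r x (unit_vec k i) = x"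
    using x by (simp_all add: corner_def)
  have "r x b = r x (vec k (\<lambda>j. unit_vec k i $ j * b $ j))"
    using r_mult[OF xm _ b, of "unit_vec k i"] by (simp add: xr)
  also have "vec k (\<lambda>j. unit_vec k i $ j * b $ j) = b $ i \<cdot>\<^sub>v unit_vec k i"
    by (rule eq_vecI) (use i in auto)
  finally show ?thesis by (simp add: r_smult xm xr)
qed

lemma corner_ract:
  assumes x: "corner i x" and Y: "Y \<in> carrier_vec k"
  shows "vec_tprod x 1 \<lhd> Y = vec_tprod x (Y $ i)"
proof -
  have i: "i < k" and xm: "x \<in> carrier_vec m" using x by (simp_all add: corner_def)
  show ?thesis using Y
  proof (induction Y rule: vec_tensor_induct)
    case (add Y Y')
    have "vec_tprod x (s + t) = vec_tprod x s + vec_tprod x t" for s t :: 'a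
      by (rule eq_vecI) (simp_all add: scaleC_add_right)
    then show ?case using add i by (simp add: amplify2_add_right[of _ k])
  next
    case (tprod b h)
    then show ?case using xm i amplify2_tprod[OF bilinear_r, of x b 1 h]
      by (simp add: corner_r[OF x] vec_tprod_smult map_vec_scaleC_tprod)
  qed
qed

lemma corner_rip:
  assumes x: "corner i x"
  shows "rip x x = rip x x $ i \<cdot>\<^sub>v unit_vec k i"
proof -
  have i: "i < k" and xm: "x \<in> carrier_vec m" and xr: "r x (unit_vec k i) = x"
    using x by (simp_all add: corner_def)
  have "rip x x = vec k (\<lambda>j. rip x x $ j * unit_vec k i $ j)"
    using rip_r[OF xm xm, of "unit_vec k i"] by (simp add: xr)
  also have "\<dots> = rip x x $ i \<cdot>\<^sub>v unit_vec k i"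
    by (rule eq_vecI) (use i in auto)
  finally show ?thesis .
qed

text \<open>On a corner the right action is by scalars, so
  \<open>l (lip x x) x = \<rho> \<cdot>\<^sub>v x\<close> with \<rho> nonzero by definiteness. Since
  \<open>Z\<close> commutes with \<open>lip x x\<close>, \<rho> times \<open>Z \<rhd> x\<close>
  equals \<open>lip x x\<close> acting on \<open>Z \<rhd> x\<close>, which is \<open>x\<close> acted
  on by \<open>Rip x (Z \<rhd> x)\<close> and hence \<open>x\<close> with a scalar attached.\<close>

lemma central_eigenvector:
  fixes Z :: "'h::complex_star_algebra vec"
  assumes Z: "Z \<in> carrier_vec (adim A)"
    and central: "\<And>v. v \<in> acarrier A \<Longrightarrow> Z \<odot> vec_tprod v 1 = vec_tprod v 1 \<odot> Z"
    and x: "corner i x" "x \<noteq> 0\<^sub>v m"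
  shows "\<exists>\<zeta>. Z \<rhd> vec_tprod x 1 = vec_tprod x \<zeta>"
proof -
  have i: "i < k" and xm: "x \<in> carrier_vec m" using x by (simp_all add: corner_def)
  define \<rho> where "\<rho> = rip x x $ i"
  have "\<rho> \<noteq> 0"
  proof
    assume "\<rho> = 0"
    then have "rip x x = 0 \<cdot>\<^sub>v unit_vec k i" using corner_rip[OF x(1)] unfolding \<rho>_def by metis
    also have "\<dots> = 0\<^sub>v k" by (rule eq_vecI) auto
    finally have "rip x x = 0\<^sub>v k" .
    then show False using rip_definite xm x(2) by blast
  qed
  let ?x = "vec_tprod x (1 :: 'h)"
  define \<zeta> where "\<zeta> = Rip ?x (Z \<rhd> ?x) $ i"
  have lip_carrier: "lip x x \<in> acarrier A" using xm by simp
  have "vec_tprod x \<zeta> = ?x \<lhd> Rip ?x (Z \<rhd> ?x)"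
    unfolding \<zeta>_def by (rule corner_ract[OF x(1), symmetric]) simp
  also have "\<dots> = Lip ?x ?x \<rhd> Z \<rhd> ?x"
    using xm by (simp add: Lip_act)
  also have "Lip ?x ?x = vec_tprod (lip x x) 1"
    by (rule Lip_tprod_one[OF xm xm])
  also have "vec_tprod (lip x x) 1 \<rhd> Z \<rhd> ?x = Z \<rhd> vec_tprod (lip x x) 1 \<rhd> ?x"
    using Z xm lip_carrier by (simp add: act_mult[symmetric] central)
  also have "vec_tprod (lip x x) 1 \<rhd> ?x = vec_tprod (l (lip x x) x) 1"
    using xm by (simp add: amp_simps)
  also have "l (lip x x) x = \<rho> \<cdot>\<^sub>v x"
    using xm by (simp add: l_lip corner_r[OF x(1)] \<rho>_def)
  also have "Z \<rhd> vec_tprod (\<rho> \<cdot>\<^sub>v x) 1 = map_vec (scaleC \<rho>) (Z \<rhd> ?x)"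
    by (simp add: vec_tprod_smult map_vec_scaleC_amplify2)
  finally have "map_vec (scaleC (inverse \<rho>)) (vec_tprod x \<zeta>) =
      map_vec (scaleC (inverse \<rho>)) (map_vec (scaleC \<rho>) (Z \<rhd> ?x))" by simp
  then have "vec_tprod x (inverse \<rho> *\<^sub>C \<zeta>) = Z \<rhd> ?x"
    using \<open>\<rho> \<noteq> 0\<close> by (simp add: map_vec_scaleC_tprod map_vec_comp)
  then show ?thesis by metis
qed

lemma act_scalar:
  assumes "X \<rhd> vec_tprod x 1 = vec_tprod x s"
  shows "X \<rhd> vec_tprod x t = vec_tprod x (s * t)"
proof -
  have scale: "vec_tprod x (h * t) = map_vec (\<lambda>h. h * t) (vec_tprod x h)" for h
    by (rule eq_vecI) simp_all
  have "X \<rhd> map_vec (\<lambda>h. h * t) y = map_vec (\<lambda>h. h * t) (X \<rhd> y)" for y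
    by (rule eq_vecI) (simp_all add: amplify2_def sum_distrib_right mult.assoc)
  from this[of "vec_tprod x 1"] show ?thesis
    by (simp add: assms scale[symmetric])
qed

lemma map_act_scalar:
  assumes f: "star_hom f" and eq: "X \<rhd> vec_tprod x 1 = vec_tprod x s"
  shows "map_vec f X \<rhd> vec_tprod x 1 = vec_tprod x (f s)"
  using arg_cong[OF eq, of "map_vec f"]
  by (simp add: map_vec_hom_amplify2 map_vec_hom_tprod_one map_vec_tprod f star_homD(1,2)[OF f])

text \<open>The unit of the right algebra is the sum of its minimal projections, so every vector is
  a sum of corner vectors, and the action is faithful.\<close>

lemma eq_one_on_corners:
  fixes X :: "'h::complex_star_algebra vec"
  assumes X: "X \<in> carrier_vec (adim A)"
    and eq: "\<And>i x. corner i x \<Longrightarrow> x \<noteq> 0\<^sub>v m \<Longrightarrow> X \<rhd> vec_tprod x 1 = vec_tprod x 1"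
  shows "X = A.one_amp"
proof (rule act_faithful[OF X])
  have zero: "X \<rhd> vec_tprod (0\<^sub>v m) 1 = vec_tprod (0\<^sub>v m) 1"
  proof -
    have z: "vec_tprod (0\<^sub>v m) (1 :: 'h) = map_vec (scaleC 0) (vec_tprod (0\<^sub>v m) 1)"
      by (rule eq_vecI) simp_all
    have "X \<rhd> vec_tprod (0\<^sub>v m) 1 = map_vec (scaleC 0) (X \<rhd> vec_tprod (0\<^sub>v m) 1)"
      by (subst z) (rule map_vec_scaleC_amplify2)
    also have "\<dots> = vec_tprod (0\<^sub>v m) 1"
      by (rule eq_vecI) (simp_all add: amplify2_def)
    finally show ?thesis .
  qed
  fix z :: "complex vec" assume z: "z \<in> carrier_vec m"
  have part: "X \<rhd> vec_tprod (r z b) 1 = vec_tprod (r z b) 1" if "b \<in> carrier_vec k" for b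
    using that
  proof (rule vec_sum_induct[where P = "\<lambda>b. X \<rhd> vec_tprod (r z b) 1 = vec_tprod (r z b) 1"])
    fix x y :: "complex vec"
    assume "x \<in> carrier_vec k" "y \<in> carrier_vec k" "X \<rhd> vec_tprod (r z x) 1 = vec_tprod (r z x) 1"
      "X \<rhd> vec_tprod (r z y) 1 = vec_tprod (r z y) 1"
    then show "X \<rhd> vec_tprod (r z (x + y)) 1 = vec_tprod (r z (x + y)) 1"
      using z by (simp add: r_add vec_tprod_add[of _ m] amplify2_add_right[of _ m])
  next
    have "r z (0 \<cdot>\<^sub>v 0\<^sub>v k) = 0 \<cdot>\<^sub>v r z (0\<^sub>v k)" using z by (simp only: r_smult zero_carrier_vec)
    moreover have "0 \<cdot>\<^sub>v 0\<^sub>v k = vec k (\<lambda>_. 0 :: complex)" by (rule eq_vecI) simp_all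
    moreover have "0 \<cdot>\<^sub>v r z (0\<^sub>v k) = 0\<^sub>v m"
      using base_carrier(2)[OF z, of "0\<^sub>v k"] by (intro eq_vecI) auto
    ultimately show "X \<rhd> vec_tprod (r z (vec k (\<lambda>_. 0))) 1 = vec_tprod (r z (vec k (\<lambda>_. 0))) 1"
      using zero by simp
  next
    fix i assume i: "i < k"
    let ?b = "vec k (\<lambda>j. if j = i then b $ i else 0)"
    have "vec k (\<lambda>j. ?b $ j * unit_vec k i $ j) = ?b"
      by (rule eq_vecI) (use i in auto)
    then have "corner i (r z ?b)"
      using i z r_mult[OF z, of ?b "unit_vec k i"] base_carrier(2)[OF z, of ?b] by (simp add: corner_def)
    then show "X \<rhd> vec_tprod (r z ?b) 1 = vec_tprod (r z ?b) 1"
      using eq zero by (cases "r z ?b = 0\<^sub>v m") auto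
  qed
  show "X \<rhd> vec_tprod z 1 = A.one_amp \<rhd> vec_tprod z 1"
    using part[of "vec k (\<lambda>_. 1)"] z by (simp add: r_one act_one)
qed simp

end

subsection \<open>Coactions of a Cartesian product\<close>

lemma coaction_map:
  fixes \<alpha> :: "complex vec \<Rightarrow> 'h::complex_star_algebra vec" and q :: "'h \<Rightarrow> 'k::complex_star_algebra"
  assumes \<alpha>: "coaction \<Gamma> A \<alpha>" and q: "star_hom q"
    and comult: "\<And>t. tensor_map q q (comult \<Gamma> t) = comult \<Gamma>' (q t)"
    and counit: "\<And>t. counit \<Gamma>' (q t) = counit \<Gamma> t"
  shows "coaction \<Gamma>' A (\<lambda>x. map_vec q (\<alpha> x))"
proof -
  note Q = star_homD(1)[OF q]
  interpret fd_star_alg A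
    by unfold_locales (use \<alpha> in \<open>simp add: coaction_def fd_cstar_algebra_def\<close>)
  let ?n = "adim A"
  have lin: "vec_linear ?n ?n \<alpha>" using \<alpha> by (simp add: coaction_def corepresentation_def)
  have carrier: "\<alpha> x \<in> carrier_vec ?n" if "x \<in> carrier_vec ?n" for x
    by (rule vec_semilinear_carrier[OF lin that])
  have "vec_linear ?n ?n (\<lambda>x. map_vec q (\<alpha> x))"
    using lin by (simp add: vec_semilinear_def map_vec_add[OF Q, of _ ?n] map_vec_comp clinear_scaleC[OF Q])
  moreover have "map_vec (comult \<Gamma>') (map_vec q (\<alpha> x)) = amplify_corep ?n (\<lambda>x. map_vec q (\<alpha> x)) (map_vec q (\<alpha> x))"
    if x: "x \<in> carrier_vec ?n" for x
  proof -
    have "map_vec (comult \<Gamma>') (map_vec q (\<alpha> x)) = map_vec (tensor_map q q) (map_vec (comult \<Gamma>) (\<alpha> x))"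
      by (simp add: map_vec_comp comult)
    also have "map_vec (comult \<Gamma>) (\<alpha> x) = amplify_corep ?n \<alpha> (\<alpha> x)"
      using \<alpha> x by (simp add: coaction_def corepresentation_def)
    also have "map_vec (tensor_map q q) \<dots> = amplify_corep ?n (\<lambda>x. map_vec q (\<alpha> x)) (map_vec q (\<alpha> x))"
      using carrier[OF x] carrier[OF unit_vec_carrier, THEN carrier_vecD]
      by (intro eq_vecI) (simp_all add: amplify_corep_def clinear_sum[OF clinear_tensor_map[OF Q Q]] Q)
    finally show ?thesis .
  qed
  moreover have "map_vec (counit \<Gamma>') (map_vec q (\<alpha> x)) = x" if "x \<in> carrier_vec ?n" for x
    using \<alpha> that by (simp add: map_vec_comp counit coaction_def corepresentation_def)
  ultimately show ?thesis
    using \<alpha> by (simp add: coaction_def corepresentation_def map_vec_hom_tprod_one q map_vec_hom_amplify2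
        map_vec_star_amp)
qed

context dqg_pair
begin

lemma proj_tprod: "proj1 (a \<otimes>\<^sub>C b) = G2.\<epsilon> b *\<^sub>C a" "proj2 (a \<otimes>\<^sub>C b) = G1.\<epsilon> a *\<^sub>C b"
  by (simp_all add: proj1_def proj2_def cbilinear_scaleC' cbilinear_scaleC)

lemma star_hom_proj: "star_hom proj1" "star_hom proj2"
proof -
  have eq1: "proj1 = tensor_lift (\<lambda>a b. a * (G2.\<epsilon> b *\<^sub>C 1))"
    by (simp add: proj1_def)
  show "star_hom proj1" unfolding eq1
    by (intro star_hom_tensor_lift star_hom_id star_hom_comp[OF star_hom_scalar] G2.star_hom_counit)
      simp
  have eq2: "proj2 = tensor_lift (\<lambda>a b. (G1.\<epsilon> a *\<^sub>C 1) * b)"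
    by (simp add: proj2_def)
  show "star_hom proj2" unfolding eq2
    by (intro star_hom_tensor_lift star_hom_id star_hom_comp[OF star_hom_scalar] G1.star_hom_counit)
      simp
qed

lemmas clinear_proj = star_homD(1)[OF star_hom_proj(1)] star_homD(1)[OF star_hom_proj(2)]

lemma counit_proj: "G1.\<epsilon> (proj1 t) = counit \<Gamma> t" "G2.\<epsilon> (proj2 t) = counit \<Gamma> t"
  by (rule tensor_ext[OF clinear_comp[OF G1.clinear_counit clinear_proj(1)] star_homD(1)[OF star_hom_product_counit]],
      simp add: proj_tprod clinear_scaleC[OF G1.clinear_counit] product_counit_tprod scaleC_complex_def)
    (rule tensor_ext[OF clinear_comp[OF G2.clinear_counit clinear_proj(2)] star_homD(1)[OF star_hom_product_counit]],
      simp add: proj_tprod clinear_scaleC[OF G2.clinear_counit] product_counit_tprod scaleC_complex_def)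

lemma comult_proj:
  "tensor_map proj1 proj1 (comult \<Gamma> t) = G1.\<Delta> (proj1 t)"
  "tensor_map proj2 proj2 (comult \<Gamma> t) = G2.\<Delta> (proj2 t)"
proof -
  note D = star_homD(1)[OF star_hom_product_comult]
  show "tensor_map proj1 proj1 (comult \<Gamma> t) = G1.\<Delta> (proj1 t)"
  proof (rule tensor_ext[OF clinear_comp[OF clinear_tensor_map D] clinear_comp[OF comult_lin(1)]])
    fix a :: 'a and b :: 'b
    have "tensor_map proj1 proj1 (tensor_interchange (G1.\<Delta> a \<otimes>\<^sub>C G2.\<Delta> b)) =
        tensor_lift (\<lambda>a b. G2.\<epsilon> a * G2.\<epsilon> b) (G2.\<Delta> b) *\<^sub>C tensor_lift (\<otimes>\<^sub>C) (G1.\<Delta> a)"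
      unfolding tensor_map_def
      by (rule tensor_lift_interchange[where h = "\<lambda>x c. c *\<^sub>C x"])
        (simp_all add: cbilinear_tensor cbilinear_tprod clinear_proj cbilinear_scaleC' cbilinear_mult proj_tprod)
    then show "tensor_map proj1 proj1 (comult \<Gamma> (a \<otimes>\<^sub>C b)) = G1.\<Delta> (proj1 (a \<otimes>\<^sub>C b))"
      by (simp add: product_comult_tprod proj_tprod G2.counit_counit tensor_lift_tensor clinear_scaleC[OF comult_lin(1)])
  qed (rule clinear_proj)+
  show "tensor_map proj2 proj2 (comult \<Gamma> t) = G2.\<Delta> (proj2 t)"
  proof (rule tensor_ext[OF clinear_comp[OF clinear_tensor_map D] clinear_comp[OF comult_lin(2)]])
    fix a :: 'a and b :: 'b
    have "tensor_map proj2 proj2 (tensor_interchange (G1.\<Delta> a \<otimes>\<^sub>C G2.\<Delta> b)) =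
        tensor_lift (\<lambda>a b. G1.\<epsilon> a * G1.\<epsilon> b) (G1.\<Delta> a) *\<^sub>C tensor_lift (\<otimes>\<^sub>C) (G2.\<Delta> b)"
      unfolding tensor_map_def
      by (rule tensor_lift_interchange[where h = "\<lambda>c x. c *\<^sub>C x"])
        (simp_all add: cbilinear_tensor cbilinear_tprod clinear_proj cbilinear_scaleC cbilinear_mult proj_tprod)
    then show "tensor_map proj2 proj2 (comult \<Gamma> (a \<otimes>\<^sub>C b)) = G2.\<Delta> (proj2 (a \<otimes>\<^sub>C b))"
      by (simp add: product_comult_tprod proj_tprod G1.counit_counit tensor_lift_tensor clinear_scaleC[OF comult_lin(2)])
  qed (rule clinear_proj)+
qed

definition incl1 :: "'a \<Rightarrow> ('a, 'b) tensor" where "incl1 a = a \<otimes>\<^sub>C 1"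
definition incl2 :: "'b \<Rightarrow> ('a, 'b) tensor" where "incl2 b = 1 \<otimes>\<^sub>C b"

lemma star_hom_incl: "star_hom incl1" "star_hom incl2"
  unfolding incl1_def incl2_def by (rule star_hom_tprod_left star_hom_tprod_right)+

lemma incl_commute: "incl1 a * incl2 b = incl2 b * incl1 a"
  by (simp add: incl1_def incl2_def)

lemma comult_incl:
  "comult \<Gamma> (incl1 a) = tensor_map incl1 incl1 (G1.\<Delta> a)"
  "comult \<Gamma> (incl2 b) = tensor_map incl2 incl2 (G2.\<Delta> b)"
proof -
  note one = star_homD(2)[OF star_hom_tensor_map[OF star_hom_tprod_left star_hom_tprod_left]]
    star_homD(2)[OF star_hom_tensor_map[OF star_hom_tprod_right star_hom_tprod_right]]
  show "comult \<Gamma> (incl1 a) = tensor_map incl1 incl1 (G1.\<Delta> a)"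
    unfolding incl1_def
    by (simp add: product_comult_tprod star_homD(2)[OF G2.star_hom_comult] tensor_interchange_tprod_eq one)
  show "comult \<Gamma> (incl2 b) = tensor_map incl2 incl2 (G2.\<Delta> b)"
    unfolding incl2_def
    by (simp add: product_comult_tprod star_homD(2)[OF G1.star_hom_comult] tensor_interchange_tprod_eq one)
qed

text \<open>Each leg keeps one factor and is killed by the counit in the other. That both orders
  recover \<open>z\<close> encodes that the two restricted coactions commute and compose to the
  given one.\<close>

lemma split_comult:
  "tensor_lift (\<lambda>s t. incl1 (proj1 s) * incl2 (proj2 t)) (comult \<Gamma> z) = z"
  "tensor_lift (\<lambda>s t. incl2 (proj2 s) * incl1 (proj1 t)) (comult \<Gamma> z) = z"
proof -
  have q: "clinear (\<lambda>s. incl1 (proj1 s))" "clinear (\<lambda>s. incl2 (proj2 s))"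
    using star_hom_incl star_hom_proj star_hom_comp star_homD(1) by metis+
  show "tensor_lift (\<lambda>s t. incl1 (proj1 s) * incl2 (proj2 t)) (comult \<Gamma> z) = z"
    by (rule product_lift[OF cbilinear_mult[OF q] G1.bilinear_counit_right G2.bilinear_counit_left _ clinear_id])
      (simp_all add: proj_tprod incl1_def incl2_def mult.commute G1.counit_right G2.counit_left)
  show "tensor_lift (\<lambda>s t. incl2 (proj2 s) * incl1 (proj1 t)) (comult \<Gamma> z) = z"
    by (rule product_lift[OF cbilinear_mult[OF q(2,1)] G1.bilinear_counit_left G2.bilinear_counit_right _ clinear_id])
      (simp_all add: proj_tprod incl1_def incl2_def mult.commute G1.counit_left G2.counit_right)
qed

lemma coaction_proj:
  assumes "coaction \<Gamma> A \<alpha>"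
  shows "coaction \<Gamma>\<^sub>1 A (\<lambda>x. map_vec proj1 (\<alpha> x))" "coaction \<Gamma>\<^sub>2 A (\<lambda>x. map_vec proj2 (\<alpha> x))"
  by (rule coaction_map[OF assms star_hom_proj(1) comult_proj(1) counit_proj(1)]
      coaction_map[OF assms star_hom_proj(2) comult_proj(2) counit_proj(2)])+

end

section \<open>The commutator of the two implementing unitaries\<close>

locale product_coaction =
  dqg_pair \<Gamma>\<^sub>1 \<Gamma>\<^sub>2 + trivial_imprimitivity A k m l r lip rip
  for \<Gamma>\<^sub>1 :: "'a::complex_star_algebra quantum_group"
    and \<Gamma>\<^sub>2 :: "'b::complex_star_algebra quantum_group"
    and A k m l r lip rip +
  fixes \<alpha> :: "complex vec \<Rightarrow> ('a, 'b) tensor vec" and U1 :: "'a vec" and U2 :: "'b vec"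
  assumes \<alpha>: "coaction \<Gamma> A \<alpha>"
    and U1: "implements \<Gamma>\<^sub>1 A (\<lambda>x. map_vec proj1 (\<alpha> x)) U1"
    and U2: "implements \<Gamma>\<^sub>2 A (\<lambda>x. map_vec proj2 (\<alpha> x)) U2"
begin

definition "V = map_vec incl1 U1"
definition "W = map_vec incl2 U2"

text \<open>
  As \<open>V\<close> and \<open>W\<close> implement commuting coactions, \<open>Z\<close> commutes with \<open>A\<close>.  On each minimal central
  component of the bimodule it is a scalar \<open>\<zeta>\<close> in \<open>\<complex>[\<Gamma>\<^sub>1] \<otimes> \<complex>[\<Gamma>\<^sub>2]\<close>, which is a bicharacter.
\<close>

definition "Z = A.commutator V W"

lemmas D1 = A.implementsD[OF U1] and D2 = A.implementsD[OF U2]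

lemma unitary_V: "A.unitary V" and unitary_W: "A.unitary W"
  unfolding V_def W_def
  by (intro A.unitary_map star_hom_incl A.implements_unitary[OF U1] A.implements_unitary[OF U2])+

lemmas V_carrier = A.unitary_carrier[OF unitary_V] and W_carrier = A.unitary_carrier[OF unitary_W]

text \<open>These are \<open>iterated_inner\<close> for the two orders in
  \<open>split_comult\<close>. Its commutation condition holds because the coefficients of
  \<open>V\<close> and of \<open>W\<close> come from different tensor factors.\<close>

lemma inner_VW: "a \<in> acarrier A \<Longrightarrow>
    \<alpha> a = V \<odot> (W \<odot> vec_tprod a 1 \<odot> A.star_amp W) \<odot> A.star_amp V"
  and inner_WV: "a \<in> acarrier A \<Longrightarrow>
    \<alpha> a = W \<odot> (V \<odot> vec_tprod a 1 \<odot> A.star_amp V) \<odot> A.star_amp W"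
proof -
  note i1 = star_hom_incl(1) and i2 = star_hom_incl(2)
  have corep: "corepresentation \<Gamma> (adim A) \<alpha>" using \<alpha> by (simp add: coaction_def)
  have q1: "star_hom (\<lambda>s. incl1 (proj1 s))" and q2: "star_hom (\<lambda>s. incl2 (proj2 s))"
    by (intro star_hom_comp[OF i1] star_hom_comp[OF i2] star_hom_proj)+
  have \<alpha>V: "map_vec (\<lambda>s. incl1 (proj1 s)) (\<alpha> a) = V \<odot> vec_tprod a 1 \<odot> A.star_amp V"
    if "a \<in> acarrier A" for a
    using arg_cong[OF D1(6)[OF that], of "map_vec incl1"]
    by (simp add: map_vec_comp A.map_vec_mult i1 A.map_vec_star_amp map_vec_hom_tprod_one V_def)
  have \<alpha>W: "map_vec (\<lambda>s. incl2 (proj2 s)) (\<alpha> a) = W \<odot> vec_tprod a 1 \<odot> A.star_amp W"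
    if "a \<in> acarrier A" for a
    using arg_cong[OF D2(6)[OF that], of "map_vec incl2"]
    by (simp add: map_vec_comp A.map_vec_mult i2 A.map_vec_star_amp map_vec_hom_tprod_one W_def)
  have commV: "A.star_amp V \<odot> vec_tprod (aone A) (incl2 h) = vec_tprod (aone A) (incl2 h) \<odot> A.star_amp V" for h
    unfolding V_def A.map_vec_star_amp[OF i1, symmetric]
    by (rule A.commute_scalar) (simp_all add: star_homD(1)[OF i1] incl_commute)
  have commW: "A.star_amp W \<odot> vec_tprod (aone A) (incl1 h) = vec_tprod (aone A) (incl1 h) \<odot> A.star_amp W" for h
    unfolding W_def A.map_vec_star_amp[OF i2, symmetric]
    by (rule A.commute_scalar) (simp_all add: star_homD(1)[OF i2] incl_commute)
  show "\<alpha> a = V \<odot> (W \<odot> vec_tprod a 1 \<odot> A.star_amp W) \<odot> A.star_amp V" if a: "a \<in> acarrier A"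
    using A.iterated_inner[OF corep q1 q2 split_comult(1) V_carrier \<alpha>V commV a] \<alpha>W[OF a] by simp
  show "\<alpha> a = W \<odot> (V \<odot> vec_tprod a 1 \<odot> A.star_amp V) \<odot> A.star_amp W" if a: "a \<in> acarrier A"
    using A.iterated_inner[OF corep q2 q1 split_comult(2) W_carrier \<alpha>W commW a] \<alpha>V[OF a] by simp
qed

lemma Z_carrier [simp]: "Z \<in> carrier_vec (adim A)"
  by (simp add: Z_def A.commutator_carrier)

lemma Z_isometric: "A.star_amp Z \<odot> Z = A.one_amp"
proof -
  have "A.star_amp (A.star_amp V) = V" "A.star_amp (A.star_amp W) = W"
    using V_carrier W_carrier by (simp_all add: A.star_amp_star_amp)
  then have "A.unitary (A.star_amp V)" "A.unitary (A.star_amp W)"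
    using unitary_V unitary_W by (simp_all add: A.unitary_def)
  then have "A.unitary Z"
    unfolding Z_def A.commutator_def by (intro A.unitary_mult unitary_V unitary_W)
  then show ?thesis by (simp add: A.unitary_def)
qed

text \<open>Conjugation by \<open>V \<odot> W\<close> and by \<open>W \<odot> V\<close> are both
  \<open>\<alpha>\<close>, and \<open>Z\<close> is the quotient of these two unitaries.\<close>

lemma Z_central:
  assumes a: "a \<in> acarrier A"
  shows "Z \<odot> vec_tprod a 1 = vec_tprod a 1 \<odot> Z"
proof -
  note c = V_carrier W_carrier a
  note cancel = A.unitary_cancel[OF unitary_V] A.unitary_cancel[OF unitary_W]
  have "Z \<odot> vec_tprod a 1 = A.star_amp V \<odot> (A.star_amp W \<odot> (\<alpha> a \<odot> (V \<odot> W)))"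
    unfolding inner_VW[OF a] using c
    by (simp add: Z_def A.commutator_def A.mult_assoc cancel
        unitary_V[unfolded A.unitary_def] unitary_W[unfolded A.unitary_def] A.one_mult)
  also have "\<dots> = vec_tprod a 1 \<odot> Z"
    unfolding inner_WV[OF a] using c by (simp add: Z_def A.commutator_def A.mult_assoc cancel)
  finally show ?thesis .
qed

text \<open>Each projection sends one of the two unitaries to the unit, by the counit condition in
  \<open>implements\<close>, and a commutator with the unit is trivial.\<close>

lemma proj_Z: "map_vec proj1 Z = A.one_amp" "map_vec proj2 Z = A.one_amp"
proof -
  have "map_vec proj1 V = U1" "map_vec proj2 W = U2"
    by (simp_all add: V_def W_def map_vec_comp incl1_def incl2_def proj_tprod G1.counit_one G2.counit_one)
  moreover have "map_vec proj1 W = vec_tprod (map_vec G2.\<epsilon> U2) 1" "map_vec proj2 V = vec_tprod (map_vec G1.\<epsilon> U1) 1"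
    by (rule eq_vecI; simp add: V_def W_def incl1_def incl2_def proj_tprod)+
  ultimately show "map_vec proj1 Z = A.one_amp" "map_vec proj2 Z = A.one_amp"
    using D1(1,2,5) D2(1,2,5)
    unfolding Z_def A.map_vec_commutator[OF star_hom_proj(1)] A.map_vec_commutator[OF star_hom_proj(2)]
    by (simp_all add: A.commutator_def A.star_amp_one A.one_mult)
qed

text \<open>The coproduct of the first factor doubles \<open>V\<close> into two copies in different
  legs and leaves \<open>W\<close> alone, so \<open>commutator_mult_left\<close> applies. Its
  hypothesis holds since the first copy of \<open>Z\<close> is central over \<open>A\<close> and its
  coefficients avoid the leg of the second copy of \<open>V\<close>.\<close>

lemma comult_Z:
  shows "map_vec (tensor_map G1.\<Delta> (\<lambda>b. b)) Z =
      map_vec (tensor_map (\<lambda>a. a \<otimes>\<^sub>C 1) (\<lambda>b. b)) Z \<odot> map_vec (tensor_map (\<lambda>a. 1 \<otimes>\<^sub>C a) (\<lambda>b. b)) Z"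
    (is "map_vec ?D Z = map_vec ?f Z \<odot> map_vec ?g Z")
proof -
  have homs: "star_hom ?D" "star_hom ?f" "star_hom ?g"
    by (intro star_hom_intros G1.star_hom_comult)+
  note lin = star_homD(1)[OF G1.star_hom_comult] clinear_id clinear_tprod_left clinear_tprod_right
  note hom2 = star_hom_comp[OF star_hom_tprod_left star_hom_tprod_right]
  have "map_vec ?D V = map_vec (\<lambda>s. s \<otimes>\<^sub>C 1) (map_vec G1.\<Delta> U1)"
    by (simp add: V_def map_vec_comp incl1_def lin)
  then have DV: "map_vec ?D V = map_vec ?f V \<odot> map_vec ?g V"
    by (simp add: D1(4) A.map_vec_mult star_hom_tprod_left map_vec_comp V_def incl1_def lin)
  have W_eq: "map_vec ?D W = map_vec ?f W" "map_vec ?g W = map_vec ?f W"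
    by (simp_all add: W_def map_vec_comp incl2_def lin star_homD(2)[OF G1.star_hom_comult] one_tensor_def)
  have eq: "A.star_amp (map_vec ?g V) = map_vec (\<lambda>a. (1 \<otimes>\<^sub>C a) \<otimes>\<^sub>C 1) (A.star_amp U1)"
    by (subst A.map_vec_star_amp[OF hom2]) (simp add: V_def map_vec_comp incl1_def lin)
  have comm: "?f t * ((1 \<otimes>\<^sub>C y) \<otimes>\<^sub>C 1) = ((1 \<otimes>\<^sub>C y) \<otimes>\<^sub>C 1) * ?f t" for t y
    by (rule tensor_ext[where t = t])
      (simp_all add: clinear_comp[OF clinear_mult_right clinear_tensor_map]
        clinear_comp[OF clinear_mult_left clinear_tensor_map] lin)
  have "map_vec ?f Z \<odot> A.star_amp (map_vec ?g V) = A.star_amp (map_vec ?g V) \<odot> map_vec ?f Z"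
    unfolding eq
    by (rule A.central_commute[OF Z_carrier _ Z_central homs(2) star_homD(1)[OF hom2] comm]) simp_all
  then show ?thesis
    unfolding Z_def A.map_vec_commutator[OF homs(1)] A.map_vec_commutator[OF homs(2)]
      A.map_vec_commutator[OF homs(3)] DV W_eq
    by (intro A.commutator_mult_left A.unitary_map homs unitary_V unitary_W)
qed

text \<open>Now \<open>W\<close> is doubled and \<open>commutator_mult_right\<close> applies, whence
  the reversed order of the copies of \<open>Z\<close>.\<close>

lemma comult_Z':
  shows "map_vec (tensor_map (\<lambda>a. a) G2.\<Delta>) Z =
      map_vec (tensor_map (\<lambda>a. a) (\<lambda>b. 1 \<otimes>\<^sub>C b)) Z \<odot> map_vec (tensor_map (\<lambda>a. a) (\<lambda>b. b \<otimes>\<^sub>C 1)) Z"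
    (is "map_vec ?D Z = map_vec ?g Z \<odot> map_vec ?f Z")
proof -
  have homs: "star_hom ?D" "star_hom ?f" "star_hom ?g"
    by (intro star_hom_intros G2.star_hom_comult)+
  note lin = star_homD(1)[OF G2.star_hom_comult] clinear_id clinear_tprod_left clinear_tprod_right
  note hom2 = star_hom_comp[OF star_hom_tprod_right star_hom_tprod_right]
  have "map_vec ?D W = map_vec (\<lambda>s. 1 \<otimes>\<^sub>C s) (map_vec G2.\<Delta> U2)"
    by (simp add: W_def map_vec_comp incl2_def lin)
  then have DW: "map_vec ?D W = map_vec ?f W \<odot> map_vec ?g W"
    by (simp add: D2(4) A.map_vec_mult star_hom_tprod_right map_vec_comp W_def incl2_def lin)
  have V_eq: "map_vec ?D V = map_vec ?f V" "map_vec ?g V = map_vec ?f V"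
    by (simp_all add: V_def map_vec_comp incl1_def lin star_homD(2)[OF G2.star_hom_comult] one_tensor_def)
  have eq: "map_vec ?g W = map_vec (\<lambda>b. 1 \<otimes>\<^sub>C (1 \<otimes>\<^sub>C b)) U2"
    by (simp add: W_def map_vec_comp incl2_def lin)
  have comm: "?f t * (1 \<otimes>\<^sub>C (1 \<otimes>\<^sub>C y)) = (1 \<otimes>\<^sub>C (1 \<otimes>\<^sub>C y)) * ?f t" for t y
    by (rule tensor_ext[where t = t])
      (simp_all add: clinear_comp[OF clinear_mult_right clinear_tensor_map]
        clinear_comp[OF clinear_mult_left clinear_tensor_map] lin)
  have "map_vec ?f Z \<odot> map_vec ?g W = map_vec ?g W \<odot> map_vec ?f Z"
    unfolding eq by (rule A.central_commute[OF Z_carrier D2(1) Z_central homs(2) star_homD(1)[OF hom2] comm])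
  then show ?thesis
    unfolding Z_def A.map_vec_commutator[OF homs(1)] A.map_vec_commutator[OF homs(2)]
      A.map_vec_commutator[OF homs(3)] DW V_eq
    by (intro A.commutator_mult_right A.unitary_map homs unitary_V unitary_W)
qed

lemma V_W_commute:
  assumes tf: "torsion_free \<Gamma>\<^sub>2"
  shows "V \<odot> W = W \<odot> V"
proof -
  have "Z = A.one_amp"
  proof (rule eq_one_on_corners[OF Z_carrier])
    fix i x assume x: "corner i x" "x \<noteq> 0\<^sub>v m"
    then have xm: "x \<in> carrier_vec m" by (simp add: corner_def)
    obtain \<zeta> where \<zeta>: "Z \<rhd> vec_tprod x 1 = vec_tprod x \<zeta>"
      using central_eigenvector[OF Z_carrier Z_central x] by blast
    note inj = vec_tprod_inj[OF xm x(2)]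
    have hom: "map_vec f Z \<rhd> vec_tprod x 1 = vec_tprod x (f \<zeta>)" if "star_hom f" for f
      by (rule map_act_scalar[OF that \<zeta>])
    \<comment> \<open>Evaluating at \<open>x\<close> turns products of amplified elements into
      products of scalars in the same order; injectivity of tensoring with the nonzero
      \<open>x\<close> strips off the vector.\<close>
    have product: "f \<zeta> = g \<zeta> * h \<zeta>"
      if "star_hom f" "star_hom g" "star_hom h" and eq: "map_vec f Z = map_vec g Z \<odot> map_vec h Z" for f g h
    proof (rule inj)
      have "vec_tprod x (f \<zeta>) = map_vec g Z \<rhd> map_vec h Z \<rhd> vec_tprod x 1"
        unfolding hom[OF that(1), symmetric] eq using xm by (simp add: act_mult)
      then show "vec_tprod x (f \<zeta>) = vec_tprod x (g \<zeta> * h \<zeta>)"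
        by (simp only: hom[OF that(3)] act_scalar[OF hom[OF that(2)]])
    qed
    have isometric: "star \<zeta> * \<zeta> = 1"
    proof -
      \<comment> \<open>As \<open>Z\<close> is isometric it preserves \<open>Rip\<close>, so
        \<open>star \<zeta> * \<zeta>\<close> and 1 agree after tensoring with
        \<open>rip x x\<close>, which is nonzero by definiteness.\<close>
      have "Rip (vec_tprod x \<zeta>) (vec_tprod x \<zeta>) = Rip (vec_tprod x 1) (vec_tprod x 1)"
        unfolding \<zeta>[symmetric] using xm
        by (simp add: Rip_act act_mult[symmetric] Z_isometric act_one del: trivial_simps)
      then have "vec_tprod (rip x x) (star \<zeta> * \<zeta>) = vec_tprod (rip x x) 1"
        using xm by (simp add: amp_simps del: trivial_simps)
      moreover have "rip x x \<noteq> 0\<^sub>v k" using rip_definite xm x(2) by blast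
      ultimately show ?thesis using vec_tprod_inj rip_carrier[OF xm xm] by blast
    qed
    have counit: "proj1 \<zeta> = 1" "proj2 \<zeta> = 1"
    proof -
      have "vec_tprod x (proj1 \<zeta>) = vec_tprod x 1" "vec_tprod x (proj2 \<zeta>) = vec_tprod x 1"
        using hom[OF star_hom_proj(1)] hom[OF star_hom_proj(2)] xm by (simp_all add: proj_Z act_one)
      then show "proj1 \<zeta> = 1" "proj2 \<zeta> = 1"
        by (blast intro: vec_tprod_inj[OF xm x(2)])+
    qed
    interpret bicharacter \<Gamma>\<^sub>1 \<Gamma>\<^sub>2 \<zeta>
      by (unfold_locales; (rule product[OF _ _ _ comult_Z] product[OF _ _ _ comult_Z'] isometric counit)?;
          intro star_hom_intros G1.star_hom_comult G2.star_hom_comult)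
    have "\<zeta> = 1" by (rule bicharacter_trivial[OF tf])
    then show "Z \<rhd> vec_tprod x 1 = vec_tprod x 1" using \<zeta> by simp
  qed
  then show ?thesis
    unfolding Z_def by (rule A.commutator_eq_one[OF unitary_V unitary_W])
qed

lemma implements_VW:
  assumes tf: "torsion_free \<Gamma>\<^sub>2"
  shows "implements \<Gamma> A \<alpha> (V \<odot> W)"
proof -
  let ?i1 = "\<lambda>x::('a, 'b) tensor. x \<otimes>\<^sub>C (1 :: ('a, 'b) tensor)"
  let ?i2 = "\<lambda>x::('a, 'b) tensor. (1 :: ('a, 'b) tensor) \<otimes>\<^sub>C x"
  have i: "star_hom ?i1" "star_hom ?i2" by (rule star_hom_tprod_left star_hom_tprod_right)+
  note inc = star_hom_incl
  have "map_vec (comult \<Gamma>) V = map_vec (tensor_map incl1 incl1) (map_vec G1.\<Delta> U1)"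
    by (simp add: V_def map_vec_comp comult_incl)
  then have comult_V: "map_vec (comult \<Gamma>) V = map_vec ?i1 V \<odot> map_vec ?i2 V"
    by (simp add: D1(4) A.map_vec_mult star_hom_tensor_map inc map_vec_comp star_homD(1,2)[OF inc(1)] V_def)
  have "map_vec (comult \<Gamma>) W = map_vec (tensor_map incl2 incl2) (map_vec G2.\<Delta> U2)"
    by (simp add: W_def map_vec_comp comult_incl)
  then have comult_W: "map_vec (comult \<Gamma>) W = map_vec ?i1 W \<odot> map_vec ?i2 W"
    by (simp add: D2(4) A.map_vec_mult star_hom_tensor_map inc map_vec_comp star_homD(1,2)[OF inc(2)] W_def)
  have swap: "map_vec ?i2 V \<odot> map_vec ?i1 W = map_vec ?i1 W \<odot> map_vec ?i2 V"
  proof -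
    \<comment> \<open>\<open>?h\<close> sends the first factor to the second copy of the product and
      the second factor to the first copy. It transports the commutation of \<open>V\<close> and
      \<open>W\<close> within one copy to commutation across the two copies.\<close>
    let ?h = "tensor_lift (\<lambda>a b. ?i2 (incl1 a) * ?i1 (incl2 b))"
    have a: "star_hom (\<lambda>a. ?i2 (incl1 a))" and b: "star_hom (\<lambda>b. ?i1 (incl2 b))"
      by (intro star_hom_comp[OF i(2)] star_hom_comp[OF i(1)] inc)+
    have h: "star_hom ?h"
      by (rule star_hom_tensor_lift[OF a b]) simp
    have bil: "cbilinear (\<lambda>a b. ?i2 (incl1 a) * ?i1 (incl2 b))"
      by (rule cbilinear_mult[OF star_homD(1)[OF a] star_homD(1)[OF b]])
    have "?h (incl1 a) = ?i2 (incl1 a)" "?h (incl2 b) = ?i1 (incl2 b)" for a b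
      using tensor_lift_tprod[OF bil, of a 1] tensor_lift_tprod[OF bil, of 1 b]
        star_homD(2)[OF a] star_homD(2)[OF b]
      by (simp_all add: incl1_def[of a] incl2_def[of b])
    then have "map_vec ?h V = map_vec ?i2 V" "map_vec ?h W = map_vec ?i1 W"
      by (simp_all add: V_def W_def map_vec_comp)
    then show ?thesis
      using arg_cong[OF V_W_commute[OF tf], of "map_vec ?h"] by (simp add: A.map_vec_mult h del: tprod_mult)
  qed
  have "map_vec (comult \<Gamma>) (V \<odot> W) =
      map_vec ?i1 V \<odot> ((map_vec ?i2 V \<odot> map_vec ?i1 W) \<odot> map_vec ?i2 W)"
    using V_carrier W_carrier
    by (simp add: A.map_vec_mult star_hom_product_comult comult_V comult_W A.mult_assoc)
  then have comult: "map_vec (comult \<Gamma>) (V \<odot> W) = map_vec ?i1 (V \<odot> W) \<odot> map_vec ?i2 (V \<odot> W)"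
    using V_carrier W_carrier unfolding swap by (simp add: A.map_vec_mult i A.mult_assoc)
  have "map_vec (counit \<Gamma>) V = aone A" "map_vec (counit \<Gamma>) W = aone A"
    using D1(5) D2(5)
    by (simp_all add: V_def W_def map_vec_comp incl1_def incl2_def product_counit_tprod G1.counit_one G2.counit_one)
  then have counit: "map_vec (counit \<Gamma>) (V \<odot> W) = aone A"
    by (simp add: A.map_vec_mult star_hom_product_counit amplify2_complex[OF A.bilinear_amult] A.aone_mult)
  have "\<alpha> a = V \<odot> W \<odot> vec_tprod a 1 \<odot> A.star_amp (V \<odot> W)" if "a \<in> acarrier A" for a
    using inner_VW[OF that] V_carrier W_carrier that by (simp add: A.star_amp_mult A.mult_assoc)
  then show ?thesis
    using A.unitary_mult[OF unitary_V unitary_W] comult counit by (simp add: A.implements_iff A.unitary_def)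
qed

end

lemma (in dqg_pair) torsion_free_product:
  assumes tf1: "torsion_free \<Gamma>\<^sub>1" and tf2: "torsion_free \<Gamma>\<^sub>2"
  shows "torsion_free \<Gamma>"
  unfolding torsion_free_def
proof (intro allI impI)
  fix A and \<alpha> :: "complex vec \<Rightarrow> ('a, 'b) tensor vec"
  assume \<alpha>: "coaction \<Gamma> A \<alpha>"
  obtain U1 where U1: "implements \<Gamma>\<^sub>1 A (\<lambda>x. map_vec proj1 (\<alpha> x)) U1"
    using torsion_free_implements[OF G1.dqg_axioms tf1 coaction_proj(1)[OF \<alpha>]] by blast
  \<comment> \<open>This bimodule serves twice: its corners split the commutator into bicharacters,
    and \<open>bimodule_of_implements\<close> makes it equivariant for the product.\<close>
  obtain k m l r lip rip U2 where imp: "imprimitivity A (trivial_algebra k) m l r lip rip"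
    and U2: "implements \<Gamma>\<^sub>2 A (\<lambda>x. map_vec proj2 (\<alpha> x)) U2"
    using torsion_free_implements[OF G2.dqg_axioms tf2 coaction_proj(2)[OF \<alpha>]] by blast
  interpret trivial_imprimitivity A k m l r lip rip
    using imp by (simp add: trivial_imprimitivity_def)
  interpret product_coaction \<Gamma>\<^sub>1 \<Gamma>\<^sub>2 A k m l r lip rip \<alpha> U1 U2
    by unfold_locales (rule \<alpha> U1 U2)+
  show "\<exists>k. equivariantly_morita_equivalent \<Gamma> A \<alpha> (trivial_algebra k) trivial_coaction"
    using bimodule_of_implements[OF dqg.intro[OF dqg_product] implements_VW[OF tf2]] by blast
qed

theorem theorem3p17:
  fixes \<Gamma>\<^sub>1 :: "'a::complex_star_algebra quantum_group"
    and \<Gamma>\<^sub>2 :: "'b::complex_star_algebra quantum_group"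
  assumes "discrete_quantum_group \<Gamma>\<^sub>1" and "torsion_free \<Gamma>\<^sub>1"
    and "discrete_quantum_group \<Gamma>\<^sub>2" and "torsion_free \<Gamma>\<^sub>2"
  shows "discrete_quantum_group (cartesian_product \<Gamma>\<^sub>1 \<Gamma>\<^sub>2) \<and>
    torsion_free (cartesian_product \<Gamma>\<^sub>1 \<Gamma>\<^sub>2)"
proof -
  interpret dqg_pair \<Gamma>\<^sub>1 \<Gamma>\<^sub>2
    using assms by unfold_locales
  show ?thesis using dqg_product torsion_free_product assms by blast
qed

end
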